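(* Let $\xi$ be a (possibly killed) subordinator with Laplace exponent $\phi\not\equiv0$ and harmonic potential measure $H$, and let $R$ be the remainder random variable associated with its exponential functional. Then the Laplace exponent of $\log R$, i.e. the function $\lambda\mapsto\log\mathbf{E}[R^\lambda]$, is given by $$\log\Gamma_\phi(\lambda+1)=-\lambda\gamma_\phi+\int_{(0,\infty)}\left(e^{-\lambda x}-1+\lambda x\right)\frac{e^{-x}}{1-e^{-x}}\,H(dx),\qquad \lambda>-1.$$ The Lévy measure of (the infinitely divisible random variable) $\log R$ is the image under the map $x\mapsto -x$ of the measure $\mathbf{1}_{\{x>0\}}(e^x-1)^{-1}H(dx)$. Furthermore, the following equalities hold: $$\log R\stackrel{(d)}{=}\log\phi(1)+\sum_{k=1}^\infty\left(\phi_k(1)-G^{(k)}\right)=-\gamma_\phi+\sum_{k=1}^\infty\left(\mathbf{E}[G^{(k)}]-G^{(k)}\right),$$ where $(G^{(k)},k\ge1)$ are independent random variables such that, for each $k=1,2,\dots$, $G^{(k)}$ is a copy of $G_{\mathbf{e}_k}$, with $\mathbf{E}[G^{(k)}]=\frac{\phi'(k)}{\phi(k)}$ and $$\phi_k(1)=-\log\mathbf{E}\left[e^{-G^{(k)}}\right]=\int_{(0,\infty)}(1-e^{-x})e^{-kx}\,H(dx)=\log\frac{\phi(k+1)}{\phi(k)}.$$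
   Context: A (possibly killed) subordinator $\xi$ is a $[0,\infty]$-valued Lévy process with non-decreasing paths, started at $0$, with absorbing state $+\infty$; convention $e^{-\infty}=0$. Its Laplace exponent is $\phi(\lambda)=-\log\mathbf{E}[e^{-\lambda\xi_1}]=q+\lambda a+\int_{(0,\infty)}(1-e^{-\lambda x})\Pi(dx)$, with killing term $q\ge0$, drift $a\ge0$ and Lévy measure $\Pi$ on $(0,\infty)$ with $\int(x\wedge1)\Pi(dx)<\infty$. The trivial case $\phi\equiv0$ is excluded. Harmonic potential measure: $H(dx)=\int_0^\infty\frac{dt}{t}\mathbf{P}(\xi_t\in dx)$ on $x\in(0,\infty)$. Remainder random variable: $R$ is a positive random variable whose law is the (unique, moment-determinate) law with $\mathbf{E}[R^n]=\prod_{i=1}^n\phi(i)$, $n\ge1$. Last positions: for $t>0$, $L_t=\inf\{s>0:\xi_s>t\}$ and $G_t=\xi_{L_t-}$. For $k\ge1$, $\mathbf{e}_k$ is an exponential random variable with parameter $k$ independent of $\xi$, and $G_{\mathbf{e}_k}$ is $G_t$ at $t=\mathbf{e}_k$. Generalized gamma function of $\phi$: $\gamma_\phi=\lim_{n\to\infty}\left(\sum_{j=1}^n\frac{\phi'(j)}{\phi(j)}-\log\phi(n)\right)$ and $$\Gamma_\phi(s)=\frac{e^{-\gamma_\phi s}}{\phi(s)}\prod_{n=1}^\infty\frac{\phi(n)}{\phi(n+s)}e^{s\phi'(n)/\phi(n)},\quad s>0.$$ Infinite series of random variables are limits of their partial sums; $\stackrel{(d)}{=}$ denotes equality in distribution.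 *)

theory Defs
  imports "HOL-Probability.Probability"
begin

definition process_events :: "'a measure \<Rightarrow> (real \<Rightarrow> 'a \<Rightarrow> ennreal) \<Rightarrow> real set \<Rightarrow> 'a set set" where
  "process_events M \<xi> T =
     sigma_sets (space M) (\<Union>t\<in>T. {\<xi> t -` B \<inter> space M | B. B \<in> sets borel})"

text \<open>
  Possibly killed subordinators. Time is \<open>[0,\<infinity>)\<close>; values at negative times are never used.
  Left limits, and the absorption at \<open>\<infinity>\<close>, follow from monotonicity. The increments are
  stationary and independent of the past as long as the process is alive, that is, on
  \<open>\<xi> s < \<infinity>\<close>, the past up to \<open>s\<close> being \<open>process_events M \<xi> {0..s}\<close>; the increment takes the value \<open>\<infinity>\<close> if killing occurs between \<open>s\<close> and \<open>s + t\<close>.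
\<close>

definition subordinator :: "'a measure \<Rightarrow> (real \<Rightarrow> 'a \<Rightarrow> ennreal) \<Rightarrow> bool" where
  "subordinator M \<xi> \<longleftrightarrow>
     prob_space M \<and>
     (\<forall>t\<ge>0. \<xi> t \<in> borel_measurable M) \<and>
     (\<forall>\<omega>\<in>space M. \<xi> 0 \<omega> = 0 \<and>
        mono_on {0..} (\<lambda>t. \<xi> t \<omega>) \<and>
        (\<forall>t\<ge>0. ((\<lambda>s. \<xi> s \<omega>) \<longlongrightarrow> \<xi> t \<omega>) (at_right t))) \<and>
     (\<forall>s\<ge>0. \<forall>t\<ge>0. \<forall>A\<in>process_events M \<xi> {0..s}. \<forall>B\<in>sets borel.
        measure M (A \<inter> {\<omega>\<in>space M. \<xi> s \<omega> < \<infinity> \<and> \<xi> (s + t) \<omega> - \<xi> s \<omega> \<in> B}) =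
        measure M (A \<inter> {\<omega>\<in>space M. \<xi> s \<omega> < \<infinity>}) * measure M {\<omega>\<in>space M. \<xi> t \<omega> \<in> B})"

text \<open>\<open>exp (- u x)\<close> with \<open>exp (- \<infinity>) = 0\<close>, also for \<open>u = 0\<close>, so that the Laplace exponent
  at \<open>0\<close> is the killing rate.\<close>

definition exp_neg :: "real \<Rightarrow> ennreal \<Rightarrow> real" where
  "exp_neg u x = (if x = \<infinity> then 0 else exp (- u * enn2real x))"

definition laplace_exponent :: "'a measure \<Rightarrow> (real \<Rightarrow> 'a \<Rightarrow> ennreal) \<Rightarrow> real \<Rightarrow> real" where
  "laplace_exponent M \<xi> u = - ln (\<integral>\<omega>. exp_neg u (\<xi> 1 \<omega>) \<partial>M)"

text \<open>The harmonic potential measure lives on \<open>(0,\<infinity>)\<close>; it is represented as a Borel measure on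
  the real line that does not charge \<open>(-\<infinity>,0]\<close>. The set function below is indeed a measure,
  see \<open>emeasure_harmonic_potential\<close>.\<close>

definition harmonic_potential :: "'a measure \<Rightarrow> (real \<Rightarrow> 'a \<Rightarrow> ennreal) \<Rightarrow> real measure" where
  "harmonic_potential M \<xi> = measure_of UNIV (sets borel)
     (\<lambda>B. \<integral>\<^sup>+t\<in>{0<..}. (ennreal (1 / t) *
            emeasure M {\<omega>\<in>space M. \<xi> t \<omega> \<in> ennreal ` (B \<inter> {0<..})}) \<partial>lborel)"

lemma sets_harmonic_potential [simp, measurable_cong]: "sets (harmonic_potential M \<xi>) = sets borel"
proof -
  have "sigma_sets UNIV (sets (borel :: real measure)) = sets borel"
    by (metis sets.sigma_sets_eq space_borel)
  then show ?thesis
    by (simp add: harmonic_potential_def)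
qed

lemma ennreal_image_borel:
  assumes "B \<in> sets (borel :: real measure)"
  shows "ennreal ` (B \<inter> {0<..}) \<in> sets borel"
proof -
  have "ennreal ` (B \<inter> {0<..}) = {x \<in> space borel. x \<noteq> \<infinity> \<and> enn2real x \<in> B \<inter> {0<..}}"
  proof (intro equalityI subsetI)
    fix x :: ennreal assume "x \<in> {x \<in> space borel. x \<noteq> \<infinity> \<and> enn2real x \<in> B \<inter> {0<..}}"
    then show "x \<in> ennreal ` (B \<inter> {0<..})"
      by (intro image_eqI[of _ _ "enn2real x"]) (auto simp: top.not_eq_extremum)
  qed auto
  also have "\<dots> \<in> sets borel" using assms by measurable
  finally show ?thesis .
qed

lemma subordinator_prob_measurable:
  assumes "subordinator M \<xi>" and C: "C \<in> sets borel"
  shows "(\<lambda>t. emeasure M {\<omega>\<in>space M. \<xi> t \<omega> \<in> C} * indicator {0<..} t) \<in> borel_measurable borel"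
proof -
  interpret prob_space M using assms(1) by (simp add: subordinator_def)
  have meas: "\<xi> t \<in> borel_measurable M" if "t \<ge> 0" for t
    using assms(1) that by (simp add: subordinator_def)
  have mono: "\<xi> s \<omega> \<le> \<xi> t \<omega>" if "\<omega> \<in> space M" "0 \<le> s" "s \<le> t" for s t \<omega>
    using assms(1) that by (auto simp: subordinator_def mono_on_def)
  have ev: "{\<omega>\<in>space M. \<xi> t \<omega> \<in> C} \<in> events" if "t > 0" "C \<in> sets borel" for t C
    using measurable_sets[OF meas[of t] that(2)] that(1) by (simp add: vimage_def Int_def conj_commute)
  let ?F = "\<lambda>C t. prob {\<omega>\<in>space M. \<xi> t \<omega> \<in> C} * indicator {0<..} t"
  have eq: "sets (borel :: ennreal measure) = sigma_sets UNIV (range greaterThan)"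
    by (simp add: borel_Ioi)
  have "Int_stable (range (greaterThan :: ennreal \<Rightarrow> ennreal set))"
  proof (rule Int_stableI_image)
    fix i j :: ennreal
    have "{i<..} \<inter> {j<..} = {max i j<..}" by auto
    then show "\<exists>k\<in>UNIV. {i<..} \<inter> {j<..} = {k<..}" by blast
  qed
  moreover have "range (greaterThan :: ennreal \<Rightarrow> ennreal set) \<subseteq> Pow UNIV" by simp
  moreover from C eq have "C \<in> sigma_sets UNIV (range greaterThan)" by simp
  ultimately have "?F C \<in> borel_measurable borel"
  proof (induction rule: sigma_sets_induct_disjoint)
    case (basic A)
    then obtain c where A: "A = {c<..}" by auto
    have "mono (?F A)"
    proof (rule monoI)
      fix s t :: real assume st: "s \<le> t"
      show "?F A s \<le> ?F A t"
      proof (cases "0 < s")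
        case True
        have "{\<omega>\<in>space M. \<xi> s \<omega> \<in> A} \<subseteq> {\<omega>\<in>space M. \<xi> t \<omega> \<in> A}"
          using mono[of _ s t] True st by (auto simp: A intro: less_le_trans)
        then show ?thesis
          using True st ev[of t A] by (auto simp: A intro!: finite_measure_mono)
      qed (auto simp: indicator_def)
    qed
    then show ?case by (rule borel_measurable_mono)
  next
    case empty
    then show ?case by simp
  next
    case (compl A)
    have "?F (UNIV - A) = (\<lambda>t. indicator {0<..} t - ?F A t)"
    proof
      fix t
      have "{\<omega>\<in>space M. \<xi> t \<omega> \<in> UNIV - A} = space M - {\<omega>\<in>space M. \<xi> t \<omega> \<in> A}" by auto
      then show "?F (UNIV - A) t = indicator {0<..} t - ?F A t"
        using compl(1) eq ev[of t A] by (cases "0 < t") (auto simp: prob_compl)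
    qed
    then show ?case using compl(2) by simp
  next
    case (union A)
    have "?F (\<Union>i. A i) = (\<lambda>t. \<Sum>i. ?F (A i) t)"
    proof
      fix t
      show "?F (\<Union>i. A i) t = (\<Sum>i. ?F (A i) t)"
      proof (cases "0 < t")
        case True
        have "(\<lambda>i. prob {\<omega>\<in>space M. \<xi> t \<omega> \<in> A i}) sums prob (\<Union>i. {\<omega>\<in>space M. \<xi> t \<omega> \<in> A i})"
          using union(1,2) eq True ev
          by (intro finite_measure_UNION) (auto simp: disjoint_family_on_def)
        moreover have "(\<Union>i. {\<omega>\<in>space M. \<xi> t \<omega> \<in> A i}) = {\<omega>\<in>space M. \<xi> t \<omega> \<in> (\<Union>i. A i)}"
          by auto
        ultimately show ?thesis using True by (simp add: sums_iff)
      qed simp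
    qed
    then show ?case using union(3) by simp
  qed
  then have "(\<lambda>t. ennreal (?F C t)) \<in> borel_measurable borel" by measurable
  also have "(\<lambda>t. ennreal (?F C t)) =
      (\<lambda>t. emeasure M {\<omega>\<in>space M. \<xi> t \<omega> \<in> C} * indicator {0<..} t)"
    by (auto simp: fun_eq_iff indicator_def emeasure_eq_measure)
  finally show ?thesis .
qed

lemma emeasure_harmonic_potential:
  assumes sub: "subordinator M \<xi>" and B: "B \<in> sets borel"
  shows "emeasure (harmonic_potential M \<xi>) B =
    (\<integral>\<^sup>+t\<in>{0<..}. (ennreal (1 / t) *
       emeasure M {\<omega>\<in>space M. \<xi> t \<omega> \<in> ennreal ` (B \<inter> {0<..})}) \<partial>lborel)"
  unfolding harmonic_potential_def
proof (rule emeasure_measure_of_sigma)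
  show "sigma_algebra UNIV (sets (borel :: real measure))"
    using sets.sigma_algebra_axioms[of borel] by simp
  let ?m = "\<lambda>B. \<integral>\<^sup>+t\<in>{0<..}. (ennreal (1 / t) *
       emeasure M {\<omega>\<in>space M. \<xi> t \<omega> \<in> ennreal ` (B \<inter> {0<..})}) \<partial>lborel"
  show "positive (sets borel) ?m" by (simp add: positive_def)
  have ev: "{\<omega>\<in>space M. \<xi> t \<omega> \<in> C} \<in> sets M" if "t > 0" "C \<in> sets borel" for t C
  proof -
    have "\<xi> t \<in> borel_measurable M" using sub that(1) by (simp add: subordinator_def)
    from measurable_sets[OF this that(2)] show ?thesis
      by (simp add: vimage_def Int_def conj_commute)
  qed
  show "countably_additive (sets borel) ?m"
    unfolding countably_additive_def
  proof (intro allI impI)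
    fix A :: "nat \<Rightarrow> real set"
    assume A: "range A \<subseteq> sets borel" "disjoint_family A" "\<Union> (range A) \<in> sets borel"
    let ?E = "\<lambda>B t. {\<omega>\<in>space M. \<xi> t \<omega> \<in> ennreal ` (B \<inter> {0<..})}"
    let ?f = "\<lambda>B t. ennreal (1 / t) * emeasure M (?E B t) * indicator {0<..} t"
    have meas: "?f (A i) \<in> borel_measurable lborel" for i
    proof -
      have "(\<lambda>t. ennreal (1 / t) * (emeasure M (?E (A i) t) * indicator {0<..} t))
          \<in> borel_measurable borel"
        using A(1)
        by (intro borel_measurable_times_ennreal subordinator_prob_measurable[OF sub]
            ennreal_image_borel) auto
      then show ?thesis by (simp add: mult.assoc)
    qed
    have "(\<Sum>i. ?m (A i)) = (\<integral>\<^sup>+t. (\<Sum>i. ?f (A i) t) \<partial>lborel)"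
      by (rule nn_integral_suminf[symmetric]) (rule meas)
    also have "(\<lambda>t. \<Sum>i. ?f (A i) t) = ?f (\<Union> (range A))"
    proof
      fix t
      show "(\<Sum>i. ?f (A i) t) = ?f (\<Union> (range A)) t"
      proof (cases "0 < t")
        case True
        have disj: "disjoint_family (\<lambda>i. ?E (A i) t)"
          using A(2) unfolding disjoint_family_on_def by fastforce
        have "(\<Sum>i. emeasure M (?E (A i) t)) = emeasure M (\<Union>i. ?E (A i) t)"
          using A(1) True disj
          by (intro suminf_emeasure) (auto intro!: ev ennreal_image_borel)
        also have "(\<Union>i. ?E (A i) t) = ?E (\<Union> (range A)) t" by auto
        finally show ?thesis using True by simp
      qed simp
    qed
    finally show "(\<Sum>i. ?m (A i)) = ?m (\<Union> (range A))" .
  qed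
qed (fact B)

text \<open>First passage time strictly above \<open>t\<close> (\<open>\<infinity>\<close> if the path stays below), and the left limit of
  the path there. Only the part of the path on \<open>[0,\<infinity>)\<close> enters the left limit.\<close>

definition first_passage :: "(real \<Rightarrow> 'a \<Rightarrow> ennreal) \<Rightarrow> real \<Rightarrow> 'a \<Rightarrow> ennreal" where
  "first_passage \<xi> t \<omega> = Inf {ennreal s | s. 0 < s \<and> ennreal t < \<xi> s \<omega>}"

definition left_limit :: "(real \<Rightarrow> ennreal) \<Rightarrow> ennreal \<Rightarrow> ennreal" where
  "left_limit f L =
     (if L = \<infinity> then Lim at_top f else Lim (at (enn2real L) within {0..<enn2real L}) f)"

text \<open>The last position is at most \<open>t\<close> for \<open>t > 0\<close>, so its conversion to a real number is harmless.\<close>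

definition last_position :: "(real \<Rightarrow> 'a \<Rightarrow> ennreal) \<Rightarrow> real \<Rightarrow> 'a \<Rightarrow> real" where
  "last_position \<xi> t \<omega> = enn2real (left_limit (\<lambda>s. \<xi> s \<omega>) (first_passage \<xi> t \<omega>))"

definition independent_exponential ::
    "'a measure \<Rightarrow> (real \<Rightarrow> 'a \<Rightarrow> ennreal) \<Rightarrow> real \<Rightarrow> ('a \<Rightarrow> real) \<Rightarrow> bool" where
  "independent_exponential M \<xi> r e \<longleftrightarrow>
     distributed M lborel e (exponential_density r) \<and>
     prob_space.indep_set M
       (process_events M \<xi> {0..}) {e -` B \<inter> space M | B. B \<in> sets borel}"

definition remainder :: "(real \<Rightarrow> real) \<Rightarrow> 'b measure \<Rightarrow> ('b \<Rightarrow> real) \<Rightarrow> bool" where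
  "remainder \<phi> N R \<longleftrightarrow>
     prob_space N \<and> R \<in> borel_measurable N \<and> (AE \<omega> in N. 0 < R \<omega>) \<and>
     (\<forall>n\<ge>1. has_bochner_integral N (\<lambda>\<omega>. R \<omega> ^ n) (\<Prod>i=1..n. \<phi> (real i)))"

definition gamma_seq :: "(real \<Rightarrow> real) \<Rightarrow> nat \<Rightarrow> real" where
  "gamma_seq \<phi> n = (\<Sum>j=1..n. deriv \<phi> (real j) / \<phi> (real j)) - ln (\<phi> (real n))"

definition gamma_const :: "(real \<Rightarrow> real) \<Rightarrow> real" where
  "gamma_const \<phi> = lim (gamma_seq \<phi>)"

definition gamma_factor :: "(real \<Rightarrow> real) \<Rightarrow> real \<Rightarrow> nat \<Rightarrow> real" where
  "gamma_factor \<phi> s n =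
     \<phi> (real n) / \<phi> (real n + s) * exp (s * deriv \<phi> (real n) / \<phi> (real n))"

definition gen_Gamma :: "(real \<Rightarrow> real) \<Rightarrow> real \<Rightarrow> real" where
  "gen_Gamma \<phi> s =
     exp (- gamma_const \<phi> * s) / \<phi> s * (\<Prod>n. gamma_factor \<phi> s (Suc n))"

definition infinitely_divisible :: "real measure \<Rightarrow> bool" where
  "infinitely_divisible \<mu> \<longleftrightarrow>
     (\<forall>n\<ge>1. \<exists>\<nu>. real_distribution \<nu> \<and> ((\<lambda>\<rho>. \<nu> \<star> \<rho>) ^^ n) (return borel 0) = \<mu>)"

text \<open>\<open>\<nu>\<close> is the Levy measure of \<open>\<mu>\<close>: it is the jump measure in the Levy--Khintchine
  representation of \<open>\<mu>\<close>, with shift \<open>b\<close> and Gaussian variance \<open>v\<close>.\<close>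

definition has_levy_measure :: "real measure \<Rightarrow> real measure \<Rightarrow> bool" where
  "has_levy_measure \<mu> \<nu> \<longleftrightarrow>
     sets \<nu> = sets borel \<and> emeasure \<nu> {0} = 0 \<and>
     (\<integral>\<^sup>+x. ennreal (min 1 (x\<^sup>2)) \<partial>\<nu>) < \<infinity> \<and>
     (\<exists>b v. 0 \<le> v \<and> (\<forall>u. char \<mu> u =
        exp (\<i> * of_real (b * u) - of_real (v * u\<^sup>2 / 2) +
          (\<integral>x. (iexp (u * x) - 1 - \<i> * of_real (u * x * indicator {-1..1} x)) \<partial>\<nu>))))"

end

theory Submission
  imports Defs "HOL-Complex_Analysis.Complex_Analysis"
begin

text \<open>
Everything rests on the identity
  \<open>\<integral> (1 - exp (- l x)) exp (- s x) H(dx) = ln (\<phi> (s + l) / \<phi> s)\<close>, which is a Frullani integral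
  because \<open>E exp (- s \<xi>\<^sub>t) = exp (- t \<phi> s)\<close>. With \<open>l = 1\<close>, \<open>s = k\<close> it is the formula for \<open>\<phi>\<^sub>k 1\<close>;
  its derivative at \<open>l = 0\<close> is \<open>\<phi>' s / \<phi> s = \<integral> x exp (- s x) H(dx)\<close>. Hence the logarithm of the
  \<open>k\<close>-th factor of the infinite product defining the gamma function is
  \<open>\<integral> (exp (- u x) - 1 + u x) exp (- k x) H(dx) \<ge> 0\<close>. Summing the geometric series over \<open>k\<close>
  gives the integral \<open>I u\<close> of the theorem, the convergence of the product, and, by telescoping,
  \<open>I (u + 1) - I u = \<gamma> + ln (\<phi> (u + 1))\<close>. So \<open>ln \<Gamma>\<^sub>\<phi> (u + 1) = - u \<gamma> + I u\<close>.

  Next, let \<open>G\<^sub>k\<close> be independent with \<open>E exp (- u G\<^sub>k) = \<phi> k / \<phi> (k + u)\<close>. Then the exponential moment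
  \<open>E exp (u (E G\<^sub>k - G\<^sub>k))\<close> is the \<open>k\<close>-th factor of the product above. As the product converges also for
  \<open>u = \<plusminus> 1 / 2\<close>, the variances are summable, the series \<open>\<Sum> (E G\<^sub>k - G\<^sub>k)\<close> converges almost surely by
  Kolmogorov's maximal inequality, and \<open>X = - \<gamma> + \<Sum> (E G\<^sub>k - G\<^sub>k)\<close> satisfies
  \<open>E exp (u X) = exp (- u \<gamma> + I u)\<close>. At integers this is \<open>E exp (n X) = \<phi> 1 \<cdots> \<phi> n\<close>. Since
  \<open>\<phi> n \<le> n \<phi> 1\<close>, these moments grow at most like \<open>C\<^sup>n n!\<close> and determine the law, so \<open>ln R\<close> and \<open>X\<close>
  have the same law. The other series of the theorem differs from \<open>X\<close> termwise by constants, which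
  sum to \<open>\<gamma> + ln (\<phi> 1)\<close>.

  Two sources of such variables \<open>G\<^sub>k\<close> are needed. The last positions: approximating the first passage
  time of the level by dyadic times reduces their Laplace transform to a geometric series of one-step
  increments. And a construction that does not presuppose exponential variables: \<open>1 / \<phi>\<close> is the
  Laplace transform of the potential measure of \<open>\<xi>\<close>, so tilting that measure by \<open>exp (- k x)\<close> and
  normalizing gives a law with the required transform. Weighting time by a gamma density instead of
  Lebesgue measure replaces \<open>\<phi>\<close> by the power \<open>\<phi>\<^sup>\<alpha>\<close>, and then \<open>X\<close> by a variable with transform
  \<open>exp (\<alpha> (- u \<gamma> + I u))\<close>; with \<open>\<alpha> = 1 / n\<close> this is the \<open>n\<close>-th convolution root that infinite
  divisibility asks for.

  The Levy--Khintchine formula follows because \<open>E exp (z X)\<close> and \<open>exp (- z \<gamma> + I z)\<close> are holomorphic on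
  \<open>Re z > -1\<close> and agree on a real interval, hence also on the imaginary axis. The same argument,
  applied to two Laplace transforms, is the uniqueness theorem used throughout.\<close>

section \<open>Holomorphic parameter integrals and uniqueness of laws\<close>

text \<open>Holomorphy makes a domination of the integrand alone sufficient: by Cauchy's inequality it
  dominates the derivative, hence the difference quotients, on the ball of half the radius.\<close>

lemma has_field_derivative_parameter_integral:
  fixes f :: "complex \<Rightarrow> 'a \<Rightarrow> complex"
  assumes r: "0 < r"
    and hol: "\<And>x. x \<in> space M \<Longrightarrow> (\<lambda>z. f z x) holomorphic_on ball z0 r"
    and meas: "\<And>z. z \<in> ball z0 r \<Longrightarrow> f z \<in> borel_measurable M"
    and g: "integrable M g"
    and bound: "AE x in M. \<forall>z\<in>ball z0 r. norm (f z x) \<le> g x"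
  shows "integrable M (\<lambda>x. deriv (\<lambda>z. f z x) z0)"
    and "((\<lambda>z. \<integral>x. f z x \<partial>M) has_field_derivative (\<integral>x. deriv (\<lambda>z. f z x) z0 \<partial>M)) (at z0)"
proof -
  have int: "integrable M (f z)" if "z \<in> ball z0 r" for z
    by (rule Bochner_Integration.integrable_bound[OF g meas[OF that]])
       (use bound that in \<open>auto elim!: eventually_mono intro!: order.trans[OF _ abs_ge_self]\<close>)
  have diff: "((\<lambda>z. f z x) has_field_derivative deriv (\<lambda>z. f z x) w) (at w)"
    if "x \<in> space M" "w \<in> ball z0 r" for x w
    using hol[OF that(1)] that(2) by (intro holomorphic_derivI[where S="ball z0 r"]) auto
  have dbound: "norm (deriv (\<lambda>z. f z x) w) \<le> g x / (r / 2)"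
    if x: "x \<in> space M" and gx: "\<forall>z\<in>ball z0 r. norm (f z x) \<le> g x" and w: "w \<in> ball z0 (r / 2)" for x w
  proof -
    have sub: "cball w (r / 2) \<subseteq> ball z0 r"
      using w by (metis add_less_cancel_right cball_subset_ball_iff dist_commute field_sum_of_halves mem_ball)
    have "norm ((deriv ^^ 1) (\<lambda>z. f z x) w) \<le> fact 1 * g x / (r / 2) ^ 1"
    proof (rule Cauchy_inequality)
      show "(\<lambda>z. f z x) holomorphic_on ball w (r / 2)"
        using hol[OF x] sub by (meson ball_subset_cball holomorphic_on_subset order.trans)
      show "continuous_on (cball w (r / 2)) (\<lambda>z. f z x)"
        using hol[OF x] sub holomorphic_on_imp_continuous_on holomorphic_on_subset by blast
      show "norm (f z x) \<le> g x" if "norm (w - z) = r / 2" for z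
        using that sub by (intro gx[rule_format]) (auto simp: dist_norm)
    qed (use r in auto)
    then show ?thesis by simp
  qed
  have key: "integrable M (\<lambda>x. deriv (\<lambda>z. f z x) z0) \<and>
      (\<lambda>i. ((\<integral>x. f (X i) x \<partial>M) - (\<integral>x. f z0 x \<partial>M)) / (X i - z0)) \<longlonglongrightarrow>
        (\<integral>x. deriv (\<lambda>z. f z x) z0 \<partial>M)"
    if X: "\<And>i. X i \<in> ball z0 (r / 2)" "\<And>i. X i \<noteq> z0" "X \<longlonglongrightarrow> z0" for X :: "nat \<Rightarrow> complex"
  proof -
    let ?q = "\<lambda>i x. (f (X i) x - f z0 x) / (X i - z0)"
    have Xr: "X i \<in> ball z0 r" for i using X(1)[of i] r by auto
    have z0: "z0 \<in> ball z0 r" using r by simp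
    have lim: "(\<lambda>i. ?q i x) \<longlonglongrightarrow> deriv (\<lambda>z. f z x) z0" if "x \<in> space M" for x
    proof -
      have "((\<lambda>y. (f y x - f z0 x) / (y - z0)) \<longlongrightarrow> deriv (\<lambda>z. f z x) z0) (at z0)"
        using diff[OF that z0] by (simp add: has_field_derivative_iff)
      then show ?thesis
        using X(2,3) by (auto simp: tendsto_at_iff_sequentially o_def)
    qed
    have qm: "?q i \<in> borel_measurable M" for i
      using meas[OF Xr[of i]] meas[OF z0] by measurable
    have dm: "(\<lambda>x. deriv (\<lambda>z. f z x) z0) \<in> borel_measurable M"
      by (rule borel_measurable_LIMSEQ_metric[OF qm lim])
    have qb: "norm (?q i x) \<le> g x / (r / 2)"
      if x: "x \<in> space M" and gx: "\<forall>z\<in>ball z0 r. norm (f z x) \<le> g x" for i x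
    proof -
      have "norm (f (X i) x - f z0 x) \<le> g x / (r / 2) * norm (X i - z0)"
      proof (rule field_differentiable_bound[OF convex_ball[of z0 "r / 2"], where f'="deriv (\<lambda>z. f z x)"])
        fix z assume z: "z \<in> ball z0 (r / 2)"
        then have "z \<in> ball z0 r" using r by auto
        then show "((\<lambda>z. f z x) has_field_derivative deriv (\<lambda>z. f z x) z) (at z within ball z0 (r / 2))"
          by (rule has_field_derivative_at_within[OF diff[OF x]])
        show "norm (deriv (\<lambda>z. f z x) z) \<le> g x / (r / 2)" by (rule dbound[OF x gx z])
      qed (use X(1)[of i] r in auto)
      then show ?thesis using X(2)[of i] by (simp add: norm_divide divide_le_eq)
    qed
    have gi: "integrable M (\<lambda>x. g x / (r / 2))" using g by simp
    have AEl: "AE x in M. (\<lambda>i. ?q i x) \<longlonglongrightarrow> deriv (\<lambda>z. f z x) z0" using lim by (intro AE_I2)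
    have AEb: "AE x in M. norm (?q i x) \<le> g x / (r / 2)" for i
      using AE_space bound by eventually_elim (rule qb)
    have eq: "(\<integral>x. ?q i x \<partial>M) = ((\<integral>x. f (X i) x \<partial>M) - (\<integral>x. f z0 x \<partial>M)) / (X i - z0)" for i
      using int[OF Xr[of i]] int[OF z0] by simp
    have "integrable M (\<lambda>x. deriv (\<lambda>z. f z x) z0)"
      by (rule integrable_dominated_convergence[OF dm qm gi AEl AEb])
    moreover have "(\<lambda>i. \<integral>x. ?q i x \<partial>M) \<longlonglongrightarrow> (\<integral>x. deriv (\<lambda>z. f z x) z0 \<partial>M)"
      by (rule integral_dominated_convergence[OF dm qm gi AEl AEb])
    ultimately show ?thesis by (simp only: eq simp_thms)
  qed
  define e where "e i = r / 2 * inverse (real (Suc (Suc i)))" for i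
  have e: "0 < e i" "e i < r / 2" for i
  proof -
    have "inverse (real (Suc (Suc i))) < 1" by (intro inverse_less_1_iff[THEN iffD2]) simp
    then show "e i < r / 2" unfolding e_def using mult_strict_left_mono[of _ 1 "r / 2"] r by simp
  qed (use r in \<open>simp add: e_def\<close>)
  have "e \<longlonglongrightarrow> r / 2 * 0"
    unfolding e_def by (intro tendsto_intros LIMSEQ_Suc[OF LIMSEQ_inverse_real_of_nat])
  then have "(\<lambda>i. z0 + of_real (e i)) \<longlonglongrightarrow> z0 + of_real 0"
    by (intro tendsto_intros) simp
  moreover have "z0 + of_real (e i) \<in> ball z0 (r / 2)" "z0 + of_real (e i) \<noteq> z0" for i
    using e[of i] by (auto simp: dist_norm)
  ultimately show "integrable M (\<lambda>x. deriv (\<lambda>z. f z x) z0)"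
    using key[of "\<lambda>i. z0 + of_real (e i)"] by simp
  show "((\<lambda>z. \<integral>x. f z x \<partial>M) has_field_derivative (\<integral>x. deriv (\<lambda>z. f z x) z0 \<partial>M)) (at z0)"
    unfolding has_field_derivative_iff tendsto_at_iff_sequentially
  proof (intro allI impI)
    fix X :: "nat \<Rightarrow> complex"
    assume X: "\<forall>i. X i \<in> UNIV - {z0}" "X \<longlonglongrightarrow> z0"
    from X(2) r obtain n where n: "\<And>i. i \<ge> n \<Longrightarrow> X i \<in> ball z0 (r / 2)"
      by (force simp: lim_sequentially dist_commute dest: spec[of _ "r / 2"])
    from key[of "\<lambda>i. X (i + n)"] n X
    have "(\<lambda>i. ((\<integral>x. f (X (i + n)) x \<partial>M) - (\<integral>x. f z0 x \<partial>M)) / (X (i + n) - z0))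
        \<longlonglongrightarrow> (\<integral>x. deriv (\<lambda>z. f z x) z0 \<partial>M)"
      by (auto intro: LIMSEQ_ignore_initial_segment)
    then show "((\<lambda>y. ((\<integral>x. f y x \<partial>M) - (\<integral>x. f z0 x \<partial>M)) / (y - z0)) \<circ> X)
        \<longlonglongrightarrow> (\<integral>x. deriv (\<lambda>z. f z x) z0 \<partial>M)"
      unfolding o_def by (rule LIMSEQ_offset)
  qed
qed

lemma holomorphic_eq_of_real_interval:
  assumes "f holomorphic_on S" "g holomorphic_on S" "open S" "connected S"
    and cd: "c < d" "\<And>u. c < u \<Longrightarrow> u < d \<Longrightarrow> complex_of_real u \<in> S"
    and eq: "\<And>u. c < u \<Longrightarrow> u < d \<Longrightarrow> f (complex_of_real u) = g (of_real u)"
    and z: "z \<in> S"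
  shows "f z = g z"
proof -
  let ?U = "complex_of_real ` {c<..<d}"
  let ?m = "(c + d) / 2"
  have m: "c < ?m" "?m < d" using cd(1) by auto
  have "?m islimpt {c<..<d}"
    using m islimpt_greaterThanLessThan1 by (simp add: open_imp_islimpt)
  then have "of_real ?m islimpt ?U"
    unfolding islimpt_sequential
  proof (elim exE conjE)
    fix X assume "\<forall>n. X n \<in> {c<..<d} - {?m}" "X \<longlonglongrightarrow> ?m"
    then show "\<exists>X. (\<forall>n. X n \<in> ?U - {of_real ?m}) \<and> X \<longlonglongrightarrow> complex_of_real ?m"
      by (intro exI[of _ "\<lambda>n. of_real (X n)"]) (auto intro!: tendsto_of_real simp del: of_real_divide of_real_add)
  qed
  then have "f z - g z = 0"
    using assms m by (intro analytic_continuation[of "\<lambda>z. f z - g z" S ?U "of_real ?m" z])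
      (auto intro!: holomorphic_intros simp del: of_real_divide of_real_add)
  then show ?thesis by simp
qed

lemma Laplace_transform_derivative:
  fixes M :: "real measure"
  assumes sets: "sets M = sets borel" and S: "open S"
    and int: "\<And>u. u \<in> S \<Longrightarrow> integrable M (\<lambda>x. exp (u * x))"
    and z: "Re z0 \<in> S"
  shows "((\<lambda>z. \<integral>x. exp (z * complex_of_real x) \<partial>M) has_field_derivative
     (\<integral>x. of_real x * exp (z0 * of_real x) \<partial>M)) (at z0)"
    and "integrable M (\<lambda>x. complex_of_real x * exp (z0 * of_real x))"
proof -
  from S z obtain r where r: "r > 0" "cball (Re z0) r \<subseteq> S" by (meson open_contains_cball)
  let ?g = "\<lambda>x. exp ((Re z0 - r) * x) + exp ((Re z0 + r) * x)"
  note [measurable_cong] = sets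
  have g: "integrable M ?g"
    using r by (intro Bochner_Integration.integrable_add int subsetD[OF r(2)]) (auto simp: dist_real_def)
  have d: "deriv (\<lambda>z. exp (z * complex_of_real x)) z0 = of_real x * exp (z0 * of_real x)" for x
    by (rule DERIV_imp_deriv) (auto intro!: derivative_eq_intros)
  have b: "norm (exp (z * complex_of_real x)) \<le> ?g x" if "z \<in> ball z0 r" for z x
  proof -
    have "\<bar>Re z - Re z0\<bar> \<le> r"
      using that abs_Re_le_cmod[of "z - z0"] by (auto simp: dist_norm norm_minus_commute)
    then have "Re z * x \<le> (Re z0 + r) * x \<or> Re z * x \<le> (Re z0 - r) * x"
      using mult_right_mono[of "Re z" "Re z0 + r" x] mult_right_mono_neg[of "Re z0 - r" "Re z" x]
      by linarith
    then show ?thesis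
      by (auto intro: order.trans[of _ "exp ((Re z0 + r) * x)"] order.trans[of _ "exp ((Re z0 - r) * x)"])
  qed
  have "AE x in M. \<forall>z\<in>ball z0 r. norm (exp (z * complex_of_real x)) \<le> ?g x"
    using b by (intro AE_I2) blast
  note D = has_field_derivative_parameter_integral[where f="\<lambda>z x. exp (z * complex_of_real x)" and M=M and g="?g", OF r(1) _ _ g this]
  show "integrable M (\<lambda>x. complex_of_real x * exp (z0 * of_real x))"
    unfolding d[symmetric] by (rule D(1)) (auto intro!: holomorphic_intros)
  show "((\<lambda>z. \<integral>x. exp (z * complex_of_real x) \<partial>M) has_field_derivative
     (\<integral>x. of_real x * exp (z0 * of_real x) \<partial>M)) (at z0)"
    unfolding d[symmetric] by (rule D(2)) (auto intro!: holomorphic_intros)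
qed

lemma integral_exp_of_real:
  "(\<integral>x. exp (complex_of_real u * complex_of_real (X x)) \<partial>M) = of_real (\<integral>x. exp (u * X x) \<partial>M)"
proof -
  have "(\<lambda>x. exp (complex_of_real u * complex_of_real (X x))) = (\<lambda>x. of_real (exp (u * X x)))"
    by (simp add: exp_of_real flip: of_real_mult)
  then show ?thesis by (simp only: integral_complex_of_real)
qed

text \<open>Parameter integrals are differentiated in the complex plane; this brings the result back to the
  real line.\<close>

lemma has_real_derivative_of_complex:
  assumes deriv: "(F has_field_derivative complex_of_real D) (at (complex_of_real x))"
    and eq: "\<forall>\<^sub>F y in nhds x. F (complex_of_real y) = complex_of_real (g y)"
  shows "(g has_real_derivative D) (at x)"
proof -
  have "filterlim complex_of_real (at (of_real x)) (at x)"
    by (auto simp: filterlim_at eventually_at_filter intro!: tendsto_intros)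
  from filterlim_compose[OF deriv[unfolded has_field_derivative_iff] this]
  have "((\<lambda>y. (F (of_real y) - F (of_real x)) / (of_real y - of_real x)) \<longlongrightarrow> complex_of_real D) (at x)" .
  moreover have "\<forall>\<^sub>F y in at x. (F (of_real y) - F (of_real x)) / (of_real y - of_real x) =
      complex_of_real ((g y - g x) / (y - x))"
    using filter_leD[OF at_within_le_nhds eq]
    by eventually_elim (use eq[THEN eventually_nhds_x_imp_x] in simp)
  ultimately have "((\<lambda>y. complex_of_real ((g y - g x) / (y - x))) \<longlongrightarrow> complex_of_real D) (at x)"
    by (rule Lim_transform_eventually)
  then show ?thesis by (simp only: tendsto_of_real_iff has_field_derivative_iff)
qed

lemma real_Laplace_transform_derivative:
  fixes M :: "real measure"
  assumes sets: "sets M = sets borel" and S: "open S"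
    and int: "\<And>u. u \<in> S \<Longrightarrow> integrable M (\<lambda>x. exp (u * x))"
    and u: "u \<in> S"
  shows "integrable M (\<lambda>x. x * exp (u * x))"
    and "((\<lambda>u. \<integral>x. exp (u * x) \<partial>M) has_real_derivative (\<integral>x. x * exp (u * x) \<partial>M)) (at u)"
proof -
  have u': "Re (complex_of_real u) \<in> S" using u by simp
  have eq: "(\<lambda>x. complex_of_real x * exp (of_real u * of_real x)) = (\<lambda>x. of_real (x * exp (u * x)))"
    by (simp add: exp_of_real flip: of_real_mult)
  have "integrable M (\<lambda>x. complex_of_real (x * exp (u * x)))"
    by (rule Laplace_transform_derivative(2)[OF sets S _ u', unfolded eq]) (rule int)
  then show "integrable M (\<lambda>x. x * exp (u * x))"
    by (simp only: complex_of_real_integrable_eq)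
  have "((\<lambda>z. \<integral>x. exp (z * complex_of_real x) \<partial>M) has_field_derivative
     complex_of_real (\<integral>x. x * exp (u * x) \<partial>M)) (at (of_real u))"
    by (rule Laplace_transform_derivative(1)[OF sets S _ u', unfolded eq integral_complex_of_real]) (rule int)
  then show "((\<lambda>u. \<integral>x. exp (u * x) \<partial>M) has_real_derivative (\<integral>x. x * exp (u * x) \<partial>M)) (at u)"
    by (rule has_real_derivative_of_complex) (intro always_eventually allI integral_exp_of_real)
qed

lemma Laplace_transform_holomorphic:
  fixes M :: "real measure"
  assumes "sets M = sets borel" and "open S"
    and "\<And>u. u \<in> S \<Longrightarrow> integrable M (\<lambda>x. exp (u * x))"
  shows "(\<lambda>z. \<integral>x. exp (z * complex_of_real x) \<partial>M) holomorphic_on {z. Re z \<in> S}"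
proof -
  have "open {z. Re z \<in> S}" using open_vimage[OF assms(2) continuous_on_Re[OF continuous_on_id]]
    by (simp add: vimage_def)
  then show ?thesis
    using Laplace_transform_derivative(1)[OF assms] by (auto simp: holomorphic_on_open)
qed

text \<open>The two transforms are holomorphic on the strip \<open>a < Re z < b\<close>; agreeing on a real interval, they
  agree on the imaginary axis, where they are the characteristic functions.\<close>

lemma Laplace_transform_unique:
  assumes M1: "real_distribution M1" and M2: "real_distribution M2" and ab: "a < 0" "0 < b"
    and int1: "\<And>u. a < u \<Longrightarrow> u < b \<Longrightarrow> integrable M1 (\<lambda>x. exp (u * x))"
    and int2: "\<And>u. a < u \<Longrightarrow> u < b \<Longrightarrow> integrable M2 (\<lambda>x. exp (u * x))"
    and eq: "\<And>u. 0 < u \<Longrightarrow> u < b \<Longrightarrow> (\<integral>x. exp (u * x) \<partial>M1) = (\<integral>x. exp (u * x) \<partial>M2)"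
  shows "M1 = M2"
proof (rule Levy_uniqueness[OF M1 M2])
  interpret M1: real_distribution M1 by fact
  interpret M2: real_distribution M2 by fact
  let ?S = "{z. Re z \<in> {a<..<b}}"
  let ?F = "\<lambda>M z. \<integral>x. exp (z * complex_of_real x) \<partial>M"
  have conv: "convex ?S"
    using convex_linear_vimage[of Re "{a<..<b}"] by (simp add: vimage_def bounded_linear_Re[THEN bounded_linear.linear])
  have op: "open ?S"
    using open_vimage[of "{a<..<b}" Re] by (simp add: vimage_def continuous_on_Re)
  show "char M1 = char M2"
  proof
    fix t :: real
    have "?F M1 (\<i> * t) = ?F M2 (\<i> * t)"
    proof (rule holomorphic_eq_of_real_interval[of "?F M1" ?S "?F M2" 0 b])
      show "?F M1 holomorphic_on ?S" "?F M2 holomorphic_on ?S"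
        using int1 int2 by (intro Laplace_transform_holomorphic; simp)+
      show "?F M1 (of_real u) = ?F M2 (of_real u)" if "0 < u" "u < b" for u
        using eq[OF that] by (simp only: integral_exp_of_real)
    qed (use conv op ab in \<open>auto intro: convex_connected\<close>)
    then show "char M1 t = char M2 t" by (simp add: char_def mult.assoc)
  qed
qed

text \<open>The bound on the moments makes the exponential series of \<open>E exp (u x)\<close> converge for \<open>0 < u < 1 / C\<close>;
  for \<open>u \<le> 0\<close> the transform of a nonnegative variable is finite anyway. So there is a strip around
  the imaginary axis as required by uniqueness of Laplace transforms.\<close>

lemma moments_determine_distribution:
  assumes M1: "real_distribution M1" and M2: "real_distribution M2" and C: "0 < C"
    and pos1: "AE x in M1. 0 \<le> x" and pos2: "AE x in M2. 0 \<le> x"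
    and mom1: "\<And>n. has_bochner_integral M1 (\<lambda>x. x ^ n) (m n)"
    and mom2: "\<And>n. has_bochner_integral M2 (\<lambda>x. x ^ n) (m n)"
    and bound: "\<And>n. m n \<le> C ^ n * fact n"
  shows "M1 = M2"
proof -
  have *: "integrable M (\<lambda>x. exp (u * x)) \<and> (0 < u \<longrightarrow> (\<integral>x. exp (u * x) \<partial>M) = (\<Sum>n. u ^ n * m n / fact n))"
    if M: "real_distribution M" and pos: "AE x in M. 0 \<le> x"
      and mom: "\<And>n. has_bochner_integral M (\<lambda>x. x ^ n) (m n)" and u: "u < 1 / C" for M u
  proof (cases "0 < u")
    case True
    interpret M: real_distribution M by fact
    have int: "integrable M (\<lambda>x. x ^ n)" and E: "(\<integral>x. x ^ n \<partial>M) = m n" for n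
      using mom[of n] by (auto simp: has_bochner_integral_iff)
    have m0: "m n \<ge> 0" for n
      unfolding E[symmetric] using pos by (intro integral_nonneg_AE) auto
    have "u * C < 1" using u C by (simp add: field_simps)
    then have s1: "summable (\<lambda>n. (u * C) ^ n)" using True C by (intro summable_geometric) auto
    have s2: "u ^ n * m n / fact n \<le> (u * C) ^ n" for n
      using bound[of n] True by (simp add: power_mult_distrib divide_le_eq mult_left_mono mult.assoc)
    have s3: "0 \<le> u ^ n * m n / fact n" for n using True m0 by simp
    have summ: "summable (\<lambda>n. u ^ n * m n / fact n)"
      by (rule summable_comparison_test'[OF s1, of 0]) (simp only: real_norm_def abs_of_nonneg[OF s3] s2)
    have "(\<integral>\<^sup>+x. ennreal (exp (u * x)) \<partial>M) = (\<integral>\<^sup>+x. (\<Sum>n. ennreal ((u * x) ^ n / fact n)) \<partial>M)"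
      using pos
    proof (intro nn_integral_cong_AE, eventually_elim)
      case (elim x)
      have s: "(\<lambda>n. (u * x) ^ n / fact n) sums exp (u * x)"
        using exp_converges[of "u * x"] by (simp add: divide_inverse mult.commute)
      show ?case
        using elim True by (intro suminf_ennreal_eq[OF _ s, symmetric]) simp
    qed
    also have "\<dots> = (\<Sum>n. \<integral>\<^sup>+x. ennreal ((u * x) ^ n / fact n) \<partial>M)"
      by (rule nn_integral_suminf) simp
    also have "\<dots> = (\<Sum>n. ennreal (u ^ n * m n / fact n))"
    proof (rule suminf_cong)
      fix n
      have "(\<integral>\<^sup>+x. ennreal ((u * x) ^ n / fact n) \<partial>M) = ennreal (\<integral>x. (u * x) ^ n / fact n \<partial>M)"
        using int[of n] pos True by (intro nn_integral_eq_integral) (auto simp: power_mult_distrib)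
      then show "(\<integral>\<^sup>+x. ennreal ((u * x) ^ n / fact n) \<partial>M) = ennreal (u ^ n * m n / fact n)"
        using E[of n] by (simp add: power_mult_distrib)
    qed
    also have "\<dots> = ennreal (\<Sum>n. u ^ n * m n / fact n)"
      using summ m0 True by (intro suminf_ennreal2) auto
    finally have nn: "(\<integral>\<^sup>+x. ennreal (exp (u * x)) \<partial>M) = ennreal (\<Sum>n. u ^ n * m n / fact n)" .
    have "integrable M (\<lambda>x. exp (u * x))"
      by (rule integrableI_nonneg) (auto simp: nn)
    moreover have "(\<integral>x. exp (u * x) \<partial>M) = (\<Sum>n. u ^ n * m n / fact n)"
      using suminf_nonneg[OF summ s3] by (subst integral_eq_nn_integral) (auto simp: nn)
    ultimately show ?thesis using True by simp
  next
    case False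
    interpret M: real_distribution M by fact
    have "integrable M (\<lambda>x. exp (u * x))"
      using pos False by (intro M.integrable_const_bound[of _ 1])
        (auto elim!: eventually_mono simp: mult_nonpos_nonneg)
    then show ?thesis using False by simp
  qed
  show ?thesis
    by (rule Laplace_transform_unique[OF M1 M2, of "-1" "1 / C"])
       (use C *[OF M1 pos1 mom1] *[OF M2 pos2 mom2] in auto)
qed

section \<open>Almost sure convergence of centred independent series\<close>

text \<open>The partial sums of \<open>y a, y (a + 1), \<dots>\<close> stopped when their modulus first reaches \<open>\<epsilon>\<close>. Stopping turns
  the event that some partial sum exceeds \<open>\<epsilon>\<close> into an event on the last stopped sum, so that the
  maximal inequality reduces to Chebyshev's inequality.\<close>

primrec stopped_sum :: "real \<Rightarrow> (nat \<Rightarrow> real) \<Rightarrow> nat \<Rightarrow> nat \<Rightarrow> real" where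
  "stopped_sum \<epsilon> y a 0 = 0"
| "stopped_sum \<epsilon> y a (Suc n) =
     stopped_sum \<epsilon> y a n + (if \<bar>stopped_sum \<epsilon> y a n\<bar> < \<epsilon> then y (a + n) else 0)"

lemma stopped_sum_cases:
  "(\<forall>j\<le>n. \<bar>\<Sum>k<j. y (a + k)\<bar> < \<epsilon>) \<and> stopped_sum \<epsilon> y a n = (\<Sum>k<n. y (a + k)) \<or>
   \<epsilon> \<le> \<bar>stopped_sum \<epsilon> y a n\<bar>"
proof (induction n)
  case (Suc n)
  then show ?case
  proof (elim disjE conjE)
    assume "\<forall>j\<le>n. \<bar>\<Sum>k<j. y (a + k)\<bar> < \<epsilon>" "stopped_sum \<epsilon> y a n = (\<Sum>k<n. y (a + k))"
    moreover from this have "stopped_sum \<epsilon> y a (Suc n) = (\<Sum>k<Suc n. y (a + k))" by auto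
    ultimately show ?thesis
      by (auto simp del: sum.lessThan_Suc stopped_sum.simps simp: le_Suc_eq not_le)
  qed auto
qed (auto simp: not_le)

lemma stopped_sum_restrict:
  "stopped_sum \<epsilon> (restrict y {a..<a + n}) a n = stopped_sum \<epsilon> y a n"
proof -
  have "n \<le> m \<Longrightarrow> stopped_sum \<epsilon> (restrict y {a..<a + m}) a n = stopped_sum \<epsilon> y a n" for m
    by (induction n) auto
  then show ?thesis by simp
qed

lemma measurable_stopped_sum:
  "(\<lambda>y. stopped_sum \<epsilon> y a n) \<in> borel_measurable (PiM {a..<a + n} (\<lambda>_. borel))"
proof -
  have "n \<le> m \<Longrightarrow> (\<lambda>y. stopped_sum \<epsilon> y a n) \<in> borel_measurable (PiM {a..<a + m} (\<lambda>_. borel))" for m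
  proof (induction n)
    case (Suc n)
    then have [measurable]: "(\<lambda>y. stopped_sum \<epsilon> y a n) \<in> borel_measurable (PiM {a..<a + m} (\<lambda>_. borel))"
      by simp
    have [measurable]: "(\<lambda>y. y (a + n)) \<in> borel_measurable (PiM {a..<a + m} (\<lambda>_. borel))"
      using Suc(2) by (intro measurable_component_singleton) auto
    show ?case by simp
  qed simp
  then show ?thesis by simp
qed

text \<open>The increment of the stopped sum at time \<open>n\<close> is \<open>Y (a + n)\<close> times a function of the earlier
  variables. By independence and centring the cross term vanishes, so the second moment of the stopped
  sum grows by at most \<open>E (Y (a + n))\<^sup>2\<close>.\<close>

lemma (in prob_space) Kolmogorov_maximal_inequality:
  fixes Y :: "nat \<Rightarrow> 'a \<Rightarrow> real"
  assumes indep: "indep_vars (\<lambda>_. borel) Y {a..}"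
    and int: "\<And>k. a \<le> k \<Longrightarrow> integrable M (Y k)" "\<And>k. a \<le> k \<Longrightarrow> integrable M (\<lambda>\<omega>. (Y k \<omega>)\<^sup>2)"
    and mean: "\<And>k. a \<le> k \<Longrightarrow> expectation (Y k) = 0"
    and e: "0 < \<epsilon>"
  shows "prob {\<omega>\<in>space M. \<exists>j\<le>n. \<epsilon> \<le> \<bar>\<Sum>k<j. Y (a + k) \<omega>\<bar>}
    \<le> (\<Sum>k<n. expectation (\<lambda>\<omega>. (Y (a + k) \<omega>)\<^sup>2)) / \<epsilon>\<^sup>2"
proof -
  define T where "T n \<omega> = stopped_sum \<epsilon> (\<lambda>k. Y k \<omega>) a n" for n \<omega>
  have [measurable]: "Y (a + k) \<in> borel_measurable M" for k
    using int(1)[of "a + k"] by auto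
  have T_meas [measurable]: "T n \<in> borel_measurable M" for n
    unfolding T_def by (induction n) auto
  have step: "integrable M (\<lambda>\<omega>. (T n \<omega>)\<^sup>2) \<and>
     expectation (\<lambda>\<omega>. (T n \<omega>)\<^sup>2) \<le> (\<Sum>k<n. expectation (\<lambda>\<omega>. (Y (a + k) \<omega>)\<^sup>2))" for n
  proof (induction n)
    case (Suc n)
    \<comment> \<open>The previous sum on the event that the walk has not been stopped; it is bounded by \<open>\<epsilon>\<close>.\<close>
    define U where "U x = (if \<bar>x\<bar> < \<epsilon> then x else 0)" for x :: real
    have [measurable]: "U \<in> borel_measurable borel" unfolding U_def[abs_def] by simp
    have "indep_var borel ((\<lambda>y. U (stopped_sum \<epsilon> y a n)) \<circ> (\<lambda>\<omega>. restrict (\<lambda>i. Y i \<omega>) {a..<a + n}))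
        borel ((\<lambda>y. y (a + n)) \<circ> (\<lambda>\<omega>. restrict (\<lambda>i. Y i \<omega>) {a + n}))"
      by (intro indep_var_compose[OF indep_var_restrict[OF indep]]
          measurable_compose[OF measurable_stopped_sum] measurable_component_singleton) auto
    then have ind: "indep_var borel (\<lambda>\<omega>. U (T n \<omega>)) borel (Y (a + n))"
      by (simp add: o_def stopped_sum_restrict T_def)
    have iU: "integrable M (\<lambda>\<omega>. U (T n \<omega>))"
      using e by (intro integrable_const_bound[of _ \<epsilon>]) (auto simp: U_def)
    have iY: "integrable M (Y (a + n))" by (rule int) simp
    have cross: "integrable M (\<lambda>\<omega>. U (T n \<omega>) * Y (a + n) \<omega>)"
        "expectation (\<lambda>\<omega>. U (T n \<omega>) * Y (a + n) \<omega>) = 0"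
      using indep_var_integrable[OF ind iU iY] indep_var_lebesgue_integral[OF ind iU iY] mean[of "a + n"]
      by auto
    let ?I = "\<lambda>\<omega>. (if \<bar>T n \<omega>\<bar> < \<epsilon> then (Y (a + n) \<omega>)\<^sup>2 else 0)"
    have iY2: "integrable M (\<lambda>\<omega>. (Y (a + n) \<omega>)\<^sup>2)" by (rule int) simp
    have iI: "integrable M ?I"
      by (rule Bochner_Integration.integrable_bound[OF iY2]) auto
    have eq: "(T (Suc n) \<omega>)\<^sup>2 = (T n \<omega>)\<^sup>2 + 2 * (U (T n \<omega>) * Y (a + n) \<omega>) + ?I \<omega>" for \<omega>
      by (simp add: T_def U_def power2_eq_square algebra_simps)
    have "integrable M (\<lambda>\<omega>. (T (Suc n) \<omega>)\<^sup>2)"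
      unfolding eq using Suc cross iI by simp
    moreover have "expectation (\<lambda>\<omega>. (T (Suc n) \<omega>)\<^sup>2) = expectation (\<lambda>\<omega>. (T n \<omega>)\<^sup>2) + expectation ?I"
      unfolding eq using Suc cross iI by simp
    moreover have "expectation ?I \<le> expectation (\<lambda>\<omega>. (Y (a + n) \<omega>)\<^sup>2)"
      by (rule integral_mono[OF iI iY2]) auto
    ultimately show ?case using Suc by simp
  qed (simp add: T_def)
  have "prob {\<omega>\<in>space M. \<exists>j\<le>n. \<epsilon> \<le> \<bar>\<Sum>k<j. Y (a + k) \<omega>\<bar>} \<le> prob {\<omega>\<in>space M. \<epsilon>\<^sup>2 \<le> (T n \<omega>)\<^sup>2}"
  proof (intro finite_measure_mono subsetI)
    fix \<omega> assume "\<omega> \<in> {\<omega>\<in>space M. \<exists>j\<le>n. \<epsilon> \<le> \<bar>\<Sum>k<j. Y (a + k) \<omega>\<bar>}"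
    then show "\<omega> \<in> {\<omega>\<in>space M. \<epsilon>\<^sup>2 \<le> (T n \<omega>)\<^sup>2}"
      using stopped_sum_cases[of n "\<lambda>k. Y k \<omega>" a \<epsilon>] e
      by (auto simp: T_def not_le abs_le_square_iff[symmetric])
  qed auto
  also have "\<dots> \<le> expectation (\<lambda>\<omega>. (T n \<omega>)\<^sup>2) / \<epsilon>\<^sup>2"
    using step[of n] e by (intro integral_Markov_inequality_measure[where A="{}"]) auto
  also have "\<dots> \<le> (\<Sum>k<n. expectation (\<lambda>\<omega>. (Y (a + k) \<omega>)\<^sup>2)) / \<epsilon>\<^sup>2"
    using step[of n] by (intro divide_right_mono) auto
  finally show ?thesis .
qed

text \<open>Kolmogorov's convergence theorem: the maximal inequality applied to the tails bounds the probability
  that the partial sums oscillate by more than \<open>\<epsilon>\<close> after time \<open>m\<close> by a remainder of a convergent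
  series, so almost surely the partial sums form a Cauchy sequence.\<close>

lemma (in prob_space) AE_summable_of_indep_centred:
  fixes Y :: "nat \<Rightarrow> 'a \<Rightarrow> real"
  assumes indep: "indep_vars (\<lambda>_. borel) Y {a..}"
    and int: "\<And>k. a \<le> k \<Longrightarrow> integrable M (Y k)" "\<And>k. a \<le> k \<Longrightarrow> integrable M (\<lambda>\<omega>. (Y k \<omega>)\<^sup>2)"
    and mean: "\<And>k. a \<le> k \<Longrightarrow> expectation (Y k) = 0"
    and summ: "summable (\<lambda>k. expectation (\<lambda>\<omega>. (Y (a + k) \<omega>)\<^sup>2))"
  shows "AE \<omega> in M. summable (\<lambda>k. Y (a + k) \<omega>)"
proof -
  let ?v = "\<lambda>k. expectation (\<lambda>\<omega>. (Y (a + k) \<omega>)\<^sup>2)"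
  have [measurable]: "Y (a + k) \<in> borel_measurable M" for k
    using int(1)[of "a + k"] by auto
  let ?A = "\<lambda>\<epsilon> m n. {\<omega>\<in>space M. \<exists>j\<le>n. \<epsilon> \<le> \<bar>\<Sum>k<j. Y (a + m + k) \<omega>\<bar>}"
  let ?E = "\<lambda>\<epsilon> m. {\<omega>\<in>space M. \<exists>j. \<epsilon> \<le> \<bar>\<Sum>k<j. Y (a + m + k) \<omega>\<bar>}"
  have [measurable]: "Y (a + m + k) \<in> borel_measurable M" for m k
    using int(1)[of "a + m + k"] by auto
  have tail: "prob (?E \<epsilon> m) \<le> (\<Sum>k. ?v (k + m)) / \<epsilon>\<^sup>2" if e: "0 < \<epsilon>" for \<epsilon> m
  proof -
    have "(\<lambda>n. prob (?A \<epsilon> m n)) \<longlonglongrightarrow> prob (\<Union>n. ?A \<epsilon> m n)"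
      by (rule finite_Lim_measure_incseq) (auto simp: incseq_def intro: order.trans)
    moreover have "(\<Union>n. ?A \<epsilon> m n) = ?E \<epsilon> m" by auto
    moreover have "prob (?A \<epsilon> m n) \<le> (\<Sum>k. ?v (k + m)) / \<epsilon>\<^sup>2" for n
    proof -
      have "prob (?A \<epsilon> m n) \<le> (\<Sum>k<n. expectation (\<lambda>\<omega>. (Y (a + m + k) \<omega>)\<^sup>2)) / \<epsilon>\<^sup>2"
        by (rule Kolmogorov_maximal_inequality)
           (use int mean e in \<open>auto intro: indep_vars_subset[OF indep]\<close>)
      also have "(\<Sum>k<n. expectation (\<lambda>\<omega>. (Y (a + m + k) \<omega>)\<^sup>2)) = (\<Sum>k<n. ?v (k + m))"
        by (simp add: ac_simps)
      also have "\<dots> \<le> (\<Sum>k. ?v (k + m))"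
        using summ by (intro sum_le_suminf) (auto simp: summable_iff_shift[where f="?v"])
      finally show ?thesis using e by (simp add: divide_right_mono)
    qed
    ultimately show ?thesis by (auto intro: LIMSEQ_le_const2)
  qed
  have null: "AE \<omega> in M. \<exists>m. \<omega> \<notin> ?E \<epsilon> m" if e: "0 < \<epsilon>" for \<epsilon>
  proof -
    have le: "prob (\<Inter>m. ?E \<epsilon> m) \<le> (\<Sum>k. ?v (k + m)) / \<epsilon>\<^sup>2" for m
      by (rule order.trans[OF _ tail[OF e]]) (intro finite_measure_mono, auto)
    have "(\<lambda>m. (\<Sum>k. ?v (k + m)) / \<epsilon>\<^sup>2) \<longlonglongrightarrow> 0 / \<epsilon>\<^sup>2"
      using e by (intro tendsto_divide tendsto_const suminf_exist_split2[OF summ]) auto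
    then have "prob (\<Inter>m. ?E \<epsilon> m) \<le> 0"
      using le by (auto intro: LIMSEQ_le_const)
    then have "prob (\<Inter>m. ?E \<epsilon> m) = 0" by (simp add: measure_le_0_iff)
    then have "AE \<omega> in M. \<omega> \<notin> (\<Inter>m. ?E \<epsilon> m)"
      by (intro AE_not_in) (simp add: null_sets_def emeasure_eq_measure)
    then show ?thesis by (rule eventually_mono) auto
  qed
  have "AE \<omega> in M. \<forall>p. \<exists>m. \<omega> \<notin> ?E (inverse (real (Suc p))) m"
    unfolding AE_all_countable by (intro allI null) simp
  then show ?thesis
  proof (rule AE_mp, intro AE_I2 impI)
    fix \<omega> assume \<omega>: "\<omega> \<in> space M" and *: "\<forall>p. \<exists>m. \<omega> \<notin> ?E (inverse (real (Suc p))) m"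
    show "summable (\<lambda>k. Y (a + k) \<omega>)"
      unfolding summable_Cauchy
    proof (intro allI impI)
      fix e :: real assume "0 < e"
      then obtain p where p: "inverse (real (Suc p)) < e / 2"
        using reals_Archimedean[of "e / 2"] by auto
      from * obtain m where "\<omega> \<notin> ?E (inverse (real (Suc p))) m" by blast
      with \<omega> have "\<bar>\<Sum>k<j. Y (a + m + k) \<omega>\<bar> < inverse (real (Suc p))" for j
        by (simp add: not_le)
      with p have m: "\<bar>\<Sum>k<j. Y (a + m + k) \<omega>\<bar> < e / 2" for j
        using less_trans by blast
      show "\<exists>N. \<forall>i\<ge>N. \<forall>n. norm (\<Sum>k=i..<n. Y (a + k) \<omega>) < e"
      proof (intro exI[of _ m] allI impI)
        fix i n assume i: "m \<le> i"
        have split: "(\<Sum>k=m..<l. Y (a + k) \<omega>) = (\<Sum>k<l - m. Y (a + m + k) \<omega>)" for l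
          by (rule sum.reindex_bij_witness[of _ "\<lambda>k. k + m" "\<lambda>k. k - m"]) (auto simp: ac_simps)
        show "norm (\<Sum>k=i..<n. Y (a + k) \<omega>) < e"
        proof (cases "i \<le> n")
          case True
          then have "(\<Sum>k=m..<n. Y (a + k) \<omega>) = (\<Sum>k=m..<i. Y (a + k) \<omega>) + (\<Sum>k=i..<n. Y (a + k) \<omega>)"
            using i by (simp add: sum.atLeastLessThan_concat)
          then show ?thesis
            using m[of "n - m"] m[of "i - m"] unfolding split real_norm_def by linarith
        qed (use \<open>0 < e\<close> in simp)
      qed
    qed
  qed
qed

text \<open>Cutting a nonnegative variable at height \<open>c\<close> changes its expectation by at most its second moment
  divided by \<open>c\<close>; after the cut, convergence is dominated.\<close>

lemma (in prob_space) expectation_tendsto_of_L2_bounded: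
  fixes X :: "nat \<Rightarrow> 'a \<Rightarrow> real"
  assumes [measurable]: "\<And>n. X n \<in> borel_measurable M" "Z \<in> borel_measurable M"
    and pos: "\<And>n \<omega>. 0 \<le> X n \<omega>"
    and lim: "AE \<omega> in M. (\<lambda>n. X n \<omega>) \<longlonglongrightarrow> Z \<omega>"
    and int: "\<And>n. integrable M (\<lambda>\<omega>. (X n \<omega>)\<^sup>2)"
    and bound: "\<And>n. expectation (\<lambda>\<omega>. (X n \<omega>)\<^sup>2) \<le> C"
  shows "integrable M Z" and "(\<lambda>n. expectation (X n)) \<longlonglongrightarrow> expectation Z"
proof -
  have C: "0 \<le> C" using bound[of 0] by (rule order.trans[rotated]) simp
  have Zpos: "AE \<omega> in M. 0 \<le> Z \<omega>"
    using lim by eventually_elim (auto intro: LIMSEQ_le_const pos)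
  have iX: "integrable M (X n)" for n
    by (rule square_integrable_imp_integrable[OF _ int]) simp
  have "(\<integral>\<^sup>+\<omega>. ennreal ((Z \<omega>)\<^sup>2) \<partial>M) = (\<integral>\<^sup>+\<omega>. liminf (\<lambda>n. ennreal ((X n \<omega>)\<^sup>2)) \<partial>M)"
    using lim
  proof (intro nn_integral_cong_AE, eventually_elim)
    case (elim \<omega>)
    have "(\<lambda>n. ennreal ((X n \<omega>)\<^sup>2)) \<longlonglongrightarrow> ennreal ((Z \<omega>)\<^sup>2)"
      using elim by (intro tendsto_ennrealI tendsto_power)
    then show ?case by (intro lim_imp_Liminf[symmetric]) simp_all
  qed
  also have "\<dots> \<le> liminf (\<lambda>n. \<integral>\<^sup>+\<omega>. ennreal ((X n \<omega>)\<^sup>2) \<partial>M)"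
    by (rule nn_integral_liminf) simp
  also have "\<dots> \<le> ennreal C"
  proof (rule Liminf_le)
    show "\<forall>\<^sub>F n in sequentially. (\<integral>\<^sup>+\<omega>. ennreal ((X n \<omega>)\<^sup>2) \<partial>M) \<le> ennreal C"
      by (intro always_eventually allI, subst nn_integral_eq_integral[OF int]) (auto intro!: ennreal_leI bound)
  qed simp
  finally have nZ: "(\<integral>\<^sup>+\<omega>. ennreal ((Z \<omega>)\<^sup>2) \<partial>M) \<le> ennreal C" .
  then have iZ2: "integrable M (\<lambda>\<omega>. (Z \<omega>)\<^sup>2)"
    by (intro integrableI_nonneg) (auto intro: order_le_less_trans)
  have Z2: "expectation (\<lambda>\<omega>. (Z \<omega>)\<^sup>2) \<le> C"
    using nZ C by (subst (asm) nn_integral_eq_integral[OF iZ2]) auto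
  show iZ: "integrable M Z"
    by (rule square_integrable_imp_integrable[OF _ iZ2]) simp
  have trunc: "\<bar>expectation f - expectation (\<lambda>\<omega>. min (f \<omega>) c)\<bar> \<le> C / c"
    if c: "0 < c" and f: "integrable M f" "integrable M (\<lambda>\<omega>. (f \<omega>)\<^sup>2)" "AE \<omega> in M. 0 \<le> f \<omega>"
      "expectation (\<lambda>\<omega>. (f \<omega>)\<^sup>2) \<le> C" for f :: "'a \<Rightarrow> real" and c
  proof -
    have [measurable]: "f \<in> borel_measurable M" using f(1) by auto
    have im: "integrable M (\<lambda>\<omega>. min (f \<omega>) c)"
      using f(1) by simp
    have pw: "AE \<omega> in M. 0 \<le> f \<omega> - min (f \<omega>) c \<and> f \<omega> - min (f \<omega>) c \<le> (f \<omega>)\<^sup>2 / c"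
      using f(3)
    proof eventually_elim
      case (elim \<omega>)
      show ?case
      proof (cases "f \<omega> \<le> c")
        case False
        then have "c * f \<omega> \<le> f \<omega> * f \<omega>" using c by (intro mult_right_mono) auto
        then show ?thesis using False c by (auto simp: min_def power2_eq_square field_simps intro: add_increasing)
      qed (use c in auto)
    qed
    have eq: "expectation f - expectation (\<lambda>\<omega>. min (f \<omega>) c) = expectation (\<lambda>\<omega>. f \<omega> - min (f \<omega>) c)"
      using f(1) im by simp
    have "0 \<le> expectation (\<lambda>\<omega>. f \<omega> - min (f \<omega>) c)"
      using pw by (intro integral_nonneg_AE) auto
    moreover have "expectation (\<lambda>\<omega>. f \<omega> - min (f \<omega>) c) \<le> expectation (\<lambda>\<omega>. (f \<omega>)\<^sup>2 / c)"
      using pw f(1,2) im by (intro integral_mono_AE) auto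
    moreover have "expectation (\<lambda>\<omega>. (f \<omega>)\<^sup>2 / c) \<le> C / c"
      using f(4) c by (simp add: divide_right_mono)
    ultimately show ?thesis unfolding eq by simp
  qed
  show "(\<lambda>n. expectation (X n)) \<longlonglongrightarrow> expectation Z"
  proof (rule LIMSEQ_I)
    fix e :: real assume e: "0 < e"
    define c where "c = 4 * (C + 1) / e"
    have c: "0 < c" using e C by (simp add: c_def)
    have Cc: "C / c < e / 3"
      using e C by (simp add: c_def field_simps add_nonneg_pos)
    have "(\<lambda>n. expectation (\<lambda>\<omega>. min (X n \<omega>) c)) \<longlonglongrightarrow> expectation (\<lambda>\<omega>. min (Z \<omega>) c)"
    proof (rule integral_dominated_convergence[where w="\<lambda>_. c"])
      show "AE \<omega> in M. (\<lambda>n. min (X n \<omega>) c) \<longlonglongrightarrow> min (Z \<omega>) c"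
        using lim by eventually_elim (intro tendsto_min tendsto_const)
      show "AE \<omega> in M. norm (min (X n \<omega>) c) \<le> c" for n
        using pos[of n] c by (intro AE_I2) (auto simp: min_def)
    qed auto
    then obtain N where N: "\<And>n. n \<ge> N \<Longrightarrow>
        \<bar>expectation (\<lambda>\<omega>. min (X n \<omega>) c) - expectation (\<lambda>\<omega>. min (Z \<omega>) c)\<bar> < e / 3"
      using LIMSEQ_D[of _ _ "e / 3"] e by fastforce
    show "\<exists>N. \<forall>n\<ge>N. norm (expectation (X n) - expectation Z) < e"
    proof (intro exI[of _ N] allI impI)
      fix n assume n: "N \<le> n"
      have "AE \<omega> in M. 0 \<le> X n \<omega>" using pos by (intro AE_I2)
      from trunc[OF c iX int this bound] trunc[OF c iZ iZ2 Zpos Z2] N[OF n] Cc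
      show "norm (expectation (X n) - expectation Z) < e" unfolding real_norm_def by linarith
    qed
  qed
qed

section \<open>Laplace transforms of subordinators\<close>

lemma measurable_exp_neg [measurable]: "exp_neg u \<in> borel_measurable borel"
  unfolding exp_neg_def[abs_def] by measurable

lemma exp_neg_nonneg: "0 \<le> exp_neg u x"
  by (simp add: exp_neg_def)

lemma exp_neg_le_1: "0 \<le> u \<Longrightarrow> exp_neg u x \<le> 1"
  by (simp add: exp_neg_def)

lemma exp_neg_add: "exp_neg u (x + y) = exp_neg u x * exp_neg u y"
  by (cases x; cases y) (auto simp: exp_neg_def algebra_simps enn2real_plus simp flip: exp_add)

lemma exp_neg_antimono: "0 \<le> u \<Longrightarrow> x \<le> y \<Longrightarrow> exp_neg u y \<le> exp_neg u x"
  by (cases x; cases y) (auto simp: exp_neg_def mult_left_mono top_unique)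

lemma exp_neg_antimono_exponent: "u \<le> v \<Longrightarrow> exp_neg v x \<le> exp_neg u x"
  by (auto simp: exp_neg_def intro!: mult_right_mono)

text \<open>Additivity gives \<open>a (n t) = n a t\<close>; enclosing \<open>n t\<close> between consecutive integers shows that
  \<open>n |a t - t a 1|\<close> stays below \<open>a 1\<close> for every \<open>n\<close>.\<close>

lemma monotone_additive_linear:
  fixes a :: "real \<Rightarrow> real"
  assumes add: "\<And>s t. 0 \<le> s \<Longrightarrow> 0 \<le> t \<Longrightarrow> a (s + t) = a s + a t"
    and mono: "\<And>s t. 0 \<le> s \<Longrightarrow> s \<le> t \<Longrightarrow> a s \<le> a t"
    and t: "0 \<le> t"
  shows "a t = t * a 1"
proof -
  have mult: "a (real n * s) = real n * a s" if "0 \<le> s" for n s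
  proof (induction n)
    case 0
    then show ?case using add[of 0 0] by simp
  next
    case (Suc n)
    then show ?case using add[of s "real n * s"] that by (simp add: algebra_simps)
  qed
  have a1: "0 \<le> a 1" using mono[of 0 1] add[of 0 0] by simp
  have "real n * \<bar>a t - t * a 1\<bar> \<le> a 1" for n
  proof -
    define k where "k = nat \<lfloor>real n * t\<rfloor>"
    have k: "real k \<le> real n * t" "real n * t \<le> real (Suc k)"
      using t real_of_int_floor_add_one_ge[of "real n * t"] by (simp_all add: k_def of_nat_nat add.commute)
    have "real k * a 1 \<le> real n * a t"
      using mono[of "real k" "real n * t"] k(1) mult[of 1 k] mult[OF t, of n] by simp
    moreover have "real n * a t \<le> real (Suc k) * a 1"
      using mono[of "real n * t" "real (Suc k)"] k(2) t mult[of 1 "Suc k"] mult[OF t, of n] by simp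
    moreover have "real k * a 1 \<le> real n * t * a 1" "real n * t * a 1 \<le> real (Suc k) * a 1"
      using k a1 by (auto intro: mult_right_mono)
    ultimately have "\<bar>real n * a t - real n * t * a 1\<bar> \<le> a 1"
      by (simp add: algebra_simps abs_le_iff)
    moreover have "real n * a t - real n * t * a 1 = real n * (a t - t * a 1)" by (simp add: algebra_simps)
    ultimately show ?thesis by (simp add: abs_mult)
  qed
  then have "\<not> 0 < \<bar>a t - t * a 1\<bar>"
    using reals_Archimedean3[of "\<bar>a t - t * a 1\<bar>"] by (meson not_le)
  then show ?thesis by simp
qed

locale subordinator_process =
  fixes M :: "'a measure" and \<xi> :: "real \<Rightarrow> 'a \<Rightarrow> ennreal"
  assumes subordinator: "subordinator M \<xi>"
begin

sublocale prob_space M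
  using subordinator by (simp add: subordinator_def)

lemma measurable_process: "0 \<le> t \<Longrightarrow> \<xi> t \<in> borel_measurable M"
  using subordinator by (simp add: subordinator_def)

lemma process_0: "\<omega> \<in> space M \<Longrightarrow> \<xi> 0 \<omega> = 0"
  using subordinator by (simp add: subordinator_def)

lemma process_mono: "\<omega> \<in> space M \<Longrightarrow> 0 \<le> s \<Longrightarrow> s \<le> t \<Longrightarrow> \<xi> s \<omega> \<le> \<xi> t \<omega>"
  using subordinator by (auto simp: subordinator_def mono_on_def)

lemma process_right_continuous:
  "\<omega> \<in> space M \<Longrightarrow> 0 \<le> t \<Longrightarrow> ((\<lambda>s. \<xi> s \<omega>) \<longlongrightarrow> \<xi> t \<omega>) (at_right t)"
  using subordinator by (simp add: subordinator_def)

text \<open>By right continuity the process is the limit of its values at the next time of the grid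
  \<open>{i / (n + 1)}\<close> strictly after \<open>t\<close>, and these depend on \<open>t\<close> through an integer only.\<close>

lemma measurable_process_pair:
  "(\<lambda>(t, \<omega>). \<xi> (max 0 t) \<omega>) \<in> borel_measurable (borel \<Otimes>\<^sub>M M)"
proof -
  let ?\<tau> = "\<lambda>n t. (real (nat \<lfloor>real (Suc n) * max 0 t\<rfloor>) + 1) / real (Suc n)"
  have meas: "(\<lambda>(t, \<omega>). \<xi> (?\<tau> n t) \<omega>) \<in> borel_measurable (borel \<Otimes>\<^sub>M M)" for n
  proof -
    have "(\<lambda>x. (\<lambda>i x. \<xi> ((real i + 1) / real (Suc n)) (snd x)) (nat \<lfloor>real (Suc n) * max 0 (fst x)\<rfloor>) x)
        \<in> borel_measurable (borel \<Otimes>\<^sub>M M)"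
    proof (rule measurable_compose_countable[where f="\<lambda>i x. \<xi> ((real i + 1) / real (Suc n)) (snd x)"])
      show "(\<lambda>x. \<xi> ((real i + 1) / real (Suc n)) (snd x)) \<in> borel_measurable (borel \<Otimes>\<^sub>M M)" for i
        by (rule measurable_compose[OF measurable_snd measurable_process]) simp
    qed simp
    then show ?thesis by (simp add: case_prod_unfold)
  qed
  have lim: "(\<lambda>n. (case x of (t, \<omega>) \<Rightarrow> \<xi> (?\<tau> n t) \<omega>)) \<longlonglongrightarrow> (case x of (t, \<omega>) \<Rightarrow> \<xi> (max 0 t) \<omega>)"
    if "x \<in> space (borel \<Otimes>\<^sub>M M)" for x
  proof -
    obtain t \<omega> where x: "x = (t, \<omega>)" "\<omega> \<in> space M" using \<open>x \<in> _\<close> by (auto simp: space_pair_measure)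
    let ?s = "max 0 t"
    have fl0: "N < real (nat \<lfloor>N\<rfloor>) + 1" "real (nat \<lfloor>N\<rfloor>) \<le> N" if "0 \<le> N" for N :: real
      using that real_of_int_floor_add_one_gt[of N] of_int_floor_le[of N] by (simp_all add: of_nat_nat)
    have fl: "real (Suc n) * ?s < real (nat \<lfloor>real (Suc n) * ?s\<rfloor>) + 1"
         "real (nat \<lfloor>real (Suc n) * ?s\<rfloor>) \<le> real (Suc n) * ?s" for n
      by (rule fl0, simp)+
    have lo: "?s < ?\<tau> n t" for n
      by (subst pos_less_divide_eq)
        (use fl(1)[of n] in \<open>simp_all only: mult.commute[of ?s] of_nat_0_less_iff zero_less_Suc\<close>)
    have hi: "?\<tau> n t \<le> ?s + inverse (real (Suc n))" for n
    proof -
      have "real (nat \<lfloor>real (Suc n) * ?s\<rfloor>) / real (Suc n) \<le> ?s"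
        by (subst pos_divide_le_eq)
          (use fl(2)[of n] in \<open>simp_all only: mult.commute[of ?s] of_nat_0_less_iff zero_less_Suc\<close>)
      then show ?thesis by (simp only: add_divide_distrib inverse_eq_divide add_right_mono)
    qed
    have "(\<lambda>n. ?s + inverse (real (Suc n))) \<longlonglongrightarrow> ?s + 0"
      by (intro tendsto_intros LIMSEQ_inverse_real_of_nat)
    then have "(\<lambda>n. ?s + inverse (real (Suc n))) \<longlonglongrightarrow> ?s" by simp
    then have "(\<lambda>n. ?\<tau> n t) \<longlonglongrightarrow> ?s"
      by (rule real_tendsto_sandwich[rotated 3, OF _ _ _ tendsto_const[of ?s]])
         (use lo hi in \<open>auto intro!: always_eventually less_imp_le\<close>)
    then have "filterlim (\<lambda>n. ?\<tau> n t) (at_right ?s) sequentially"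
      by (rule tendsto_imp_filterlim_at_right) (intro always_eventually allI lo)
    from filterlim_compose[OF process_right_continuous[OF x(2)] this] show ?thesis
      by (simp add: x(1))
  qed
  show ?thesis
    by (rule borel_measurable_LIMSEQ_order[OF lim meas])
qed

text \<open>On the event that the process is alive at \<open>s\<close>, the position and the next increment have a product
  law.\<close>

lemma increment_independent:
  assumes s: "0 \<le> s" and t: "0 \<le> t"
    and [measurable]: "f \<in> borel_measurable borel" "h \<in> borel_measurable borel"
  shows "(\<integral>\<^sup>+\<omega>. f (\<xi> s \<omega>) * h (\<xi> (s + t) \<omega> - \<xi> s \<omega>) * indicator {..<\<infinity>} (\<xi> s \<omega>) \<partial>M) =
    (\<integral>\<^sup>+\<omega>. f (\<xi> s \<omega>) * indicator {..<\<infinity>} (\<xi> s \<omega>) \<partial>M) * (\<integral>\<^sup>+\<omega>. h (\<xi> t \<omega>) \<partial>M)"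
proof -
  have [measurable]: "\<xi> s \<in> borel_measurable M" "\<xi> t \<in> borel_measurable M" "\<xi> (s + t) \<in> borel_measurable M"
    using s t by (auto intro: measurable_process)
  let ?D = "density M (\<lambda>\<omega>. indicator {..<\<infinity>} (\<xi> s \<omega>))"
  let ?I = "\<lambda>\<omega>. \<xi> (s + t) \<omega> - \<xi> s \<omega>"
  let ?\<mu> = "distr ?D borel (\<xi> s)"
  let ?\<nu> = "distr M borel (\<xi> t)"
  let ?J = "distr ?D (borel \<Otimes>\<^sub>M borel) (\<lambda>\<omega>. (\<xi> s \<omega>, ?I \<omega>))"
  interpret \<nu>: prob_space ?\<nu> by (rule prob_space_distr) simp
  have emD: "emeasure ?D A = emeasure M (A \<inter> {\<omega>\<in>space M. \<xi> s \<omega> < \<infinity>})" if "A \<in> sets M" for A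
  proof -
    have "emeasure ?D A = (\<integral>\<^sup>+\<omega>. indicator (A \<inter> {\<omega>\<in>space M. \<xi> s \<omega> < \<infinity>}) \<omega> \<partial>M)"
      by (subst emeasure_density[OF _ that], measurable, rule nn_integral_cong) (auto simp: indicator_def)
    also have "\<dots> = emeasure M (A \<inter> {\<omega>\<in>space M. \<xi> s \<omega> < \<infinity>})"
      by (intro nn_integral_indicator sets.Int that) measurable
    finally show ?thesis .
  qed
  have "finite_measure ?D"
    by (rule finite_measureI) (use emD[of "space M"] in \<open>simp add: space_density\<close>)
  then interpret \<mu>: finite_measure ?\<mu>
    by (rule finite_measure.finite_measure_distr) simp
  have "?\<mu> \<Otimes>\<^sub>M ?\<nu> = ?J"
  proof (rule pair_measure_eqI)
    show "sigma_finite_measure ?\<mu>" "sigma_finite_measure ?\<nu>"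
      by unfold_locales
    fix A B assume AB: "A \<in> sets ?\<mu>" "B \<in> sets ?\<nu>"
    then have [measurable]: "A \<in> sets borel" "B \<in> sets borel" by auto
    let ?A = "\<xi> s -` A \<inter> space M"
    have A: "?A \<in> process_events M \<xi> {0..s}"
      unfolding process_events_def using s \<open>A \<in> sets borel\<close>
      by (intro sigma_sets.Basic UN_I[of s] CollectI exI[of _ A] conjI) auto
    have ind: "measure M (?A \<inter> {\<omega>\<in>space M. \<xi> s \<omega> < \<infinity> \<and> ?I \<omega> \<in> B}) =
        measure M (?A \<inter> {\<omega>\<in>space M. \<xi> s \<omega> < \<infinity>}) * measure M {\<omega>\<in>space M. \<xi> t \<omega> \<in> B}"
      using subordinator s t A \<open>B \<in> sets borel\<close> unfolding subordinator_def by blast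
    have "emeasure ?J (A \<times> B) = emeasure ?D ((\<lambda>\<omega>. (\<xi> s \<omega>, ?I \<omega>)) -` (A \<times> B) \<inter> space M)"
      by (subst emeasure_distr) auto
    also have "\<dots> = emeasure M ((\<lambda>\<omega>. (\<xi> s \<omega>, ?I \<omega>)) -` (A \<times> B) \<inter> space M \<inter> {\<omega>\<in>space M. \<xi> s \<omega> < \<infinity>})"
      by (rule emD) measurable
    also have "(\<lambda>\<omega>. (\<xi> s \<omega>, ?I \<omega>)) -` (A \<times> B) \<inter> space M \<inter> {\<omega>\<in>space M. \<xi> s \<omega> < \<infinity>} =
        ?A \<inter> {\<omega>\<in>space M. \<xi> s \<omega> < \<infinity> \<and> ?I \<omega> \<in> B}" by auto
    also have "emeasure M \<dots> = emeasure M (?A \<inter> {\<omega>\<in>space M. \<xi> s \<omega> < \<infinity>}) * emeasure M {\<omega>\<in>space M. \<xi> t \<omega> \<in> B}"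
      unfolding emeasure_eq_measure ind by (simp add: ennreal_mult)
    also have "emeasure M (?A \<inter> {\<omega>\<in>space M. \<xi> s \<omega> < \<infinity>}) = emeasure ?D ?A"
      by (rule emD[symmetric]) measurable
    also have "\<dots> = emeasure ?\<mu> A"
      by (subst emeasure_distr) auto
    also have "{\<omega>\<in>space M. \<xi> t \<omega> \<in> B} = \<xi> t -` B \<inter> space M" by auto
    also have "emeasure M \<dots> = emeasure ?\<nu> B"
      by (subst emeasure_distr) auto
    finally show "emeasure ?\<mu> A * emeasure ?\<nu> B = emeasure ?J (A \<times> B)" by simp
  qed (simp cong: sets_pair_measure_cong)
  have "(\<integral>\<^sup>+\<omega>. f (\<xi> s \<omega>) * h (?I \<omega>) * indicator {..<\<infinity>} (\<xi> s \<omega>) \<partial>M) = (\<integral>\<^sup>+\<omega>. f (\<xi> s \<omega>) * h (?I \<omega>) \<partial>?D)"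
    by (subst nn_integral_density) (auto intro!: nn_integral_cong simp: ac_simps)
  also have "\<dots> = (\<integral>\<^sup>+p. f (fst p) * h (snd p) \<partial>?J)"
    by (subst nn_integral_distr) auto
  also have "\<dots> = (\<integral>\<^sup>+p. f (fst p) * h (snd p) \<partial>(?\<mu> \<Otimes>\<^sub>M ?\<nu>))"
    using \<open>?\<mu> \<Otimes>\<^sub>M ?\<nu> = ?J\<close> by simp
  also have "\<dots> = (\<integral>\<^sup>+x. \<integral>\<^sup>+y. f x * h y \<partial>?\<nu> \<partial>?\<mu>)"
    by (subst \<nu>.nn_integral_fst[symmetric]) auto
  also have "\<dots> = (\<integral>\<^sup>+x. f x \<partial>?\<mu>) * (\<integral>\<^sup>+y. h y \<partial>?\<nu>)"
    by (simp add: nn_integral_cmult nn_integral_multc)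
  also have "(\<integral>\<^sup>+y. h y \<partial>?\<nu>) = (\<integral>\<^sup>+\<omega>. h (\<xi> t \<omega>) \<partial>M)"
    by (subst nn_integral_distr) auto
  also have "(\<integral>\<^sup>+x. f x \<partial>?\<mu>) = (\<integral>\<^sup>+\<omega>. f (\<xi> s \<omega>) * indicator {..<\<infinity>} (\<xi> s \<omega>) \<partial>M)"
    by (subst nn_integral_distr, simp, simp, subst nn_integral_density) (auto simp: ac_simps)
  finally show ?thesis .
qed

definition \<phi> :: "real \<Rightarrow> real" where
  "\<phi> = laplace_exponent M \<xi>"

lemma integrable_exp_neg:
  assumes "0 \<le> t" "0 \<le> u"
  shows "integrable M (\<lambda>\<omega>. exp_neg u (\<xi> t \<omega>))"
proof -
  have [measurable]: "\<xi> t \<in> borel_measurable M" using assms(1) by (rule measurable_process)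
  show ?thesis
    using assms(2) by (intro integrable_const_bound[of _ 1]) (auto simp: exp_neg_nonneg exp_neg_le_1)
qed

text \<open>With \<open>u = 0\<close> this is the multiplicativity of \<open>t \<mapsto> E exp (- v \<xi>\<^sub>t)\<close>. The factor \<open>exp_neg 0 (\<xi> s)\<close> is
  then the indicator of being alive at time \<open>s\<close>.\<close>

lemma exp_neg_increment:
  assumes st: "0 \<le> s" "0 \<le> t" and u: "0 \<le> u" "0 \<le> v"
  shows "expectation (\<lambda>\<omega>. exp_neg u (\<xi> s \<omega>) * exp_neg v (\<xi> (s + t) \<omega>)) =
    expectation (\<lambda>\<omega>. exp_neg (u + v) (\<xi> s \<omega>)) * expectation (\<lambda>\<omega>. exp_neg v (\<xi> t \<omega>))"
proof -
  have [measurable]: "\<xi> s \<in> borel_measurable M" "\<xi> t \<in> borel_measurable M" "\<xi> (s + t) \<in> borel_measurable M"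
    using st by (auto intro: measurable_process)
  have "ennreal (expectation (\<lambda>\<omega>. exp_neg u (\<xi> s \<omega>) * exp_neg v (\<xi> (s + t) \<omega>))) =
      (\<integral>\<^sup>+\<omega>. ennreal (exp_neg u (\<xi> s \<omega>) * exp_neg v (\<xi> (s + t) \<omega>)) \<partial>M)"
    using u
    by (intro nn_integral_eq_integral[symmetric] integrable_const_bound[of _ 1])
       (auto simp: exp_neg_nonneg exp_neg_le_1 mult_le_one)
  also have "\<dots> = (\<integral>\<^sup>+\<omega>. ennreal (exp_neg (u + v) (\<xi> s \<omega>)) *
      ennreal (exp_neg v (\<xi> (s + t) \<omega> - \<xi> s \<omega>)) * indicator {..<\<infinity>} (\<xi> s \<omega>) \<partial>M)"
  proof (rule nn_integral_cong)
    fix \<omega> assume \<omega>: "\<omega> \<in> space M"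
    have "exp_neg v (\<xi> (s + t) \<omega>) = exp_neg v (\<xi> (s + t) \<omega> - \<xi> s \<omega>) * exp_neg v (\<xi> s \<omega>)"
      using diff_add_cancel_ennreal[OF process_mono[OF \<omega>, of s "s + t"]] st by (simp flip: exp_neg_add)
    moreover have "exp_neg (u + v) x = exp_neg u x * exp_neg v x" for x
      by (simp add: exp_neg_def algebra_simps flip: exp_add)
    moreover have "exp_neg (u + v) x = 0" if "\<not> x < \<infinity>" for x
      using that by (simp add: exp_neg_def not_less top_unique)
    ultimately show "ennreal (exp_neg u (\<xi> s \<omega>) * exp_neg v (\<xi> (s + t) \<omega>)) =
      ennreal (exp_neg (u + v) (\<xi> s \<omega>)) *
      ennreal (exp_neg v (\<xi> (s + t) \<omega> - \<xi> s \<omega>)) * indicator {..<\<infinity>} (\<xi> s \<omega>)"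
      by (cases "\<xi> s \<omega> < \<infinity>") (auto simp: ennreal_mult[symmetric] exp_neg_nonneg ac_simps indicator_def)
  qed
  also have "\<dots> = (\<integral>\<^sup>+\<omega>. ennreal (exp_neg (u + v) (\<xi> s \<omega>)) * indicator {..<\<infinity>} (\<xi> s \<omega>) \<partial>M) *
      (\<integral>\<^sup>+\<omega>. ennreal (exp_neg v (\<xi> t \<omega>)) \<partial>M)"
    by (rule increment_independent[OF st]) auto
  also have "(\<integral>\<^sup>+\<omega>. ennreal (exp_neg (u + v) (\<xi> s \<omega>)) * indicator {..<\<infinity>} (\<xi> s \<omega>) \<partial>M) =
      (\<integral>\<^sup>+\<omega>. ennreal (exp_neg (u + v) (\<xi> s \<omega>)) \<partial>M)"
    by (intro nn_integral_cong) (auto simp: exp_neg_def indicator_def less_top[symmetric])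
  also have "\<dots> * (\<integral>\<^sup>+\<omega>. ennreal (exp_neg v (\<xi> t \<omega>)) \<partial>M) =
      ennreal (expectation (\<lambda>\<omega>. exp_neg (u + v) (\<xi> s \<omega>)) * expectation (\<lambda>\<omega>. exp_neg v (\<xi> t \<omega>)))"
    using u st
    by (subst (1 2) nn_integral_eq_integral)
       (auto intro!: integrable_exp_neg integral_nonneg_AE simp: exp_neg_nonneg ennreal_mult)
  finally show ?thesis
    by (subst (asm) ennreal_inj) (auto intro!: integral_nonneg_AE mult_nonneg_nonneg simp: exp_neg_nonneg)
qed

text \<open>The expectation is multiplicative in \<open>t\<close>, nonincreasing, and positive for small \<open>t\<close> by right
  continuity at \<open>0\<close>, hence always positive. So minus its logarithm is additive and monotone in \<open>t\<close>, that
  is, linear.\<close>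

lemma expectation_exp_neg:
  assumes t: "0 \<le> t" and u: "0 \<le> u"
  shows "expectation (\<lambda>\<omega>. exp_neg u (\<xi> t \<omega>)) = exp (- t * \<phi> u)"
proof -
  define g where "g t = expectation (\<lambda>\<omega>. exp_neg u (\<xi> t \<omega>))" for t
  have mult: "g (s + t) = g s * g t" if "0 \<le> s" "0 \<le> t" for s t
  proof -
    have "exp_neg 0 (\<xi> s \<omega>) * exp_neg u (\<xi> (s + t) \<omega>) = exp_neg u (\<xi> (s + t) \<omega>)" if "\<omega> \<in> space M" for \<omega>
      using process_mono[OF that, of s "s + t"] \<open>0 \<le> s\<close> \<open>0 \<le> t\<close> by (auto simp: exp_neg_def top_unique)
    then have "expectation (\<lambda>\<omega>. exp_neg 0 (\<xi> s \<omega>) * exp_neg u (\<xi> (s + t) \<omega>)) = g (s + t)"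
      unfolding g_def by (intro Bochner_Integration.integral_cong) auto
    then show ?thesis
      using exp_neg_increment[OF that order_refl u] by (simp add: g_def)
  qed
  have anti: "g t \<le> g s" if "0 \<le> s" "s \<le> t" for s t
    unfolding g_def using that u
    by (intro integral_mono integrable_exp_neg exp_neg_antimono process_mono) auto
  have "(\<lambda>n. g (inverse (real (Suc n)))) \<longlonglongrightarrow> expectation (\<lambda>_. 1)"
    unfolding g_def
  proof (rule integral_dominated_convergence[where w="\<lambda>_. 1"])
    show "AE \<omega> in M. (\<lambda>n. exp_neg u (\<xi> (inverse (real (Suc n))) \<omega>)) \<longlonglongrightarrow> 1"
    proof (rule AE_I2)
      fix \<omega> assume \<omega>: "\<omega> \<in> space M"
      have "filterlim (\<lambda>n. inverse (real (Suc n))) (at_right 0) sequentially"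
        using LIMSEQ_inverse_real_of_nat by (auto simp: filterlim_at intro: always_eventually)
      from filterlim_compose[OF process_right_continuous[OF \<omega>] this]
      have lim: "(\<lambda>n. \<xi> (inverse (real (Suc n))) \<omega>) \<longlonglongrightarrow> 0"
        using process_0[OF \<omega>] by simp
      then have "(\<lambda>n. enn2real (\<xi> (inverse (real (Suc n))) \<omega>)) \<longlonglongrightarrow> 0"
        by (intro tendsto_enn2real) (simp_all only: ennreal_0 order_refl)
      then have "(\<lambda>n. exp (- u * enn2real (\<xi> (inverse (real (Suc n))) \<omega>))) \<longlonglongrightarrow> exp (- u * 0)"
        by (intro tendsto_exp tendsto_mult tendsto_const)
      moreover have "\<forall>\<^sub>F n in sequentially. \<xi> (inverse (real (Suc n))) \<omega> < 1"
        using lim by (rule order_tendstoD) simp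
      then have "\<forall>\<^sub>F n in sequentially. exp (- u * enn2real (\<xi> (inverse (real (Suc n))) \<omega>)) =
          exp_neg u (\<xi> (inverse (real (Suc n))) \<omega>)"
        by eventually_elim (auto simp: exp_neg_def)
      ultimately show "(\<lambda>n. exp_neg u (\<xi> (inverse (real (Suc n))) \<omega>)) \<longlonglongrightarrow> 1"
        by (auto elim: Lim_transform_eventually)
    qed
    show "(\<lambda>\<omega>. exp_neg u (\<xi> (inverse (real (Suc n))) \<omega>)) \<in> borel_measurable M" for n
      by (rule measurable_compose[OF measurable_process]) auto
  qed (use u in \<open>auto simp: exp_neg_nonneg exp_neg_le_1\<close>)
  then have "\<forall>\<^sub>F n in sequentially. 0 < g (inverse (real (Suc n)))"
    by (intro order_tendstoD) (auto simp: prob_space)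
  then obtain n where n: "0 < g (inverse (real (Suc n)))" by (auto simp: eventually_sequentially)
  have pos_mult: "0 < g (real m * inverse (real (Suc n)))" for m
  proof (induction m)
    case 0
    show ?case using n anti[of 0 "inverse (real (Suc n))"] by simp
  next
    case (Suc m)
    have "real (Suc m) * inverse (real (Suc n)) = inverse (real (Suc n)) + real m * inverse (real (Suc n))"
      by (simp add: algebra_simps)
    then show ?case using mult[of "inverse (real (Suc n))" "real m * inverse (real (Suc n))"] n Suc by simp
  qed
  have pos: "0 < g s" if s: "0 \<le> s" for s
  proof -
    obtain m where "s * real (Suc n) \<le> real m" using real_arch_simple by blast
    then have "s \<le> real m * inverse (real (Suc n))" by (simp add: field_simps)
    from anti[OF s this] pos_mult[of m] show ?thesis by simp
  qed
  have "- ln (g t) = t * - ln (g 1)"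
  proof (rule monotone_additive_linear[where a="\<lambda>t. - ln (g t)"])
    show "- ln (g (s + t)) = - ln (g s) + - ln (g t)" if "0 \<le> s" "0 \<le> t" for s t
      using mult[OF that] pos[OF that(1)] pos[OF that(2)] by (simp add: ln_mult)
    show "- ln (g s) \<le> - ln (g t)" if "0 \<le> s" "s \<le> t" for s t
      using anti[OF that] pos that by simp
  qed (fact t)
  then have "ln (g t) = - t * \<phi> u" by (simp add: \<phi>_def laplace_exponent_def g_def)
  then show ?thesis using pos[OF t] unfolding g_def[symmetric] by (metis exp_ln)
qed

end

section \<open>Potential measures and Frullani integrals\<close>

lemma nn_integral_exp_halfline:
  assumes c: "0 < c"
  shows "(\<integral>\<^sup>+t. ennreal (exp (- c * t)) * indicator {0<..} t \<partial>lborel) = ennreal (1 / c)"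
proof -
  have "(\<integral>\<^sup>+t. ennreal (exp (- c * t)) * indicator {0<..} t \<partial>lborel) =
      (\<integral>\<^sup>+t. ennreal (exp (- c * t)) * indicator {0..} t \<partial>lborel)"
    by (intro nn_integral_cong_AE eventually_mono[OF AE_lborel_singleton[of "0::real"]])
       (auto simp: indicator_def)
  also have "\<dots> = ennreal (0 - (- exp (- c * 0) / c))"
  proof (rule nn_integral_FTC_atLeast)
    show "((\<lambda>t. - exp (- c * t) / c) has_real_derivative exp (- c * t)) (at t)" for t
      using c by (auto intro!: derivative_eq_intros)
    have "((\<lambda>t. exp (- (c * t))) \<longlongrightarrow> 0) at_top"
      using c by (intro filterlim_compose[OF exp_at_bot] filterlim_compose[OF filterlim_uminus_at_bot_at_top]
          filterlim_tendsto_pos_mult_at_top[OF tendsto_const] filterlim_ident)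
    then have "((\<lambda>t. - exp (- (c * t)) / c) \<longlongrightarrow> - 0 / c) at_top"
      using c by (intro tendsto_intros) auto
    then show "((\<lambda>t. - exp (- c * t) / c) \<longlongrightarrow> 0) at_top" by simp
  qed auto
  finally show ?thesis by simp
qed

text \<open>Write the integrand as \<open>\<integral> exp (- c t) dc\<close> over \<open>[a, b]\<close> and exchange the integrals.\<close>

lemma Frullani_exp:
  assumes a: "0 < a" "a \<le> b"
  shows "(\<integral>\<^sup>+t. ennreal (1 / t) * ennreal (exp (- a * t) - exp (- b * t)) * indicator {0<..} t \<partial>lborel) =
    ennreal (ln (b / a))"
proof -
  have "(\<integral>\<^sup>+t. ennreal (1 / t) * ennreal (exp (- a * t) - exp (- b * t)) * indicator {0<..} t \<partial>lborel) =
      (\<integral>\<^sup>+t. \<integral>\<^sup>+c. ennreal (exp (- c * t)) * indicator {a..b} c * indicator {0<..} t \<partial>lborel \<partial>lborel)"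
  proof (rule nn_integral_cong)
    fix t :: real
    show "ennreal (1 / t) * ennreal (exp (- a * t) - exp (- b * t)) * indicator {0<..} t =
      (\<integral>\<^sup>+c. ennreal (exp (- c * t)) * indicator {a..b} c * indicator {0<..} t \<partial>lborel)"
    proof (cases "0 < t")
      case True
      have "(\<integral>\<^sup>+c. ennreal (exp (- c * t)) * indicator {a..b} c \<partial>lborel) =
          ennreal (- exp (- b * t) / t - (- exp (- a * t) / t))"
        using True a by (intro nn_integral_FTC_Icc) (auto intro!: derivative_eq_intros)
      also have "- exp (- b * t) / t - (- exp (- a * t) / t) = 1 / t * (exp (- a * t) - exp (- b * t))"
        by (simp add: diff_divide_distrib)
      finally show ?thesis
        using True by (simp add: ennreal_mult'[symmetric])
    qed simp
  qed
  also have "\<dots> = (\<integral>\<^sup>+c. \<integral>\<^sup>+t. ennreal (exp (- c * t)) * indicator {a..b} c * indicator {0<..} t \<partial>lborel \<partial>lborel)"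
    by (rule lborel_pair.Fubini') simp
  also have "\<dots> = (\<integral>\<^sup>+c. ennreal (1 / c) * indicator {a..b} c \<partial>lborel)"
  proof (rule nn_integral_cong)
    fix c :: real
    have "(\<integral>\<^sup>+t. ennreal (exp (- c * t)) * indicator {a..b} c * indicator {0<..} t \<partial>lborel) =
       (\<integral>\<^sup>+t. ennreal (exp (- c * t)) * indicator {0<..} t \<partial>lborel) * indicator {a..b} c"
      by (subst nn_integral_multc[symmetric]) (auto simp: ac_simps)
    also have "\<dots> = ennreal (1 / c) * indicator {a..b} c"
      using a nn_integral_exp_halfline[of c] by (cases "c \<in> {a..b}") auto
    finally show "(\<integral>\<^sup>+t. ennreal (exp (- c * t)) * indicator {a..b} c * indicator {0<..} t \<partial>lborel) =
      ennreal (1 / c) * indicator {a..b} c" .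
  qed
  also have "\<dots> = ennreal (ln b - ln a)"
    using a by (intro nn_integral_FTC_Icc) (auto intro!: derivative_eq_intros)
  also have "ln b - ln a = ln (b / a)" using a by (simp add: ln_div)
  finally show ?thesis .
qed

lemma nn_integral_gamma_density:
  assumes \<alpha>: "0 < \<alpha>" and c: "0 < c"
  shows "(\<integral>\<^sup>+t. ennreal (t powr (\<alpha> - 1) / Gamma \<alpha>) * ennreal (exp (- c * t)) * indicator {0<..} t \<partial>lborel) =
    ennreal (c powr - \<alpha>)"
proof -
  have G: "0 < Gamma \<alpha>" using \<alpha> by (rule Gamma_real_pos)
  let ?I = "\<integral>\<^sup>+t. ennreal (t powr (\<alpha> - 1) / Gamma \<alpha>) * ennreal (exp (- c * t)) * indicator {0<..} t \<partial>lborel"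
  have "ennreal (Gamma \<alpha>) = \<bar>c\<bar> * (\<integral>\<^sup>+t. ennreal (indicator {0..} (0 + c * t) * (0 + c * t) powr (\<alpha> - 1) / exp (0 + c * t)) \<partial>lborel)"
    unfolding Gamma_conv_nn_integral_real[OF \<alpha>] using c by (intro nn_integral_real_affine) auto
  also have "\<dots> = ennreal c * (\<integral>\<^sup>+t. ennreal (c powr (\<alpha> - 1) * Gamma \<alpha>) *
      (ennreal (t powr (\<alpha> - 1) / Gamma \<alpha>) * ennreal (exp (- c * t)) * indicator {0<..} t) \<partial>lborel)"
  proof (intro arg_cong2[where f="(*)"] nn_integral_cong_AE eventually_mono[OF AE_lborel_singleton[of "0::real"]])
    fix t :: real assume "t \<noteq> 0"
    show "ennreal (indicator {0..} (0 + c * t) * (0 + c * t) powr (\<alpha> - 1) / exp (0 + c * t)) =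
      ennreal (c powr (\<alpha> - 1) * Gamma \<alpha>) *
      (ennreal (t powr (\<alpha> - 1) / Gamma \<alpha>) * ennreal (exp (- c * t)) * indicator {0<..} t)"
    proof (cases "0 < t")
      case True
      then show ?thesis
        using c G by (auto simp: ennreal_mult[symmetric] powr_mult exp_minus field_simps)
    next
      case False
      with \<open>t \<noteq> 0\<close> have "c * t < 0" using c by (simp add: mult_pos_neg)
      then show ?thesis using False by simp
    qed
  qed (use c in simp)
  also have "\<dots> = ennreal (c powr \<alpha> * Gamma \<alpha>) * ?I"
    using c G by (subst nn_integral_cmult)
      (auto simp: mult.assoc[symmetric] ennreal_mult[symmetric] powr_diff)
  finally have "ennreal (Gamma \<alpha>) = ennreal (c powr \<alpha> * Gamma \<alpha>) * ?I" .
  then have "ennreal (1 / (c powr \<alpha> * Gamma \<alpha>)) * ennreal (Gamma \<alpha>) =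
      ennreal (1 / (c powr \<alpha> * Gamma \<alpha>)) * ennreal (c powr \<alpha> * Gamma \<alpha>) * ?I"
    by (simp add: mult.assoc)
  then show ?thesis
    using c G by (simp add: ennreal_mult[symmetric] powr_minus field_simps)
qed

text \<open>Jensen's inequality for powers, by induction: \<open>X\<close> and \<open>X\<^sup>n\<close> are positively correlated, because
  \<open>(X - c) (X\<^sup>n - c\<^sup>n) \<ge> 0\<close>.\<close>

lemma (in prob_space) power_expectation_le:
  fixes X :: "'a \<Rightarrow> real"
  assumes [measurable]: "X \<in> borel_measurable M" and X: "\<And>\<omega>. 0 \<le> X \<omega>" "\<And>\<omega>. X \<omega> \<le> 1"
  shows "expectation X ^ n \<le> expectation (\<lambda>\<omega>. X \<omega> ^ n)"
proof (induction n)
  case (Suc n)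
  have int: "integrable M (\<lambda>\<omega>. X \<omega> ^ k)" for k
    using X by (intro integrable_const_bound[of _ 1]) (auto simp: power_le_one)
  let ?c = "expectation X"
  have iX: "integrable M X" using int[of 1] by simp
  have c: "0 \<le> ?c" using X(1) by (intro integral_nonneg_AE) auto
  have pw: "0 \<le> (X \<omega> - ?c) * (X \<omega> ^ n - ?c ^ n)" for \<omega>
    using X(1)[of \<omega>] c by (cases "X \<omega> \<le> ?c") (auto simp: zero_le_mult_iff power_mono)
  have "0 \<le> expectation (\<lambda>\<omega>. (X \<omega> - ?c) * (X \<omega> ^ n - ?c ^ n))"
    using pw by (intro integral_nonneg_AE) auto
  also have "(\<lambda>\<omega>. (X \<omega> - ?c) * (X \<omega> ^ n - ?c ^ n)) =
      (\<lambda>\<omega>. X \<omega> ^ Suc n - ?c ^ n * X \<omega> - ?c * X \<omega> ^ n + ?c ^ Suc n)"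
    by (auto simp: algebra_simps)
  also have "expectation \<dots> = expectation (\<lambda>\<omega>. X \<omega> ^ Suc n) - ?c ^ n * ?c - ?c * expectation (\<lambda>\<omega>. X \<omega> ^ n) + ?c ^ Suc n"
    using int[of "Suc n"] int[of n] iX by (simp del: power_Suc add: prob_space)
  finally have "?c * expectation (\<lambda>\<omega>. X \<omega> ^ n) \<le> expectation (\<lambda>\<omega>. X \<omega> ^ Suc n)" by (simp add: mult.commute)
  moreover have "?c * ?c ^ n \<le> ?c * expectation (\<lambda>\<omega>. X \<omega> ^ n)"
    using Suc c by (rule mult_left_mono)
  ultimately show ?case by simp
qed (simp add: prob_space)

context subordinator_process
begin

lemma exponent_mono:
  assumes "0 \<le> u" "u \<le> v"
  shows "\<phi> u \<le> \<phi> v"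
proof -
  have "exp (- 1 * \<phi> v) \<le> exp (- 1 * \<phi> u)"
    unfolding expectation_exp_neg[OF zero_le_one order.trans[OF assms], symmetric]
      expectation_exp_neg[OF zero_le_one assms(1), symmetric]
    using assms by (intro integral_mono integrable_exp_neg exp_neg_antimono_exponent) auto
  then show ?thesis by simp
qed

text \<open>This growth bound makes the moments of the remainder determine its law.\<close>

lemma exponent_le_linear: "\<phi> (real n) \<le> real n * \<phi> 1" if "1 \<le> n"
proof -
  have [measurable]: "\<xi> 1 \<in> borel_measurable M" by (rule measurable_process) simp
  have "exp_neg (real n) x = exp_neg 1 x ^ n" for x
    using that by (auto simp: exp_neg_def simp flip: exp_of_nat_mult)
  then have "exp (- 1 * \<phi> (real n)) = expectation (\<lambda>\<omega>. exp_neg 1 (\<xi> 1 \<omega>) ^ n)"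
    using expectation_exp_neg[of 1 "real n"] by (simp only: zero_le_one of_nat_0_le_iff)
  also have "\<dots> \<ge> expectation (\<lambda>\<omega>. exp_neg 1 (\<xi> 1 \<omega>)) ^ n"
    by (intro power_expectation_le) (auto simp: exp_neg_nonneg exp_neg_le_1)
  also have "expectation (\<lambda>\<omega>. exp_neg 1 (\<xi> 1 \<omega>)) ^ n = exp (- (real n * \<phi> 1))"
    by (subst expectation_exp_neg) (auto simp flip: exp_of_nat_mult)
  finally show ?thesis by simp
qed

text \<open>The measure \<open>\<integral> w t P(\<xi>\<^sub>t \<in> dx, \<xi>\<^sub>t < \<infinity>) dt\<close> over \<open>t > 0\<close>. The weight \<open>1\<close> gives the potential measure, the
  weight \<open>1 / t\<close> the harmonic potential measure up to an atom at \<open>0\<close>, and a gamma density the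
  potential measure of a power of the exponent. Extending the process
  to negative times by its value at \<open>0\<close> makes it a map on the whole product space.\<close>

definition potential :: "(real \<Rightarrow> real) \<Rightarrow> real measure" where
  "potential w = distr
     (density (lborel \<Otimes>\<^sub>M M)
        (\<lambda>(t, \<omega>). ennreal (w t) * indicator {0<..} t * indicator {..<\<infinity>} (\<xi> (max 0 t) \<omega>)))
     borel (\<lambda>(t, \<omega>). enn2real (\<xi> (max 0 t) \<omega>))"

lemma sets_potential [simp, measurable_cong]: "sets (potential w) = sets borel"
  by (simp add: potential_def)

lemma nn_integral_potential:
  assumes [measurable]: "w \<in> borel_measurable borel" "f \<in> borel_measurable borel"
  shows "(\<integral>\<^sup>+x. f x \<partial>potential w) =
    (\<integral>\<^sup>+t. ennreal (w t) * (\<integral>\<^sup>+\<omega>. f (enn2real (\<xi> t \<omega>)) * indicator {..<\<infinity>} (\<xi> t \<omega>) \<partial>M) * indicator {0<..} t \<partial>lborel)"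
proof -
  have [measurable]: "(\<lambda>(t, \<omega>). \<xi> (max 0 t) \<omega>) \<in> borel_measurable (lborel \<Otimes>\<^sub>M M)"
    using measurable_process_pair by (simp cong: measurable_cong_sets sets_pair_measure_cong)
  have [measurable]: "\<xi> (max 0 t) \<in> borel_measurable M" for t
    by (rule measurable_process) simp
  have "(\<integral>\<^sup>+x. f x \<partial>potential w) =
     (\<integral>\<^sup>+(t, \<omega>). ennreal (w t) * indicator {0<..} t * indicator {..<\<infinity>} (\<xi> (max 0 t) \<omega>) *
        f (enn2real (\<xi> (max 0 t) \<omega>)) \<partial>(lborel \<Otimes>\<^sub>M M))"
    unfolding potential_def
    by (subst nn_integral_distr, measurable, subst nn_integral_density) (measurable, auto simp: case_prod_unfold)
  also have "\<dots> = (\<integral>\<^sup>+t. \<integral>\<^sup>+\<omega>. ennreal (w t) * indicator {0<..} t * indicator {..<\<infinity>} (\<xi> (max 0 t) \<omega>) *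
        f (enn2real (\<xi> (max 0 t) \<omega>)) \<partial>M \<partial>lborel)"
    by (subst nn_integral_fst[symmetric]) auto
  also have "\<dots> = (\<integral>\<^sup>+t. ennreal (w t) * (\<integral>\<^sup>+\<omega>. f (enn2real (\<xi> t \<omega>)) * indicator {..<\<infinity>} (\<xi> t \<omega>) \<partial>M) * indicator {0<..} t \<partial>lborel)"
  proof (rule nn_integral_cong)
    fix t :: real
    show "(\<integral>\<^sup>+\<omega>. ennreal (w t) * indicator {0<..} t * indicator {..<\<infinity>} (\<xi> (max 0 t) \<omega>) *
        f (enn2real (\<xi> (max 0 t) \<omega>)) \<partial>M) =
      ennreal (w t) * (\<integral>\<^sup>+\<omega>. f (enn2real (\<xi> t \<omega>)) * indicator {..<\<infinity>} (\<xi> t \<omega>) \<partial>M) * indicator {0<..} t"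
    proof (cases "0 < t")
      case True
      then have [measurable]: "\<xi> t \<in> borel_measurable M" by (intro measurable_process) simp
      from True have "max 0 t = t" by simp
      then show ?thesis using True by (simp add: nn_integral_cmult[symmetric] ac_simps)
    qed simp
  qed
  finally show ?thesis .
qed

lemma nn_integral_exp_process:
  assumes "0 \<le> t" "0 \<le> u"
  shows "(\<integral>\<^sup>+\<omega>. ennreal (exp (- u * enn2real (\<xi> t \<omega>))) * indicator {..<\<infinity>} (\<xi> t \<omega>) \<partial>M) = ennreal (exp (- t * \<phi> u))"
proof -
  have "(\<integral>\<^sup>+\<omega>. ennreal (exp (- u * enn2real (\<xi> t \<omega>))) * indicator {..<\<infinity>} (\<xi> t \<omega>) \<partial>M) =
      (\<integral>\<^sup>+\<omega>. ennreal (exp_neg u (\<xi> t \<omega>)) \<partial>M)"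
    by (intro nn_integral_cong) (auto simp: exp_neg_def indicator_def less_top)
  also have "\<dots> = ennreal (exp (- t * \<phi> u))"
    unfolding expectation_exp_neg[OF assms, symmetric]
    by (intro nn_integral_eq_integral integrable_exp_neg assms) (simp add: exp_neg_nonneg)
  finally show ?thesis .
qed

lemma harmonic_potential_eq:
  "harmonic_potential M \<xi> = density (potential (\<lambda>t. 1 / t)) (indicator {0<..})"
proof (rule measure_eqI)
  fix B assume "B \<in> sets (harmonic_potential M \<xi>)"
  then have B [measurable]: "B \<in> sets borel" by simp
  have "emeasure (density (potential (\<lambda>t. 1 / t)) (indicator {0<..})) B =
      (\<integral>\<^sup>+x. indicator {0<..} x * indicator B x \<partial>potential (\<lambda>t. 1 / t))"
    by (rule emeasure_density) auto
  also have "\<dots> = (\<integral>\<^sup>+x. indicator (B \<inter> {0<..}) x \<partial>potential (\<lambda>t. 1 / t))"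
    by (rule nn_integral_cong) (auto simp: indicator_def)
  also have "\<dots> = (\<integral>\<^sup>+t. ennreal (1 / t) * (\<integral>\<^sup>+\<omega>. indicator (B \<inter> {0<..}) (enn2real (\<xi> t \<omega>)) *
      indicator {..<\<infinity>} (\<xi> t \<omega>) \<partial>M) * indicator {0<..} t \<partial>lborel)"
    by (rule nn_integral_potential) auto
  also have "\<dots> = emeasure (harmonic_potential M \<xi>) B"
    unfolding emeasure_harmonic_potential[OF subordinator B]
  proof (intro nn_integral_cong)
    fix t :: real
    show "ennreal (1 / t) * (\<integral>\<^sup>+\<omega>. indicator (B \<inter> {0<..}) (enn2real (\<xi> t \<omega>)) *
        indicator {..<\<infinity>} (\<xi> t \<omega>) \<partial>M) * indicator {0<..} t =
      ennreal (1 / t) * emeasure M {\<omega>\<in>space M. \<xi> t \<omega> \<in> ennreal ` (B \<inter> {0<..})} * indicator {0<..} t"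
    proof (cases "0 < t")
      case True
      then have [measurable]: "\<xi> t \<in> borel_measurable M" by (intro measurable_process) simp
      have [measurable]: "ennreal ` (B \<inter> {0<..}) \<in> sets borel" by (rule ennreal_image_borel[OF B])
      have mem: "x \<in> ennreal ` (B \<inter> {0<..}) \<longleftrightarrow> x < \<infinity> \<and> enn2real x \<in> B \<inter> {0<..}" for x
        by (cases x) (auto simp: image_iff enn2real_positive_iff)
      have "(\<integral>\<^sup>+\<omega>. indicator (B \<inter> {0<..}) (enn2real (\<xi> t \<omega>)) * indicator {..<\<infinity>} (\<xi> t \<omega>) \<partial>M) =
          (\<integral>\<^sup>+\<omega>. indicator {\<omega>\<in>space M. \<xi> t \<omega> \<in> ennreal ` (B \<inter> {0<..})} \<omega> \<partial>M)"
        by (rule nn_integral_cong) (auto simp: indicator_def mem)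
      also have "\<dots> = emeasure M {\<omega>\<in>space M. \<xi> t \<omega> \<in> ennreal ` (B \<inter> {0<..})}"
        by (rule nn_integral_indicator) measurable
      finally show ?thesis by simp
    qed simp
  qed
  finally show "emeasure (harmonic_potential M \<xi>) B =
      emeasure (density (potential (\<lambda>t. 1 / t)) (indicator {0<..})) B" by simp
qed simp

end

locale nontrivial_subordinator = subordinator_process +
  assumes nontrivial: "\<exists>u\<ge>0. laplace_exponent M \<xi> u \<noteq> 0"
begin

text \<open>If \<open>\<phi> u = 0\<close> for some \<open>u > 0\<close>, then \<open>\<xi>\<^sub>1 = 0\<close> almost surely and the exponent vanishes identically.\<close>

lemma exponent_pos:
  assumes u: "0 < u"
  shows "0 < \<phi> u"
proof (rule ccontr)
  assume "\<not> 0 < \<phi> u"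
  have [measurable]: "\<xi> 1 \<in> borel_measurable M" by (rule measurable_process) simp
  have E: "expectation (\<lambda>\<omega>. exp_neg v (\<xi> 1 \<omega>)) = exp (- \<phi> v)" if "0 \<le> v" for v
    using expectation_exp_neg[OF zero_le_one that] by simp
  have "1 \<le> expectation (\<lambda>\<omega>. exp_neg u (\<xi> 1 \<omega>))"
    using \<open>\<not> 0 < \<phi> u\<close> u by (simp add: E)
  moreover have "expectation (\<lambda>\<omega>. exp_neg u (\<xi> 1 \<omega>)) \<le> expectation (\<lambda>_. 1)"
    using u by (intro integral_mono integrable_exp_neg) (auto simp: exp_neg_le_1)
  ultimately have "expectation (\<lambda>\<omega>. exp_neg u (\<xi> 1 \<omega>)) = expectation (\<lambda>_. 1)"
    by (simp add: prob_space)
  then have "AE \<omega> in M. exp_neg u (\<xi> 1 \<omega>) = 1"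
    using u by (intro integral_ineq_eq_0_then_AE integrable_exp_neg) (auto simp: exp_neg_le_1)
  then have "AE \<omega> in M. exp_neg v (\<xi> 1 \<omega>) = 1" for v
    by eventually_elim (use u in \<open>auto simp: exp_neg_def split: if_splits\<close>)
  then have "expectation (\<lambda>\<omega>. exp_neg v (\<xi> 1 \<omega>)) = expectation (\<lambda>_. 1)" for v
    by (intro integral_cong_AE) auto
  then have "\<phi> v = 0" if "0 \<le> v" for v
    using E[OF that] by (simp add: prob_space)
  then show False using nontrivial by (auto simp: \<phi>_def)
qed

text \<open>Integrating over the paths first turns the left-hand side into the Frullani integral of
  \<open>exp (- t \<phi> s) - exp (- t \<phi> (s + l))\<close>. The points \<open>0\<close> and \<open>\<infinity>\<close>, which \<open>H\<close> does not charge, contribute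
  nothing, since the integrand vanishes at \<open>0\<close> and both exponentials vanish at \<open>\<infinity>\<close>.\<close>

lemma nn_integral_harmonic_potential:
  assumes s: "0 < s" and l: "0 \<le> l"
  shows "(\<integral>\<^sup>+x. ennreal ((1 - exp (- l * x)) * exp (- s * x)) \<partial>harmonic_potential M \<xi>) =
    ennreal (ln (\<phi> (s + l) / \<phi> s))"
proof -
  let ?f = "\<lambda>x. ennreal ((1 - exp (- l * x)) * exp (- s * x))"
  have "(\<integral>\<^sup>+x. ?f x \<partial>harmonic_potential M \<xi>) = (\<integral>\<^sup>+x. indicator {0<..} x * ?f x \<partial>potential (\<lambda>t. 1 / t))"
    unfolding harmonic_potential_eq by (subst nn_integral_density) auto
  also have "\<dots> = (\<integral>\<^sup>+t. ennreal (1 / t) * (\<integral>\<^sup>+\<omega>. indicator {0<..} (enn2real (\<xi> t \<omega>)) * ?f (enn2real (\<xi> t \<omega>)) *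
      indicator {..<\<infinity>} (\<xi> t \<omega>) \<partial>M) * indicator {0<..} t \<partial>lborel)"
    by (rule nn_integral_potential) auto
  also have "\<dots> = (\<integral>\<^sup>+t. ennreal (1 / t) * ennreal (exp (- \<phi> s * t) - exp (- \<phi> (s + l) * t)) * indicator {0<..} t \<partial>lborel)"
  proof (rule nn_integral_cong)
    fix t :: real
    show "ennreal (1 / t) * (\<integral>\<^sup>+\<omega>. indicator {0<..} (enn2real (\<xi> t \<omega>)) * ?f (enn2real (\<xi> t \<omega>)) *
      indicator {..<\<infinity>} (\<xi> t \<omega>) \<partial>M) * indicator {0<..} t =
      ennreal (1 / t) * ennreal (exp (- \<phi> s * t) - exp (- \<phi> (s + l) * t)) * indicator {0<..} t"
    proof (cases "0 < t")
      case True
      then have [measurable]: "\<xi> t \<in> borel_measurable M" by (intro measurable_process) simp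
      have ge: "exp_neg (s + l) x \<le> exp_neg s x" for x using l by (intro exp_neg_antimono_exponent) simp
      have pw: "indicator {0<..} (enn2real x) * ?f (enn2real x) * indicator {..<\<infinity>} x =
          ennreal (exp_neg s x - exp_neg (s + l) x)" for x
      proof (cases "x < \<infinity>")
        case True
        then have "exp_neg s x - exp_neg (s + l) x = (1 - exp (- l * enn2real x)) * exp (- s * enn2real x)"
          by (simp add: exp_neg_def algebra_simps flip: exp_add)
        then show ?thesis using True by (cases "enn2real x = 0") (auto simp: indicator_def less_le)
      qed (auto simp: exp_neg_def not_less top_unique)
      have "(\<integral>\<^sup>+\<omega>. ennreal (exp_neg s (\<xi> t \<omega>) - exp_neg (s + l) (\<xi> t \<omega>)) \<partial>M) =
          ennreal (expectation (\<lambda>\<omega>. exp_neg s (\<xi> t \<omega>) - exp_neg (s + l) (\<xi> t \<omega>)))"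
        using True s l ge
        by (intro nn_integral_eq_integral Bochner_Integration.integrable_diff integrable_exp_neg) auto
      also have "expectation (\<lambda>\<omega>. exp_neg s (\<xi> t \<omega>) - exp_neg (s + l) (\<xi> t \<omega>)) =
          exp (- \<phi> s * t) - exp (- \<phi> (s + l) * t)"
        using True s l by (simp add: integrable_exp_neg expectation_exp_neg mult.commute)
      finally show ?thesis by (simp only: pw)
    qed simp
  qed
  also have "\<dots> = ennreal (ln (\<phi> (s + l) / \<phi> s))"
    using s l by (intro Frullani_exp exponent_pos exponent_mono) auto
  finally show ?thesis .
qed

text \<open>For \<open>\<alpha> = 1\<close> this is the law of the last position before an exponential level of parameter \<open>s\<close>.\<close>

definition tilted_potential :: "real \<Rightarrow> real \<Rightarrow> real measure" where
  "tilted_potential \<alpha> s = density (potential (\<lambda>t. t powr (\<alpha> - 1) / Gamma \<alpha>))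
     (\<lambda>x. ennreal (\<phi> s powr \<alpha> * exp (- s * x)))"

lemma nn_integral_tilted_potential:
  assumes \<alpha>: "0 < \<alpha>" and s: "0 < s" and u: "- s < u"
  shows "(\<integral>\<^sup>+x. ennreal (exp (- u * x)) \<partial>tilted_potential \<alpha> s) = ennreal ((\<phi> s / \<phi> (s + u)) powr \<alpha>)"
proof -
  have G: "0 < Gamma \<alpha>" using \<alpha> by (rule Gamma_real_pos)
  have pos: "0 < \<phi> s" "0 < \<phi> (s + u)" using s u by (auto intro: exponent_pos)
  let ?w = "\<lambda>t::real. t powr (\<alpha> - 1) / Gamma \<alpha>"
  have "(\<integral>\<^sup>+x. ennreal (exp (- u * x)) \<partial>tilted_potential \<alpha> s) =
      (\<integral>\<^sup>+x. ennreal (\<phi> s powr \<alpha>) * ennreal (exp (- (s + u) * x)) \<partial>potential ?w)"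
    unfolding tilted_potential_def
    by (subst nn_integral_density) (auto intro!: nn_integral_cong simp: ennreal_mult[symmetric] algebra_simps simp flip: exp_add)
  also have "\<dots> = ennreal (\<phi> s powr \<alpha>) * (\<integral>\<^sup>+x. ennreal (exp (- (s + u) * x)) \<partial>potential ?w)"
    by (rule nn_integral_cmult) simp
  also have "(\<integral>\<^sup>+x. ennreal (exp (- (s + u) * x)) \<partial>potential ?w) =
      (\<integral>\<^sup>+t. ennreal (?w t) * (\<integral>\<^sup>+\<omega>. ennreal (exp (- (s + u) * enn2real (\<xi> t \<omega>))) *
        indicator {..<\<infinity>} (\<xi> t \<omega>) \<partial>M) * indicator {0<..} t \<partial>lborel)"
    by (rule nn_integral_potential) auto
  also have "\<dots> = (\<integral>\<^sup>+t. ennreal (?w t) * ennreal (exp (- \<phi> (s + u) * t)) * indicator {0<..} t \<partial>lborel)"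
  proof (rule nn_integral_cong)
    fix t :: real
    show "ennreal (?w t) * (\<integral>\<^sup>+\<omega>. ennreal (exp (- (s + u) * enn2real (\<xi> t \<omega>))) *
        indicator {..<\<infinity>} (\<xi> t \<omega>) \<partial>M) * indicator {0<..} t =
      ennreal (?w t) * ennreal (exp (- \<phi> (s + u) * t)) * indicator {0<..} t"
      using nn_integral_exp_process[of t "s + u"] u by (cases "0 < t") (auto simp: mult.commute)
  qed
  also have "\<dots> = ennreal (\<phi> (s + u) powr - \<alpha>)"
    by (rule nn_integral_gamma_density[OF \<alpha> pos(2)])
  also have "ennreal (\<phi> s powr \<alpha>) * \<dots> = ennreal ((\<phi> s / \<phi> (s + u)) powr \<alpha>)"
    using pos by (simp add: ennreal_mult[symmetric] powr_minus powr_divide field_simps)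
  finally show ?thesis .
qed

lemma real_distribution_tilted_potential:
  assumes "0 < \<alpha>" "0 < s"
  shows "real_distribution (tilted_potential \<alpha> s)"
proof -
  have "(\<integral>\<^sup>+x. 1 \<partial>tilted_potential \<alpha> s) = 1"
    using nn_integral_tilted_potential[OF assms, of 0] exponent_pos[OF assms(2)] assms(2) by simp
  then have "emeasure (tilted_potential \<alpha> s) (space (tilted_potential \<alpha> s)) = 1" by simp
  then have "prob_space (tilted_potential \<alpha> s)" by (rule prob_spaceI)
  then show ?thesis
    by (auto simp: real_distribution_def real_distribution_axioms_def tilted_potential_def)
qed

end

section \<open>Last positions at exponential levels\<close>

text \<open>First passage times are infima of extended reals; this allows reasoning with a real infimum.\<close>

lemma Inf_ennreal_image:
  assumes S: "S \<noteq> {}" "\<And>s. s \<in> S \<Longrightarrow> 0 < s"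
  shows "Inf (ennreal ` S) = ennreal (Inf S)"
proof (rule antisym)
  have bdd: "bdd_below S" using S(2) by (intro bdd_belowI[of _ 0]) (auto intro: less_imp_le)
  show "ennreal (Inf S) \<le> Inf (ennreal ` S)"
    by (intro Inf_greatest) (auto intro!: ennreal_leI cInf_lower bdd)
  show "Inf (ennreal ` S) \<le> ennreal (Inf S)"
  proof (rule ccontr)
    assume "\<not> Inf (ennreal ` S) \<le> ennreal (Inf S)"
    then have "ennreal (Inf S) < Inf (ennreal ` S)" by simp
    then obtain z where z: "ennreal (Inf S) < z" "z < Inf (ennreal ` S)" using dense by blast
    have "0 \<le> Inf S" using S by (intro cInf_greatest) (auto intro: less_imp_le)
    from z obtain y where y: "z = ennreal y" "0 \<le> y" by (cases z) auto
    with z(1) \<open>0 \<le> Inf S\<close> have "Inf S < y" by (simp add: ennreal_less_iff)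
    then obtain s where s: "s \<in> S" "s < y" using cInf_lessD[OF S(1)] by blast
    then have "Inf (ennreal ` S) \<le> ennreal s" by (intro Inf_lower) auto
    also have "\<dots> \<le> z" using s y by (auto intro: ennreal_leI)
    finally show False using z(2) by simp
  qed
qed

text \<open>\<open>J m\<close> is the last point of the grid of mesh \<open>2\<^sup>-\<^sup>m\<close> at which the path is still at or below the level
  \<open>t\<close>. These times converge to the passage time \<open>L\<close> from below. They never reach \<open>L\<close>: right continuity
  would force the value \<open>t\<close> at a dyadic time, which is excluded. Hence the values along them
  converge to the left limit and not to the value at \<open>L\<close>.\<close>

lemma dyadic_left_limit_at_passage:
  fixes f :: "real \<Rightarrow> ennreal" and t :: ennreal
  assumes mono: "\<And>r s. 0 \<le> r \<Longrightarrow> r \<le> s \<Longrightarrow> f r \<le> f s"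
    and rc: "\<And>s. 0 \<le> s \<Longrightarrow> (f \<longlongrightarrow> f s) (at_right s)"
    and f0: "f 0 \<le> t" and pass: "0 \<le> s0" "t < f s0"
    and avoid: "\<And>m j :: nat. f (real j / 2 ^ m) \<noteq> t"
  obtains J :: "nat \<Rightarrow> nat" where
    "\<And>m. f (real (J m) / 2 ^ m) \<le> t" "\<And>m. t < f (real (Suc (J m)) / 2 ^ m)"
    "(\<lambda>m. f (real (J m) / 2 ^ m)) \<longlonglongrightarrow> left_limit f (Inf {ennreal s | s. 0 < s \<and> t < f s})"
proof -
  define S where "S = {s. 0 < s \<and> t < f s}"
  define L where "L = Inf S"
  have s0: "s0 \<in> S" using pass f0 by (cases "s0 = 0") (auto simp: S_def)
  have bdd: "bdd_below S" by (intro bdd_belowI[of _ 0]) (auto simp: S_def)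
  define J where "J m = (LEAST j. t < f (real (Suc j) / 2 ^ m))" for m
  have J1: "t < f (real (Suc (J m)) / 2 ^ m)" for m
  proof -
    obtain j :: nat where "s0 * 2 ^ m \<le> real j" using real_arch_simple by blast
    then have "s0 \<le> real (Suc j) / 2 ^ m" by (simp add: field_simps)
    then have "t < f (real (Suc j) / 2 ^ m)" using pass mono[of s0] by (auto intro: less_le_trans)
    then show ?thesis unfolding J_def by (rule LeastI)
  qed
  have J2: "f (real (J m) / 2 ^ m) \<le> t" for m
  proof (cases "J m")
    case (Suc i)
    then have "\<not> t < f (real (Suc i) / 2 ^ m)"
      using not_less_Least[of i "\<lambda>j. t < f (real (Suc j) / 2 ^ m)"] by (simp add: J_def)
    then show ?thesis using Suc by (simp add: not_less)
  qed (simp add: f0)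
  have lo: "real (J m) / 2 ^ m \<le> L" for m
    unfolding L_def
  proof (rule cInf_greatest)
    fix s assume s: "s \<in> S"
    show "real (J m) / 2 ^ m \<le> s"
    proof (rule ccontr)
      assume "\<not> real (J m) / 2 ^ m \<le> s"
      then have "f s \<le> f (real (J m) / 2 ^ m)" using s by (intro mono) (auto simp: S_def)
      then show False using J2[of m] s by (auto simp: S_def)
    qed
  qed (use s0 in auto)
  have hi: "L \<le> real (Suc (J m)) / 2 ^ m" for m
    unfolding L_def using J1[of m] by (intro cInf_lower bdd) (auto simp: S_def)
  have L0: "0 \<le> L" using lo[of 0] by (rule order.trans[rotated]) simp
  have lo': "real (J m) / 2 ^ m < L" for m
  proof (rule ccontr)
    assume "\<not> real (J m) / 2 ^ m < L"
    then have L: "real (J m) / 2 ^ m = L" using lo[of m] by simp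
    have "t \<le> f L"
    proof (rule tendsto_lowerbound[OF rc[OF L0]])
      show "\<forall>\<^sub>F s in at_right L. t \<le> f s"
        using eventually_at_right_less[of L]
      proof eventually_elim
        case (elim s)
        then obtain s' where s': "s' \<in> S" "s' < s" unfolding L_def using s0 cInf_lessD by blast
        then have "f s' \<le> f s" by (intro mono) (auto simp: S_def)
        then show ?case using s' by (auto simp: S_def)
      qed
    qed simp
    with J2[of m] L have "f (real (J m) / 2 ^ m) = t" by simp
    with avoid show False by blast
  qed
  have Lpos: "0 < L" using lo'[of 0] by (rule order.strict_trans1[rotated]) simp
  have inv: "(\<lambda>m. 1 / 2 ^ m) \<longlonglongrightarrow> (0::real)"
    using LIMSEQ_realpow_zero[of "1/2::real"] by (simp add: power_one_over)
  then have "(\<lambda>m. L - 1 / 2 ^ m) \<longlonglongrightarrow> L - 0" by (intro tendsto_intros)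
  then have "(\<lambda>m. L - 1 / 2 ^ m) \<longlonglongrightarrow> L" by simp
  then have "(\<lambda>m. real (J m) / 2 ^ m) \<longlonglongrightarrow> L"
  proof (rule real_tendsto_sandwich[rotated 2, OF _ tendsto_const[of L]])
    show "\<forall>\<^sub>F m in sequentially. L - 1 / 2 ^ m \<le> real (J m) / 2 ^ m"
      using hi by (intro always_eventually allI) (simp add: add_divide_distrib diff_le_eq add.commute)
    show "\<forall>\<^sub>F m in sequentially. real (J m) / 2 ^ m \<le> L"
      using lo by (intro always_eventually allI)
  qed
  then have Jlim: "filterlim (\<lambda>m. real (J m) / 2 ^ m) (at L within {0..<L}) sequentially"
    unfolding filterlim_at using lo' less_imp_neq[OF lo'] by (intro conjI always_eventually allI) auto
  have nontriv: "at L within {0..<L} \<noteq> bot"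
    using Jlim by (auto simp: filterlim_def bot_unique filtermap_bot_iff)
  define l where "l = (SUP s\<in>{0..<L}. f s)"
  have in_Ico: "\<forall>\<^sub>F s in at L within {0..<L}. s \<in> {0..<L}"
    by (simp add: eventually_at_filter)
  have "(f \<longlongrightarrow> l) (at L within {0..<L})"
  proof (rule order_tendstoI)
    fix a assume "a < l"
    then obtain r where r: "r \<in> {0..<L}" "a < f r" unfolding l_def less_SUP_iff by blast
    have "\<forall>\<^sub>F s in at L within {0..<L}. r < s"
      using r(1) by (intro order_tendstoD(1)[OF tendsto_ident_at]) auto
    then show "\<forall>\<^sub>F s in at L within {0..<L}. a < f s"
      by eventually_elim (use r mono[of r] in \<open>auto intro: less_le_trans\<close>)
  next
    fix a assume a: "l < a"
    show "\<forall>\<^sub>F s in at L within {0..<L}. f s < a"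
      using in_Ico by eventually_elim (rule le_less_trans[OF _ a], auto simp: l_def intro: SUP_upper)
  qed
  note lim = this
  have "{ennreal s | s. 0 < s \<and> t < f s} = ennreal ` S" by (auto simp: S_def)
  moreover have "Inf (ennreal ` S) = ennreal L"
    unfolding L_def using s0 by (intro Inf_ennreal_image) (auto simp: S_def)
  ultimately have "left_limit f (Inf {ennreal s | s. 0 < s \<and> t < f s}) = l"
    using L0 tendsto_Lim[OF nontriv lim] by (simp add: left_limit_def)
  with that[OF J2 J1] filterlim_compose[OF lim Jlim] show ?thesis by simp
qed

lemma tendsto_exp_difference_quotient:
  assumes "(\<lambda>m. h m) \<longlonglongrightarrow> (0::real)" "\<And>m. h m \<noteq> 0"
  shows "(\<lambda>m. (1 - exp (- h m * a)) / h m) \<longlonglongrightarrow> a"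
proof -
  have "((\<lambda>x. - exp (- x * a)) has_real_derivative a) (at 0)"
    by (auto intro!: derivative_eq_intros)
  then have "((\<lambda>x. (- exp (- x * a) - - exp (- 0 * a)) / (x - 0)) \<longlongrightarrow> a) (at 0)"
    by (simp add: has_field_derivative_iff)
  then have "((\<lambda>x. (1 - exp (- x * a)) / x) \<longlongrightarrow> a) (at 0)" by simp
  moreover have "filterlim h (at 0) sequentially"
    using assms by (auto simp: filterlim_at)
  ultimately show ?thesis by (rule filterlim_compose)
qed

context subordinator_process
begin

text \<open>Integrating out an independent exponential level, with the path and the level as the two
  independent coordinates.\<close>

lemma nn_integral_process_exponential:
  assumes e: "independent_exponential M \<xi> r e" and "0 < r"
    and F: "case_prod F \<in> borel_measurable (sigma (space M) (process_events M \<xi> {0..}) \<Otimes>\<^sub>M borel)"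
  shows "(\<integral>\<^sup>+\<omega>. F \<omega> (e \<omega>) \<partial>M) =
    (\<integral>\<^sup>+\<omega>. \<integral>\<^sup>+y. ennreal (exponential_density r y) * F \<omega> y \<partial>lborel \<partial>M)"
proof -
  let ?G = "process_events M \<xi> {0..}"
  let ?P = "sigma (space M) ?G"
  have dist: "distributed M lborel e (exponential_density r)"
    and ind: "indep_set ?G {e -` B \<inter> space M | B. B \<in> sets borel}"
    using e by (auto simp: independent_exponential_def)
  have e_meas [measurable]: "e \<in> borel_measurable M"
    using distributed_measurable[OF dist] by simp
  have Gev: "?G \<subseteq> events" using ind by (simp add: indep_sets2_eq)
  then have Gsub: "?G \<subseteq> Pow (space M)" using sets.sets_into_space by blast
  have "(\<Union>t\<in>{0..}. {\<xi> t -` B \<inter> space M | B. B \<in> sets borel}) \<subseteq> Pow (space M)" by auto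
  then have setsP: "sets ?P = ?G"
    using Gsub by (simp add: process_events_def sigma_sets_sigma_sets_eq)
  have idP [measurable]: "(\<lambda>\<omega>. \<omega>) \<in> measurable M ?P"
    using Gev Gsub by (intro measurable_sigma_sets[OF sets_measure_of]) (auto intro: sets.Int)
  interpret P: prob_space "distr M ?P (\<lambda>\<omega>. \<omega>)" by (rule prob_space_distr) simp
  interpret E: prob_space "distr M borel e" by (rule prob_space_distr) simp
  have prod: "distr M ?P (\<lambda>\<omega>. \<omega>) \<Otimes>\<^sub>M distr M borel e = distr M (?P \<Otimes>\<^sub>M borel) (\<lambda>\<omega>. (\<omega>, e \<omega>))"
  proof (rule pair_measure_eqI)
    fix A B assume "A \<in> sets (distr M ?P (\<lambda>\<omega>. \<omega>))" "B \<in> sets (distr M borel e)"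
    then have A: "A \<in> ?G" "A \<in> sets ?P" and B: "B \<in> sets borel" using setsP by auto
    have "prob (A \<inter> (e -` B \<inter> space M)) = prob A * prob (e -` B \<inter> space M)"
      using ind A(1) B unfolding indep_sets2_eq by blast
    moreover have "A \<inter> (e -` B \<inter> space M) = (\<lambda>\<omega>. (\<omega>, e \<omega>)) -` (A \<times> B) \<inter> space M" by auto
    moreover have "(\<lambda>\<omega>. \<omega>) -` A \<inter> space M = A" using A(1) Gsub by auto
    ultimately show "emeasure (distr M ?P (\<lambda>\<omega>. \<omega>)) A * emeasure (distr M borel e) B =
        emeasure (distr M (?P \<Otimes>\<^sub>M borel) (\<lambda>\<omega>. (\<omega>, e \<omega>))) (A \<times> B)"
      using A(2) B by (simp add: emeasure_distr emeasure_eq_measure ennreal_mult'[symmetric])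
  qed (auto cong: sets_pair_measure_cong intro: P.sigma_finite_measure_axioms E.sigma_finite_measure_axioms)
  have Fm: "(\<lambda>p. F (fst p) (snd p)) \<in> borel_measurable (?P \<Otimes>\<^sub>M borel)"
    using F by (simp add: case_prod_unfold)
  have inner: "(\<integral>\<^sup>+y. F \<omega> y \<partial>distr M borel e) = (\<integral>\<^sup>+y. ennreal (exponential_density r y) * F \<omega> y \<partial>lborel)"
    if "\<omega> \<in> space M" for \<omega>
  proof -
    have "F \<omega> \<in> borel_measurable borel"
      using measurable_compose[OF measurable_Pair1'[of \<omega> ?P borel] Fm] that Gsub by (simp add: space_measure_of_conv)
    then show ?thesis
      using distributed_nn_integral[OF dist, of "F \<omega>"] by (subst nn_integral_distr) auto
  qed
  have "(\<integral>\<^sup>+\<omega>. F \<omega> (e \<omega>) \<partial>M) = (\<integral>\<^sup>+p. F (fst p) (snd p) \<partial>distr M (?P \<Otimes>\<^sub>M borel) (\<lambda>\<omega>. (\<omega>, e \<omega>)))"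
    using Fm by (subst nn_integral_distr) auto
  also have "\<dots> = (\<integral>\<^sup>+\<omega>. \<integral>\<^sup>+y. F \<omega> y \<partial>distr M borel e \<partial>distr M ?P (\<lambda>\<omega>. \<omega>))"
    unfolding prod[symmetric] using Fm
    by (subst E.nn_integral_fst[symmetric]) (auto cong: measurable_cong_sets sets_pair_measure_cong)
  also have "\<dots> = (\<integral>\<^sup>+\<omega>. \<integral>\<^sup>+y. F \<omega> y \<partial>distr M borel e \<partial>M)"
  proof (rule nn_integral_distr[OF idP])
    show "(\<lambda>\<omega>. \<integral>\<^sup>+y. F \<omega> y \<partial>distr M borel e) \<in> borel_measurable (distr M ?P (\<lambda>\<omega>. \<omega>))"
      using E.borel_measurable_nn_integral_fst[of "case_prod F" ?P] F
      by (simp cong: measurable_cong_sets sets_pair_measure_cong)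
  qed
  also have "\<dots> = (\<integral>\<^sup>+\<omega>. \<integral>\<^sup>+y. ennreal (exponential_density r y) * F \<omega> y \<partial>lborel \<partial>M)"
    by (rule nn_integral_cong) (rule inner)
  finally show ?thesis .
qed

lemma process_events_subset: "process_events M \<xi> T \<subseteq> Pow (space M)"
proof -
  have "(\<Union>t\<in>T. {\<xi> t -` B \<inter> space M | B. B \<in> sets borel}) \<subseteq> Pow (space M)" by auto
  from sigma_sets_into_sp[OF this] show ?thesis by (auto simp: process_events_def)
qed

lemma measurable_process_events:
  assumes "0 \<le> t"
  shows "\<xi> t \<in> borel_measurable (sigma (space M) (process_events M \<xi> {0..}))"
proof (rule measurableI)
  fix B :: "ennreal set" assume "B \<in> sets borel"
  then have "\<xi> t -` B \<inter> space M \<in> process_events M \<xi> {0..}"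
    unfolding process_events_def using assms
    by (intro sigma_sets.Basic UN_I[of t] CollectI exI[of _ B] conjI) auto
  then show "\<xi> t -` B \<inter> space (sigma (space M) (process_events M \<xi> {0..})) \<in>
      sets (sigma (space M) (process_events M \<xi> {0..}))"
    using process_events_subset by (simp add: sigma_sets.Basic)
qed simp

text \<open>Given the path, the level has a density, so it avoids the single value \<open>\<xi>\<^sub>t\<close>.\<close>

lemma AE_exponential_ne_process:
  assumes e: "independent_exponential M \<xi> r e" and r: "0 < r" and t: "0 \<le> t"
  shows "AE \<omega> in M. \<xi> t \<omega> \<noteq> ennreal (e \<omega>) \<or> e \<omega> \<le> 0"
proof -
  have [measurable]: "\<xi> t \<in> borel_measurable (sigma (space M) (process_events M \<xi> {0..}))"
    by (rule measurable_process_events[OF t])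
  have [measurable]: "\<xi> t \<in> borel_measurable M" by (rule measurable_process[OF t])
  have [measurable]: "e \<in> borel_measurable M"
    using e by (auto simp: independent_exponential_def dest: distributed_measurable)
  let ?F = "\<lambda>\<omega> y. if \<xi> t \<omega> = ennreal y \<and> 0 < y then 1 else (0::ennreal)"
  have "(\<integral>\<^sup>+\<omega>. ?F \<omega> (e \<omega>) \<partial>M) =
     (\<integral>\<^sup>+\<omega>. \<integral>\<^sup>+y. ennreal (exponential_density r y) * ?F \<omega> y \<partial>lborel \<partial>M)"
    by (rule nn_integral_process_exponential[OF e r]) measurable
  also have "\<dots> = (\<integral>\<^sup>+\<omega>. \<integral>\<^sup>+(y::real). 0 \<partial>lborel \<partial>M)"
  proof (rule nn_integral_cong, rule nn_integral_cong_AE)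
    fix \<omega>
    show "AE y in lborel. ennreal (exponential_density r y) * ?F \<omega> y = 0"
      using AE_lborel_singleton[of "enn2real (\<xi> t \<omega>)"] by eventually_elim auto
  qed
  finally have "(\<integral>\<^sup>+\<omega>. ?F \<omega> (e \<omega>) \<partial>M) = 0" by simp
  then have "AE \<omega> in M. ?F \<omega> (e \<omega>) = 0"
    by (subst (asm) nn_integral_0_iff_AE) auto
  then show ?thesis by eventually_elim (auto split: if_splits)
qed

text \<open>Given the path, the level falls into \<open>[\<xi>\<^sub>s, \<xi>\<^sub>s\<^sub>+\<^sub>t)\<close> with probability
  \<open>exp (- r \<xi>\<^sub>s) - exp (- r \<xi>\<^sub>s\<^sub>+\<^sub>t) = exp (- r \<xi>\<^sub>s) (1 - exp (- r (\<xi>\<^sub>s\<^sub>+\<^sub>t - \<xi>\<^sub>s)))\<close>, and the increment is independent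
  of \<open>\<xi>\<^sub>s\<close>.\<close>

lemma nn_integral_before_exponential:
  assumes e: "independent_exponential M \<xi> r e" and r: "0 < r" and u: "- r < u" and st: "0 \<le> s" "0 \<le> t"
  shows "(\<integral>\<^sup>+\<omega>. (if \<xi> s \<omega> \<le> ennreal (e \<omega>) \<and> ennreal (e \<omega>) < \<xi> (s + t) \<omega>
      then ennreal (exp_neg u (\<xi> s \<omega>)) else 0) \<partial>M) =
    ennreal (exp (- s * \<phi> (r + u)) * (1 - exp (- t * \<phi> r)))"
proof -
  have [measurable]: "\<xi> s \<in> borel_measurable (sigma (space M) (process_events M \<xi> {0..}))"
    "\<xi> (s + t) \<in> borel_measurable (sigma (space M) (process_events M \<xi> {0..}))"
    using st by (auto intro: measurable_process_events)
  let ?F = "\<lambda>\<omega> y. if \<xi> s \<omega> \<le> ennreal y \<and> ennreal y < \<xi> (s + t) \<omega> then ennreal (exp_neg u (\<xi> s \<omega>)) else 0"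
  have "(\<integral>\<^sup>+\<omega>. ?F \<omega> (e \<omega>) \<partial>M) =
     (\<integral>\<^sup>+\<omega>. \<integral>\<^sup>+y. ennreal (exponential_density r y) * ?F \<omega> y \<partial>lborel \<partial>M)"
    by (rule nn_integral_process_exponential[OF e r]) measurable
  also have "\<dots> = (\<integral>\<^sup>+\<omega>. ennreal (exp_neg (r + u) (\<xi> s \<omega>)) * ennreal (1 - exp_neg r (\<xi> (s + t) \<omega> - \<xi> s \<omega>)) *
       indicator {..<\<infinity>} (\<xi> s \<omega>) \<partial>M)"
  proof (rule nn_integral_cong)
    fix \<omega> assume \<omega>: "\<omega> \<in> space M"
    have le: "\<xi> s \<omega> \<le> \<xi> (s + t) \<omega>" using st by (intro process_mono[OF \<omega>]) auto
    show "(\<integral>\<^sup>+y. ennreal (exponential_density r y) * ?F \<omega> y \<partial>lborel) =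
       ennreal (exp_neg (r + u) (\<xi> s \<omega>)) * ennreal (1 - exp_neg r (\<xi> (s + t) \<omega> - \<xi> s \<omega>)) *
       indicator {..<\<infinity>} (\<xi> s \<omega>)"
    proof (cases "\<xi> s \<omega> < \<infinity>")
      case False
      then have "\<xi> s \<omega> = \<infinity>" by (simp add: not_less top_unique)
      then show ?thesis by (simp add: exp_neg_def top_unique)
    next
      case True
      define x where "x = enn2real (\<xi> s \<omega>)"
      have x: "\<xi> s \<omega> = ennreal x" "0 \<le> x" using True by (auto simp: x_def)
      have tail: "(\<integral>\<^sup>+y. ennreal (r * exp (- r * y)) * indicator {x..} y \<partial>lborel) = ennreal (exp (- r * x))"
      proof -
        have "(\<integral>\<^sup>+y. ennreal (r * exp (- r * y)) * indicator {x..} y \<partial>lborel) = ennreal (0 - - exp (- r * x))"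
        proof (rule nn_integral_FTC_atLeast)
          show "((\<lambda>y. - exp (- r * y)) has_real_derivative r * exp (- r * y)) (at y)" for y
            by (auto intro!: derivative_eq_intros)
          have "((\<lambda>y. exp (- (r * y))) \<longlongrightarrow> 0) at_top"
            using r by (intro filterlim_compose[OF exp_at_bot] filterlim_compose[OF filterlim_uminus_at_bot_at_top]
                filterlim_tendsto_pos_mult_at_top[OF tendsto_const] filterlim_ident)
          then show "((\<lambda>y. - exp (- r * y)) \<longlongrightarrow> 0) at_top"
            using tendsto_minus by fastforce
        qed (use r in auto)
        then show ?thesis by simp
      qed
      have between: "(\<integral>\<^sup>+y. ennreal (r * exp (- r * y)) * indicator {y. x \<le> y \<and> ennreal y < \<xi> (s + t) \<omega>} y \<partial>lborel) =
          ennreal (exp (- r * x) - exp_neg r (\<xi> (s + t) \<omega>))"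
      proof (cases "\<xi> (s + t) \<omega>")
        case top
        then show ?thesis using tail by (simp add: exp_neg_def atLeast_def)
      next
        case (real z)
        then have xz: "x \<le> z" using le x by simp
        have "(\<integral>\<^sup>+y. ennreal (r * exp (- r * y)) * indicator {y. x \<le> y \<and> ennreal y < \<xi> (s + t) \<omega>} y \<partial>lborel) =
            (\<integral>\<^sup>+y. ennreal (r * exp (- r * y)) * indicator {x..z} y \<partial>lborel)"
          using AE_lborel_singleton[of z]
          by (intro nn_integral_cong_AE, eventually_elim)
             (use real x(2) in \<open>auto simp: indicator_def ennreal_less_iff\<close>)
        also have "\<dots> = ennreal (- exp (- r * z) - - exp (- r * x))"
          using xz r by (intro nn_integral_FTC_Icc) (auto intro!: derivative_eq_intros)
        finally show ?thesis using real by (simp add: exp_neg_def)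
      qed
      have "(\<integral>\<^sup>+y. ennreal (exponential_density r y) * ?F \<omega> y \<partial>lborel) =
         (\<integral>\<^sup>+y. ennreal (exp_neg u (\<xi> s \<omega>)) *
           (ennreal (r * exp (- r * y)) * indicator {y. x \<le> y \<and> ennreal y < \<xi> (s + t) \<omega>} y) \<partial>lborel)"
        using AE_lborel_singleton[of "0::real"]
      proof (intro nn_integral_cong_AE, eventually_elim)
        case (elim y)
        have "\<xi> s \<omega> \<le> ennreal y \<longleftrightarrow> x \<le> y" if "0 \<le> y" using x that by (simp add: ennreal_le_iff)
        then show ?case
          using x(2) elim by (auto simp: exponential_density_def indicator_def ac_simps)
      qed
      also have "\<dots> = ennreal (exp_neg u (\<xi> s \<omega>)) * ennreal (exp (- r * x) - exp_neg r (\<xi> (s + t) \<omega>))"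
        by (subst nn_integral_cmult, simp, simp only: between)
      also have "exp_neg r (\<xi> (s + t) \<omega>) = exp (- r * x) * exp_neg r (\<xi> (s + t) \<omega> - \<xi> s \<omega>)"
        using diff_add_cancel_ennreal[OF le] exp_neg_add[of r "\<xi> (s + t) \<omega> - \<xi> s \<omega>" "\<xi> s \<omega>"] x
        by (simp add: exp_neg_def[of r "ennreal x"] mult.commute)
      also have "exp (- r * x) - \<dots> = exp (- r * x) * (1 - exp_neg r (\<xi> (s + t) \<omega> - \<xi> s \<omega>))"
        by (simp add: algebra_simps)
      also have "ennreal (exp_neg u (\<xi> s \<omega>)) * ennreal \<dots> =
          ennreal (exp_neg (r + u) (\<xi> s \<omega>)) * ennreal (1 - exp_neg r (\<xi> (s + t) \<omega> - \<xi> s \<omega>))"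
        using x r by (simp add: exp_neg_def[of _ "ennreal x"] exp_neg_le_1 mult.assoc[symmetric] ennreal_mult'[symmetric] algebra_simps flip: exp_add)
      finally show ?thesis using True by simp
    qed
  qed
  also have "\<dots> = (\<integral>\<^sup>+\<omega>. ennreal (exp_neg (r + u) (\<xi> s \<omega>)) * indicator {..<\<infinity>} (\<xi> s \<omega>) \<partial>M) *
      (\<integral>\<^sup>+\<omega>. ennreal (1 - exp_neg r (\<xi> t \<omega>)) \<partial>M)"
    by (rule increment_independent[OF st, where f="\<lambda>x. ennreal (exp_neg (r + u) x)" and h="\<lambda>x. ennreal (1 - exp_neg r x)"]) auto
  also have "(\<integral>\<^sup>+\<omega>. ennreal (exp_neg (r + u) (\<xi> s \<omega>)) * indicator {..<\<infinity>} (\<xi> s \<omega>) \<partial>M) =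
      (\<integral>\<^sup>+\<omega>. ennreal (exp (- (r + u) * enn2real (\<xi> s \<omega>))) * indicator {..<\<infinity>} (\<xi> s \<omega>) \<partial>M)"
    by (intro nn_integral_cong) (auto simp: exp_neg_def indicator_def)
  also have "\<dots> = ennreal (exp (- s * \<phi> (r + u)))"
    using st u by (intro nn_integral_exp_process) auto
  also have "(\<integral>\<^sup>+\<omega>. ennreal (1 - exp_neg r (\<xi> t \<omega>)) \<partial>M) = ennreal (expectation (\<lambda>\<omega>. 1 - exp_neg r (\<xi> t \<omega>)))"
    using r st by (intro nn_integral_eq_integral) (auto intro!: Bochner_Integration.integrable_diff integrable_exp_neg simp: exp_neg_le_1)
  also have "expectation (\<lambda>\<omega>. 1 - exp_neg r (\<xi> t \<omega>)) = 1 - exp (- t * \<phi> r)"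
    using r st by (simp add: integrable_exp_neg expectation_exp_neg prob_space)
  finally show ?thesis by (simp only: ennreal_mult'[OF exp_ge_zero])
qed

end

context nontrivial_subordinator
begin

text \<open>\<open>E exp (- \<xi>\<^sub>n) = exp (- n \<phi> 1)\<close> is summable, so \<open>exp (- \<xi>\<^sub>n)\<close> tends to \<open>0\<close> almost surely.\<close>

lemma AE_process_unbounded: "AE \<omega> in M. \<forall>c::real. \<exists>n::nat. ennreal c < \<xi> (real n) \<omega>"
proof -
  have [measurable]: "\<xi> (real n) \<in> borel_measurable M" for n by (rule measurable_process) simp
  have p: "0 < \<phi> 1" by (rule exponent_pos) simp
  have "(\<integral>\<^sup>+\<omega>. (\<Sum>n. ennreal (exp_neg 1 (\<xi> (real n) \<omega>))) \<partial>M) = (\<Sum>n. \<integral>\<^sup>+\<omega>. ennreal (exp_neg 1 (\<xi> (real n) \<omega>)) \<partial>M)"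
    by (rule nn_integral_suminf) simp
  also have "\<dots> = (\<Sum>n. ennreal (exp (- \<phi> 1) ^ n))"
  proof (rule suminf_cong)
    fix n
    show "(\<integral>\<^sup>+\<omega>. ennreal (exp_neg 1 (\<xi> (real n) \<omega>)) \<partial>M) = ennreal (exp (- \<phi> 1) ^ n)"
      by (subst nn_integral_eq_integral)
         (auto intro!: integrable_exp_neg simp: exp_neg_nonneg expectation_exp_neg simp flip: exp_of_nat_mult)
  qed
  also have "\<dots> = ennreal (1 / (1 - exp (- \<phi> 1)))"
    using p by (intro suminf_ennreal_eq geometric_sums) auto
  finally have "AE \<omega> in M. (\<Sum>n. ennreal (exp_neg 1 (\<xi> (real n) \<omega>))) \<noteq> \<infinity>"
    by (intro nn_integral_PInf_AE) auto
  then show ?thesis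
  proof eventually_elim
    case (elim \<omega>)
    then have "summable (\<lambda>n. exp_neg 1 (\<xi> (real n) \<omega>))"
      by (intro summable_suminf_not_top) (auto simp: exp_neg_nonneg)
    then have lim: "(\<lambda>n. exp_neg 1 (\<xi> (real n) \<omega>)) \<longlonglongrightarrow> 0" by (rule summable_LIMSEQ_zero)
    show ?case
    proof
      fix c :: real
      define c' where "c' = max 0 c"
      have "\<forall>\<^sub>F n in sequentially. exp_neg 1 (\<xi> (real n) \<omega>) < exp (- c')"
        using lim by (rule order_tendstoD) simp
      then obtain n where n: "exp_neg 1 (\<xi> (real n) \<omega>) < exp (- c')"
        by (auto simp: eventually_sequentially)
      have "ennreal c < \<xi> (real n) \<omega>"
      proof (rule ccontr)
        assume "\<not> ennreal c < \<xi> (real n) \<omega>"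
        moreover have "ennreal c \<le> ennreal c'" "0 \<le> c'" by (auto simp: c'_def intro: ennreal_leI)
        ultimately have "\<xi> (real n) \<omega> \<le> ennreal c'" by (auto simp: not_less intro: order.trans)
        from exp_neg_antimono[OF zero_le_one this] n \<open>0 \<le> c'\<close> show False
          by (simp add: exp_neg_def[of _ "ennreal c'"])
      qed
      then show "\<exists>n::nat. ennreal c < \<xi> (real n) \<omega>" by blast
    qed
  qed
qed

text \<open>On the grid of mesh \<open>h = 2\<^sup>-\<^sup>m\<close> the last position before the level is \<open>\<xi>\<^sub>j\<^sub>h\<close> for the unique \<open>j\<close> such
  that the level lies in \<open>[\<xi>\<^sub>j\<^sub>h, \<xi>\<^sub>j\<^sub>h\<^sub>+\<^sub>h)\<close>. Its Laplace transform is the geometric sum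
  \<open>(1 - exp (- h \<phi> r)) / (1 - exp (- h \<phi> (r + u)))\<close>, which tends to \<open>\<phi> r / \<phi> (r + u)\<close>. For negative \<open>u\<close>
  the passage to the limit is dominated by \<open>exp (- u e)\<close>, as last positions lie below the level \<open>e\<close>.\<close>

theorem nn_integral_last_position:
  assumes e: "independent_exponential M \<xi> r e" and r: "0 < r" and u: "- r < u"
    and [measurable]: "(\<lambda>\<omega>. last_position \<xi> (e \<omega>) \<omega>) \<in> borel_measurable M"
  shows "(\<integral>\<^sup>+\<omega>. ennreal (exp (- u * last_position \<xi> (e \<omega>) \<omega>)) \<partial>M) = ennreal (\<phi> r / \<phi> (r + u))"
proof -
  have [measurable]: "\<xi> (real j / 2 ^ m) \<in> borel_measurable M" for j m :: nat
    by (rule measurable_process) simp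
  have dist: "distributed M lborel e (exponential_density r)"
    using e by (simp add: independent_exponential_def)
  have [measurable]: "e \<in> borel_measurable M"
    using distributed_measurable[OF dist] by simp
  have pos: "0 < \<phi> r" "0 < \<phi> (r + u)" using r u by (auto intro: exponent_pos)
  let ?d = "\<lambda>j m \<omega>. \<xi> (real j / 2 ^ m) \<omega>"
  \<comment> \<open>At most one summand is nonzero: the one of the grid interval across which the path passes the level.\<close>
  define D where "D m \<omega> = (\<Sum>j. if ?d j m \<omega> \<le> ennreal (e \<omega>) \<and> ennreal (e \<omega>) < ?d (Suc j) m \<omega>
      then ennreal (exp_neg u (?d j m \<omega>)) else 0)" for m \<omega>
  have D_meas [measurable]: "D m \<in> borel_measurable M" for m
    unfolding D_def by measurable
  define h where "h m = (1 / 2 ^ m :: real)" for m :: nat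
  have h: "0 < h m" for m by (simp add: h_def)
  have hlim: "h \<longlonglongrightarrow> 0"
    unfolding h_def using LIMSEQ_realpow_zero[of "1/2::real"] by (simp add: power_one_over)
  have intD: "(\<integral>\<^sup>+\<omega>. D m \<omega> \<partial>M) = ennreal ((1 - exp (- h m * \<phi> r)) / (1 - exp (- h m * \<phi> (r + u))))" for m
  proof -
    have "(\<integral>\<^sup>+\<omega>. D m \<omega> \<partial>M) = (\<Sum>j. \<integral>\<^sup>+\<omega>. (if ?d j m \<omega> \<le> ennreal (e \<omega>) \<and> ennreal (e \<omega>) < ?d (Suc j) m \<omega>
      then ennreal (exp_neg u (?d j m \<omega>)) else 0) \<partial>M)"
      unfolding D_def by (rule nn_integral_suminf) measurable
    also have "\<dots> = (\<Sum>j. ennreal (exp (- h m * \<phi> (r + u)) ^ j * (1 - exp (- h m * \<phi> r))))"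
    proof (rule suminf_cong)
      fix j :: nat
      have s: "real (Suc j) / 2 ^ m = real j / 2 ^ m + h m" by (simp add: h_def add_divide_distrib)
      have "exp (- (real j / 2 ^ m) * \<phi> (r + u)) = exp (- h m * \<phi> (r + u)) ^ j"
        by (simp add: h_def flip: exp_of_nat_mult)
      with nn_integral_before_exponential[OF e r u, of "real j / 2 ^ m" "h m"] h[of m]
      show "(\<integral>\<^sup>+\<omega>. (if ?d j m \<omega> \<le> ennreal (e \<omega>) \<and> ennreal (e \<omega>) < ?d (Suc j) m \<omega>
          then ennreal (exp_neg u (?d j m \<omega>)) else 0) \<partial>M) =
        ennreal (exp (- h m * \<phi> (r + u)) ^ j * (1 - exp (- h m * \<phi> r)))"
        unfolding s by simp
    qed
    also have "\<dots> = ennreal (1 / (1 - exp (- h m * \<phi> (r + u))) * (1 - exp (- h m * \<phi> r)))"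
    proof (intro suminf_ennreal_eq sums_mult2 geometric_sums)
      show "0 \<le> exp (- h m * \<phi> (r + u)) ^ i * (1 - exp (- h m * \<phi> r))" for i
        using pos h[of m] by simp
      show "norm (exp (- h m * \<phi> (r + u))) < 1" using pos h[of m] by simp
    qed
    finally show ?thesis by simp
  qed
  have lim: "(\<lambda>m. \<integral>\<^sup>+\<omega>. D m \<omega> \<partial>M) \<longlonglongrightarrow> ennreal (\<phi> r / \<phi> (r + u))"
  proof -
    have "(\<lambda>m. ((1 - exp (- h m * \<phi> r)) / h m) / ((1 - exp (- h m * \<phi> (r + u))) / h m)) \<longlonglongrightarrow> \<phi> r / \<phi> (r + u)"
      using pos h by (intro tendsto_divide tendsto_exp_difference_quotient hlim) (auto simp: less_le)
    moreover have "((1 - exp (- h m * \<phi> r)) / h m) / ((1 - exp (- h m * \<phi> (r + u))) / h m) =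
        (1 - exp (- h m * \<phi> r)) / (1 - exp (- h m * \<phi> (r + u)))" for m
      using h[of m] by simp
    ultimately show ?thesis unfolding intD by (intro tendsto_ennrealI) (simp only:)
  qed
  have AE_e: "AE \<omega> in M. 0 < e \<omega>"
  proof -
    have "AE y in lborel. 0 < ennreal (exponential_density r y) \<longrightarrow> 0 < y"
      using AE_lborel_singleton[of "0::real"] by eventually_elim (auto simp: exponential_density_def)
    then show ?thesis
      using distributed_AE2[OF dist, of "\<lambda>y. 0 < y"] by simp
  qed
  have AE_avoid: "AE \<omega> in M. \<forall>m j. ?d j m \<omega> \<noteq> ennreal (e \<omega>) \<or> e \<omega> \<le> 0"
    unfolding AE_all_countable by (intro allI AE_exponential_ne_process[OF e r]) simp
  have path: "AE \<omega> in M. (\<lambda>m. D m \<omega>) \<longlonglongrightarrow> ennreal (exp (- u * last_position \<xi> (e \<omega>) \<omega>)) \<and>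
      (\<forall>m. D m \<omega> \<le> ennreal (exp (max 0 (- u) * e \<omega>)))"
    using AE_space AE_e AE_avoid AE_process_unbounded
  proof eventually_elim
    case (elim \<omega>)
    have avoid: "?d j m \<omega> \<noteq> ennreal (e \<omega>)" for j m using elim by (auto simp: not_le)
    obtain n :: nat where n: "ennreal (e \<omega>) < \<xi> (real n) \<omega>" using elim by blast
    obtain J where J: "\<And>m. ?d (J m) m \<omega> \<le> ennreal (e \<omega>)" "\<And>m. ennreal (e \<omega>) < ?d (Suc (J m)) m \<omega>"
      "(\<lambda>m. ?d (J m) m \<omega>) \<longlonglongrightarrow> left_limit (\<lambda>s. \<xi> s \<omega>) (first_passage \<xi> (e \<omega>) \<omega>)"
      unfolding first_passage_def
      by (rule dyadic_left_limit_at_passage[of "\<lambda>s. \<xi> s \<omega>" "ennreal (e \<omega>)" "real n"])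
         (use elim n avoid in \<open>auto intro: process_mono process_right_continuous simp: process_0\<close>)
    have DJ: "D m \<omega> = ennreal (exp_neg u (?d (J m) m \<omega>))" for m
    proof -
      have "\<not> (?d j m \<omega> \<le> ennreal (e \<omega>) \<and> ennreal (e \<omega>) < ?d (Suc j) m \<omega>)" if "j \<noteq> J m" for j
      proof (cases "j < J m")
        case True
        then have "?d (Suc j) m \<omega> \<le> ?d (J m) m \<omega>"
          using elim by (intro process_mono divide_right_mono) auto
        then show ?thesis using J(1)[of m] by auto
      next
        case False
        then have "?d (Suc (J m)) m \<omega> \<le> ?d j m \<omega>"
          using elim that by (intro process_mono divide_right_mono) auto
        then show ?thesis using J(2)[of m] by auto
      qed
      then show ?thesis unfolding D_def using J(1)[of m] J(2)[of m] by (subst suminf_finite[of "{J m}"]) auto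
    qed
    have fin: "?d (J m) m \<omega> < \<infinity>" for m
      using J(1)[of m] by (auto intro: le_less_trans)
    have DJ': "D m \<omega> = ennreal (exp (- u * enn2real (?d (J m) m \<omega>)))" for m
      using fin[of m] by (simp add: DJ exp_neg_def)
    have "left_limit (\<lambda>s. \<xi> s \<omega>) (first_passage \<xi> (e \<omega>) \<omega>) \<le> ennreal (e \<omega>)"
      using J by (intro LIMSEQ_le_const2[OF J(3)]) auto
    then have "left_limit (\<lambda>s. \<xi> s \<omega>) (first_passage \<xi> (e \<omega>) \<omega>) = ennreal (last_position \<xi> (e \<omega>) \<omega>)"
      unfolding last_position_def by (intro ennreal_enn2real[symmetric]) (auto intro: le_less_trans)
    then have "(\<lambda>m. ?d (J m) m \<omega>) \<longlonglongrightarrow> ennreal (last_position \<xi> (e \<omega>) \<omega>)" using J(3) by simp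
    then have "(\<lambda>m. enn2real (?d (J m) m \<omega>)) \<longlonglongrightarrow> last_position \<xi> (e \<omega>) \<omega>"
      by (rule tendsto_enn2real) (simp add: last_position_def)
    then have "(\<lambda>m. D m \<omega>) \<longlonglongrightarrow> ennreal (exp (- u * last_position \<xi> (e \<omega>) \<omega>))"
      unfolding DJ' by (intro tendsto_ennrealI tendsto_exp tendsto_mult tendsto_const)
    moreover have "D m \<omega> \<le> ennreal (exp (max 0 (- u) * e \<omega>))" for m
    proof -
      have a: "enn2real (?d (J m) m \<omega>) \<le> e \<omega>" "0 \<le> enn2real (?d (J m) m \<omega>)"
        using J(1)[of m] elim by (auto intro: enn2real_leI)
      have "- u * enn2real (?d (J m) m \<omega>) \<le> max 0 (- u) * enn2real (?d (J m) m \<omega>)"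
        using a(2) by (intro mult_right_mono) auto
      also have "\<dots> \<le> max 0 (- u) * e \<omega>" using a(1) by (intro mult_left_mono) auto
      finally show ?thesis unfolding DJ' by (intro ennreal_leI) simp
    qed
    ultimately show ?case by blast
  qed
  have dom: "(\<integral>\<^sup>+\<omega>. ennreal (exp (max 0 (- u) * e \<omega>)) \<partial>M) < \<infinity>"
  proof -
    define c where "c = r - max 0 (- u)"
    have c: "0 < c" using r u by (auto simp: c_def)
    have "(\<integral>\<^sup>+\<omega>. ennreal (exp (max 0 (- u) * e \<omega>)) \<partial>M) =
        (\<integral>\<^sup>+y. ennreal (exponential_density r y) * ennreal (exp (max 0 (- u) * y)) \<partial>lborel)"
      by (rule distributed_nn_integral[OF dist, symmetric]) simp
    also have "\<dots> = (\<integral>\<^sup>+y. ennreal r * (ennreal (exp (- c * y)) * indicator {0<..} y) \<partial>lborel)"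
      using AE_lborel_singleton[of "0::real"]
    proof (intro nn_integral_cong_AE, eventually_elim)
      case (elim y)
      have "exp (- (y * r)) * exp (max 0 (- u) * y) = exp (- c * y)"
        by (simp add: c_def algebra_simps flip: exp_add)
      then show ?case
        using r elim by (auto simp: exponential_density_def indicator_def ennreal_mult[symmetric] mult.assoc)
    qed
    also have "\<dots> = ennreal r * ennreal (1 / c)"
      by (subst nn_integral_cmult, simp, simp only: nn_integral_exp_halfline[OF c])
    finally show ?thesis by (simp add: ennreal_mult_less_top)
  qed
  have "(\<lambda>m. \<integral>\<^sup>+\<omega>. D m \<omega> \<partial>M) \<longlonglongrightarrow> (\<integral>\<^sup>+\<omega>. ennreal (exp (- u * last_position \<xi> (e \<omega>) \<omega>)) \<partial>M)"
  proof (rule nn_integral_dominated_convergence[OF _ _ _ _ dom])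
    show "AE \<omega> in M. D m \<omega> \<le> ennreal (exp (max 0 (- u) * e \<omega>))" for m
      using path by eventually_elim blast
    show "AE \<omega> in M. (\<lambda>m. D m \<omega>) \<longlonglongrightarrow> ennreal (exp (- u * last_position \<xi> (e \<omega>) \<omega>))"
      using path by eventually_elim blast
  qed measurable
  from LIMSEQ_unique[OF this lim] show ?thesis .
qed

end

section \<open>The generalized gamma function\<close>

lemma norm_exp_minus_one_le:
  fixes w :: complex
  shows "norm (exp (- w) - 1) \<le> norm w * max 1 (exp (- Re w))"
proof -
  have "norm (exp (- w) - exp (- 0)) \<le> max 1 (exp (- Re w)) * norm (w - 0)"
  proof (rule field_differentiable_bound[of "closed_segment 0 w" "\<lambda>w. exp (- w)" "\<lambda>w. - exp (- w)"])
    fix z assume "z \<in> closed_segment 0 w"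
    then obtain t where t: "0 \<le> t" "t \<le> 1" "z = of_real t * w"
      by (auto simp: closed_segment_def scaleR_conv_of_real)
    have "- (t * Re w) \<le> 0 \<or> - (t * Re w) \<le> - Re w"
      using t mult_right_mono_neg[of t 1 "Re w"] mult_nonneg_nonneg[of t "Re w"] by (cases "0 \<le> Re w") auto
    then show "norm (- exp (- z)) \<le> max 1 (exp (- Re w))"
      using t by (auto simp: le_max_iff_disj)
  qed (auto intro!: derivative_eq_intros)
  then show ?thesis by (simp add: mult.commute)
qed

lemma norm_exp_minus_linear_le:
  fixes w :: complex
  shows "norm (exp (- w) - 1 + w) \<le> (norm w)\<^sup>2 * max 1 (exp (- Re w))"
proof -
  have "norm ((exp (- w) - 1 + w) - (exp (- 0) - 1 + 0)) \<le> (norm w * max 1 (exp (- Re w))) * norm (w - 0)"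
  proof (rule field_differentiable_bound[of "closed_segment 0 w" "\<lambda>w. exp (- w) - 1 + w" "\<lambda>w. 1 - exp (- w)"])
    fix z assume "z \<in> closed_segment 0 w"
    then obtain t where t: "0 \<le> t" "t \<le> 1" "z = of_real t * w"
      by (auto simp: closed_segment_def scaleR_conv_of_real)
    have "- (t * Re w) \<le> 0 \<or> - (t * Re w) \<le> - Re w"
      using t mult_right_mono_neg[of t 1 "Re w"] mult_nonneg_nonneg[of t "Re w"] by (cases "0 \<le> Re w") auto
    then have m: "max 1 (exp (- Re z)) \<le> max 1 (exp (- Re w))"
      using t by (auto simp: le_max_iff_disj)
    have "norm z \<le> norm w"
      using t by (simp add: norm_mult mult_left_le_one_le)
    then have "norm z * max 1 (exp (- Re z)) \<le> norm w * max 1 (exp (- Re w))"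
      using m by (intro mult_mono) auto
    then show "norm (1 - exp (- z)) \<le> norm w * max 1 (exp (- Re w))"
      using norm_exp_minus_one_le[of z] by (simp add: norm_minus_commute)
  qed (auto intro!: derivative_eq_intros)
  then show ?thesis by (simp add: power2_eq_square ac_simps)
qed

lemma le_one_minus_exp_mult:
  fixes x :: real
  assumes "0 \<le> x"
  shows "x \<le> (1 - exp (- x)) * (1 + x)"
proof -
  have "exp (- x) * (1 + x) \<le> exp (- x) * exp x"
    by (intro mult_left_mono) auto
  then show ?thesis by (simp add: algebra_simps flip: exp_add)
qed

lemma mult_exp_neg_le:
  fixes x d :: real
  assumes "0 < d"
  shows "x * exp (- d * x) \<le> 1 / d"
proof -
  have "(d * x) * exp (- d * x) \<le> exp (d * x) * exp (- d * x)"
  proof (rule mult_right_mono)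
    show "d * x \<le> exp (d * x)" using exp_ge_add_one_self[of "d * x"] by linarith
  qed simp
  also have "\<dots> = 1" by (simp flip: exp_add)
  finally show ?thesis using assms by (simp add: field_simps)
qed

text \<open>The analytic content of the theorem depends on the subordinator only through the Frullani formula
  relating its exponent and its harmonic potential measure.\<close>

locale Laplace_exponent =
  fixes \<phi> :: "real \<Rightarrow> real" and H :: "real measure"
  assumes sets_H [simp, measurable_cong]: "sets H = sets borel"
    and AE_H_pos: "AE x in H. 0 < x"
    and phi_pos: "\<And>s. 0 < s \<Longrightarrow> 0 < \<phi> s"
    and phi_mono: "\<And>s t. 0 < s \<Longrightarrow> s \<le> t \<Longrightarrow> \<phi> s \<le> \<phi> t"
    and nn_integral_H: "\<And>s l. 0 < s \<Longrightarrow> 0 \<le> l \<Longrightarrow>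
      (\<integral>\<^sup>+x. ennreal ((1 - exp (- l * x)) * exp (- s * x)) \<partial>H) = ennreal (ln (\<phi> (s + l) / \<phi> s))"
begin

lemma ln_phi_div: "0 < s \<Longrightarrow> 0 < t \<Longrightarrow> ln (\<phi> s / \<phi> t) = ln (\<phi> s) - ln (\<phi> t)"
  using phi_pos[of s] phi_pos[of t] by (simp add: ln_div)

lemma has_integral_H:
  assumes s: "0 < s" and l: "0 \<le> l"
  shows "has_bochner_integral H (\<lambda>x. (1 - exp (- l * x)) * exp (- s * x)) (ln (\<phi> (s + l) / \<phi> s))"
proof (rule has_bochner_integral_nn_integral)
  show "AE x in H. 0 \<le> (1 - exp (- l * x)) * exp (- s * x)"
    using AE_H_pos by eventually_elim (use l in auto)
  show "(\<integral>\<^sup>+x. ennreal ((1 - exp (- l * x)) * exp (- s * x)) \<partial>H) = ennreal (ln (\<phi> (s + l) / \<phi> s))"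
    by (rule nn_integral_H[OF s l])
  show "0 \<le> ln (\<phi> (s + l) / \<phi> s)"
    using phi_mono[of s "s + l"] phi_pos[of s] s l by (intro ln_ge_zero) auto
qed simp

lemma integrable_H_le:
  fixes f :: "real \<Rightarrow> 'b :: {banach, second_countable_topology}"
  assumes g: "integrable H g" and [measurable]: "f \<in> borel_measurable borel"
    and le: "\<And>x. 0 < x \<Longrightarrow> norm (f x) \<le> g x"
  shows "integrable H f"
proof (rule Bochner_Integration.integrable_bound[OF g])
  show "AE x in H. norm (f x) \<le> norm (g x)"
    using AE_H_pos by eventually_elim (auto intro: order.trans[OF le abs_ge_self])
qed simp

text \<open>\<open>x \<le> (1 - exp (- x)) (1 + x)\<close>, and half of the exponential decay absorbs the factor \<open>1 + x\<close>.\<close>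

lemma integrable_H_x:
  assumes s: "0 < s"
  shows "integrable H (\<lambda>x. x * exp (- s * x))"
proof (rule integrable_H_le)
  show "integrable H (\<lambda>x. (1 + 2 / s) * ((1 - exp (- 1 * x)) * exp (- (s / 2) * x)))"
    using has_integral_H[of "s / 2" 1] s by (auto simp: has_bochner_integral_iff)
  fix x :: real assume x: "0 < x"
  have "x * exp (- s * x) = x * (exp (- (s / 2) * x) * exp (- (s / 2) * x))"
    by (simp flip: exp_add)
  also have "\<dots> \<le> ((1 - exp (- x)) * (1 + x)) * (exp (- (s / 2) * x) * exp (- (s / 2) * x))"
    using x by (intro mult_right_mono le_one_minus_exp_mult) auto
  also have "\<dots> = ((1 + x) * exp (- (s / 2) * x)) * ((1 - exp (- x)) * exp (- (s / 2) * x))" by simp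
  also have "\<dots> \<le> (1 + 2 / s) * ((1 - exp (- x)) * exp (- (s / 2) * x))"
  proof (rule mult_right_mono)
    have "exp (- (s / 2) * x) \<le> 1" using s x by simp
    moreover have "x * exp (- (s / 2) * x) \<le> 2 / s" using mult_exp_neg_le[of "s / 2" x] s by simp
    ultimately show "(1 + x) * exp (- (s / 2) * x) \<le> 1 + 2 / s"
      unfolding distrib_right mult_1 by (rule add_mono)
  qed (use x in simp)
  finally show "norm (x * exp (- s * x)) \<le> (1 + 2 / s) * ((1 - exp (- 1 * x)) * exp (- (s / 2) * x))"
    using x by simp
qed simp

lemma integrable_H_x2:
  assumes s: "0 < s"
  shows "integrable H (\<lambda>x. x\<^sup>2 * exp (- s * x))"
proof (rule integrable_H_le)
  show "integrable H (\<lambda>x. (2 / s) * (x * exp (- (s / 2) * x)))"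
    using integrable_H_x[of "s / 2"] s by simp
  fix x :: real assume x: "0 < x"
  have "x\<^sup>2 * exp (- s * x) = (x * exp (- (s / 2) * x)) * (x * exp (- (s / 2) * x))"
    by (simp add: power2_eq_square flip: exp_add)
  also have "\<dots> \<le> (2 / s) * (x * exp (- (s / 2) * x))"
    using mult_exp_neg_le[of "s / 2" x] s x by (intro mult_right_mono) auto
  finally show "norm (x\<^sup>2 * exp (- s * x)) \<le> (2 / s) * (x * exp (- (s / 2) * x))"
    using x by simp
qed simp

text \<open>The logarithmic derivative of \<open>\<phi>\<close> at \<open>s\<close>, and the mean of the last position for \<open>s = k\<close>.\<close>

definition tilted_mean :: "real \<Rightarrow> real" where
  "tilted_mean s = (\<integral>x. x * exp (- s * x) \<partial>H)"

text \<open>Frullani's formula expresses \<open>ln (\<phi> (s0 + l) / \<phi> s0)\<close> as a parameter integral; it is differentiated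
  with base point \<open>s0 = s / 2\<close> at the interior point \<open>l = s / 2\<close> of its domain.\<close>

lemma DERIV_ln_phi:
  assumes s: "0 < s"
  shows "((\<lambda>s. ln (\<phi> s)) has_real_derivative tilted_mean s) (at s)"
proof -
  define s0 where "s0 = s / 2"
  have s0: "0 < s0" "s = s0 + s0" using s by (auto simp: s0_def)
  let ?f = "\<lambda>z x. (1 - exp (- z * complex_of_real x)) * of_real (exp (- s0 * x))"
  let ?F = "\<lambda>z. \<integral>x. ?f z x \<partial>H"
  have d: "deriv (\<lambda>z. ?f z x) (of_real s0) = of_real (x * exp (- s * x))" for x
  proof -
    have "deriv (\<lambda>z. ?f z x) (of_real s0) = of_real x * exp (- of_real s0 * of_real x) * of_real (exp (- s0 * x))"
      by (rule DERIV_imp_deriv) (auto intro!: derivative_eq_intros)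
    also have "\<dots> = of_real (x * (exp (- s0 * x) * exp (- s0 * x)))"
      by (simp flip: exp_of_real)
    also have "exp (- s0 * x) * exp (- s0 * x) = exp (- s * x)"
      unfolding s0(2) by (simp add: algebra_simps flip: exp_add)
    finally show ?thesis .
  qed
  have "(?F has_field_derivative (\<integral>x. deriv (\<lambda>z. ?f z x) (of_real s0) \<partial>H)) (at (of_real s0))"
  proof (rule has_field_derivative_parameter_integral)
    show "integrable H (\<lambda>x. 2 * s0 * (x * exp (- s0 * x)))"
      using integrable_H_x[OF s0(1)] by simp
    show "AE x in H. \<forall>z\<in>ball (of_real s0) s0. norm (?f z x) \<le> 2 * s0 * (x * exp (- s0 * x))"
      using AE_H_pos
    proof eventually_elim
      case (elim x)
      show ?case
      proof
        fix z :: complex assume z: "z \<in> ball (of_real s0) s0"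
        then have "\<bar>Re (of_real s0 - z)\<bar> < s0" "norm (of_real s0 - z) < s0"
          using abs_Re_le_cmod[of "of_real s0 - z"] by (auto simp: dist_norm)
        then have "0 \<le> Re z" "norm z \<le> 2 * s0"
          using norm_triangle_ineq4[of "of_real s0" "of_real s0 - z"] s0 by auto
        have "norm (1 - exp (- z * of_real x)) \<le> norm (z * of_real x) * max 1 (exp (- Re (z * of_real x)))"
          using norm_exp_minus_one_le[of "z * of_real x"] by (simp add: norm_minus_commute)
        also have "max 1 (exp (- Re (z * of_real x))) = 1"
          using mult_nonneg_nonneg[OF \<open>0 \<le> Re z\<close> less_imp_le[OF elim]] by (intro max_absorb1) simp
        also have "norm (z * of_real x) * 1 \<le> 2 * s0 * x"
          using \<open>norm z \<le> 2 * s0\<close> elim by (simp add: norm_mult mult_right_mono)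
        finally show "norm (?f z x) \<le> 2 * s0 * (x * exp (- s0 * x))"
          unfolding norm_mult by (simp add: mult_right_mono mult.assoc[symmetric])
      qed
    qed
  qed (use s0 in \<open>auto intro!: holomorphic_intros\<close>)
  then have D: "(?F has_field_derivative of_real (tilted_mean s)) (at (of_real s0))"
    by (simp only: d integral_complex_of_real tilted_mean_def)
  have "((\<lambda>l. ln (\<phi> (s0 + l) / \<phi> s0)) has_real_derivative tilted_mean s) (at s0)"
  proof (rule has_real_derivative_of_complex[OF D])
    have "\<forall>\<^sub>F y in nhds s0. 0 < y" using s0 by (intro eventually_nhds_in_open[of "{0<..}", simplified]) auto
    then show "\<forall>\<^sub>F y in nhds s0. ?F (of_real y) = of_real (ln (\<phi> (s0 + y) / \<phi> s0))"
    proof eventually_elim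
      case (elim y)
      have "?f (of_real y) x = of_real ((1 - exp (- y * x)) * exp (- s0 * x))" for x
        by (simp flip: exp_of_real)
      then have "?F (of_real y) = of_real (\<integral>x. (1 - exp (- y * x)) * exp (- s0 * x) \<partial>H)"
        by (simp only: integral_complex_of_real)
      then show ?case
        using has_integral_H[OF s0(1), of y] elim by (simp add: has_bochner_integral_iff)
    qed
  qed
  then have "((\<lambda>l. ln (\<phi> (s0 + l) / \<phi> s0)) has_real_derivative tilted_mean s) (at (s + - s0))"
    using s0(2) by simp
  then have "((\<lambda>l. ln (\<phi> (s0 + (l + - s0)) / \<phi> s0)) has_real_derivative tilted_mean s) (at s)"
    by (simp only: DERIV_shift[where f="\<lambda>l. ln (\<phi> (s0 + l) / \<phi> s0)"])
  from DERIV_add[OF DERIV_const[of "ln (\<phi> s0)"] this]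
  have D': "((\<lambda>l. ln (\<phi> s0) + ln (\<phi> (s0 + (l + - s0)) / \<phi> s0)) has_real_derivative tilted_mean s) (at s)"
    by simp
  have "\<forall>\<^sub>F l in nhds s. 0 < l" using s by (intro eventually_nhds_in_open[of "{0<..}", simplified]) auto
  then have "\<forall>\<^sub>F l in nhds s. ln (\<phi> s0) + ln (\<phi> (s0 + (l + - s0)) / \<phi> s0) = ln (\<phi> l)"
    by eventually_elim (use s0 in \<open>simp add: ln_phi_div\<close>)
  from DERIV_cong_ev[OF refl this refl, THEN iffD1, OF D'] show ?thesis .
qed

lemma deriv_phi:
  assumes s: "0 < s"
  shows "deriv \<phi> s / \<phi> s = tilted_mean s"
proof -
  have D: "((\<lambda>s. exp (ln (\<phi> s))) has_real_derivative exp (ln (\<phi> s)) * tilted_mean s) (at s)"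
    by (rule DERIV_fun_exp[OF DERIV_ln_phi[OF s]])
  have "\<forall>\<^sub>F l in nhds s. 0 < l" using s by (intro eventually_nhds_in_open[of "{0<..}", simplified]) auto
  then have "\<forall>\<^sub>F l in nhds s. exp (ln (\<phi> l)) = \<phi> l" by eventually_elim (simp add: phi_pos)
  from DERIV_cong_ev[OF refl this refl, THEN iffD1, OF D]
  have "(\<phi> has_real_derivative exp (ln (\<phi> s)) * tilted_mean s) (at s)" .
  from DERIV_imp_deriv[OF this] show ?thesis using phi_pos[OF s] by simp
qed

text \<open>The density of the reflected Levy measure with respect to \<open>H\<close>; equal to \<open>\<Sum> exp (- k x)\<close> over \<open>k \<ge> 1\<close>
  for \<open>x > 0\<close>.\<close>

definition levy_density :: "real \<Rightarrow> real" where
  "levy_density x = exp (- x) / (1 - exp (- x))"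

lemma levy_density_bounds:
  assumes x: "0 < x"
  shows "0 \<le> levy_density x" and "x * levy_density x \<le> (1 + x) * exp (- x)"
proof -
  show "0 \<le> levy_density x" using x by (simp add: levy_density_def)
  have "x * exp (- x) \<le> (1 - exp (- x)) * (1 + x) * exp (- x)"
    using x by (intro mult_right_mono le_one_minus_exp_mult) auto
  then show "x * levy_density x \<le> (1 + x) * exp (- x)"
    using x by (simp add: levy_density_def pos_divide_le_eq ac_simps)
qed

lemma levy_density_sums:
  assumes x: "0 < x"
  shows "(\<lambda>k. exp (- real (Suc k) * x)) sums levy_density x"
proof -
  have "(\<lambda>k. exp (- x) * exp (- x) ^ k) sums (exp (- x) * (1 / (1 - exp (- x))))"
    using x by (intro sums_mult geometric_sums) simp
  moreover have "exp (- x) * exp (- x) ^ k = exp (- real (Suc k) * x)" for k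
    unfolding power_Suc[symmetric] by (simp only: exp_of_nat_mult[symmetric] mult_minus_left mult_minus_right)
  ultimately show ?thesis by (simp add: levy_density_def)
qed

text \<open>Near \<open>0\<close> the second-order Taylor remainder compensates the pole of the density; at infinity
  \<open>exp (- Re z x)\<close> is beaten by \<open>exp (- x)\<close>, with the margin \<open>2 d\<close>.\<close>

lemma levy_kernel_bound:
  assumes d: "0 < d" "2 * d \<le> 1" and z: "2 * d - 1 \<le> Re z" and x: "0 < x"
  shows "norm ((exp (- z * complex_of_real x) - 1 + z * of_real x) * of_real (levy_density x)) \<le>
     (norm z)\<^sup>2 * (x * exp (- (2 * d) * x) + x\<^sup>2 * exp (- (2 * d) * x))"
proof -
  have "norm (exp (- z * complex_of_real x) - 1 + z * of_real x) \<le>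
      (norm (z * of_real x))\<^sup>2 * max 1 (exp (- Re (z * of_real x)))"
    using norm_exp_minus_linear_le[of "z * of_real x"] by simp
  also have "\<dots> = (norm z)\<^sup>2 * x\<^sup>2 * max 1 (exp (- (Re z * x)))"
    using x by (simp add: norm_mult power_mult_distrib)
  finally have "norm ((exp (- z * complex_of_real x) - 1 + z * of_real x) * of_real (levy_density x)) \<le>
      ((norm z)\<^sup>2 * x\<^sup>2 * max 1 (exp (- (Re z * x)))) * levy_density x"
    using levy_density_bounds(1)[OF x] by (simp add: norm_mult mult_right_mono)
  also have "\<dots> = ((norm z)\<^sup>2 * x * max 1 (exp (- (Re z * x)))) * (x * levy_density x)"
    by (simp add: power2_eq_square)
  also have "\<dots> \<le> ((norm z)\<^sup>2 * x * max 1 (exp (- (Re z * x)))) * ((1 + x) * exp (- x))"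
    using x by (intro mult_left_mono levy_density_bounds(2)) auto
  also have "\<dots> = (norm z)\<^sup>2 * (x + x\<^sup>2) * (max 1 (exp (- (Re z * x))) * exp (- x))"
    by (simp add: power2_eq_square algebra_simps)
  also have "\<dots> \<le> (norm z)\<^sup>2 * (x + x\<^sup>2) * exp (- (2 * d) * x)"
  proof (rule mult_left_mono)
    have "2 * d * x \<le> 1 * x" "(2 * d - 1) * x \<le> Re z * x" using d z x by (auto intro!: mult_right_mono)
    then have "exp (- x) \<le> exp (- (2 * d) * x)" "exp (- (Re z * x)) * exp (- x) \<le> exp (- (2 * d) * x)"
      by (auto simp: algebra_simps simp flip: exp_add)
    then show "max 1 (exp (- (Re z * x))) * exp (- x) \<le> exp (- (2 * d) * x)"
      by (auto simp: max_def)
  qed (use x in auto)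
  finally show ?thesis by (simp add: algebra_simps)
qed

lemma integrable_levy_kernel:
  assumes z: "- 1 < Re z"
  shows "integrable H (\<lambda>x. (exp (- z * complex_of_real x) - 1 + z * of_real x) * of_real (levy_density x))"
proof -
  define d where "d = min 1 (Re z + 1) / 2"
  have d: "0 < d" "2 * d \<le> 1" "2 * d - 1 \<le> Re z" using z by (auto simp: d_def min_def)
  show ?thesis
    by (rule integrable_H_le[OF _ _ levy_kernel_bound[OF d]])
       (use integrable_H_x[of "2 * d"] integrable_H_x2[of "2 * d"] d in \<open>auto simp: levy_density_def\<close>)
qed

definition levy_integral :: "real \<Rightarrow> real" where
  "levy_integral u = (\<integral>x. (exp (- u * x) - 1 + u * x) * levy_density x \<partial>H)"

definition complex_levy_integral :: "complex \<Rightarrow> complex" where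
  "complex_levy_integral z = (\<integral>x. (exp (- z * of_real x) - 1 + z * of_real x) * of_real (levy_density x) \<partial>H)"

lemma levy_kernel_of_real:
  "(exp (- of_real u * complex_of_real x) - 1 + of_real u * of_real x) * of_real (levy_density x) =
   of_real ((exp (- u * x) - 1 + u * x) * levy_density x)"
  by (simp flip: exp_of_real)

lemma integrable_real_levy_kernel:
  "- 1 < u \<Longrightarrow> integrable H (\<lambda>x. (exp (- u * x) - 1 + u * x) * levy_density x)"
  using integrable_levy_kernel[of "of_real u"]
  by (simp only: levy_kernel_of_real complex_of_real_integrable_eq Re_complex_of_real)

lemma complex_levy_integral_of_real: "complex_levy_integral (of_real u) = of_real (levy_integral u)"
  unfolding complex_levy_integral_def levy_integral_def
  by (simp only: levy_kernel_of_real integral_complex_of_real)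

lemma complex_levy_integral_holomorphic: "complex_levy_integral holomorphic_on {z. - 1 < Re z}"
proof -
  have "open {z. - 1 < Re z}" by (rule open_halfspace_Re_gt)
  moreover have "\<exists>D. (complex_levy_integral has_field_derivative D) (at z0)" if "- 1 < Re z0" for z0
  proof -
    define d where "d = min 1 (Re z0 + 1) / 4"
    have d: "0 < d" "2 * d \<le> 1" "4 * d - 1 \<le> Re z0" using that by (auto simp: d_def min_def)
    let ?C = "(norm z0 + 2 * d)\<^sup>2"
    let ?g = "\<lambda>x. ?C * (x * exp (- (2 * d) * x) + x\<^sup>2 * exp (- (2 * d) * x))"
    show ?thesis
      unfolding complex_levy_integral_def[abs_def]
    proof (rule exI, rule has_field_derivative_parameter_integral(2)[where r="2 * d" and g="?g"])
      show "integrable H ?g"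
        using integrable_H_x[of "2 * d"] integrable_H_x2[of "2 * d"] d by simp
      show "AE x in H. \<forall>z\<in>ball z0 (2 * d).
          norm ((exp (- z * complex_of_real x) - 1 + z * of_real x) * of_real (levy_density x)) \<le> ?g x"
        using AE_H_pos
      proof eventually_elim
        case (elim x)
        show ?case
        proof
          fix z assume "z \<in> ball z0 (2 * d)"
          then have z: "norm (z0 - z) < 2 * d" by (simp add: dist_norm)
          then have "2 * d - 1 \<le> Re z" using abs_Re_le_cmod[of "z0 - z"] d by auto
          note levy_kernel_bound[OF d(1,2) this elim]
          also have "(norm z)\<^sup>2 * (x * exp (- (2 * d) * x) + x\<^sup>2 * exp (- (2 * d) * x)) \<le> ?g x"
            using norm_triangle_ineq4[of z0 "z0 - z"] z elim by (intro mult_right_mono power_mono) auto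
          finally show "norm ((exp (- z * complex_of_real x) - 1 + z * of_real x) * of_real (levy_density x)) \<le> ?g x" .
        qed
      qed
    qed (use d in \<open>auto intro!: holomorphic_intros simp: levy_density_def\<close>)
  qed
  ultimately show ?thesis by (auto simp: holomorphic_on_open)
qed

text \<open>The logarithm of the \<open>k\<close>-th factor of the infinite product defining the gamma function of \<open>\<phi>\<close>.\<close>

definition log_factor :: "nat \<Rightarrow> real \<Rightarrow> real" where
  "log_factor k u = ln (\<phi> (real k) / \<phi> (real k + u)) + u * tilted_mean (real k)"

lemma has_integral_exp_diff:
  assumes "0 < s" "0 < t"
  shows "has_bochner_integral H (\<lambda>x. exp (- s * x) - exp (- t * x)) (ln (\<phi> t / \<phi> s))"
proof (cases "s \<le> t")
  case True
  have "(1 - exp (- (t - s) * x)) * exp (- s * x) = exp (- s * x) - exp (- t * x)" for x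
    by (simp add: algebra_simps flip: exp_add)
  then show ?thesis using has_integral_H[OF assms(1), of "t - s"] True by simp
next
  case False
  have "- ((1 - exp (- (s - t) * x)) * exp (- t * x)) = exp (- s * x) - exp (- t * x)" for x
    by (simp add: algebra_simps flip: exp_add)
  moreover have "- ln (\<phi> (t + (s - t)) / \<phi> t) = ln (\<phi> t / \<phi> s)"
    using phi_pos[OF assms(1)] phi_pos[OF assms(2)] by (simp add: ln_div)
  ultimately show ?thesis
    using has_bochner_integral_minus[OF has_integral_H[OF assms(2), of "s - t"]] False by simp
qed

lemma has_integral_log_factor:
  assumes k: "1 \<le> k" and u: "- 1 < u"
  shows "has_bochner_integral H (\<lambda>x. (exp (- u * x) - 1 + u * x) * exp (- real k * x)) (log_factor k u)"
proof -
  have k0: "0 < real k" "0 < real k + u" using k u by (auto intro: less_le_trans)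
  have "has_bochner_integral H (\<lambda>x. (exp (- (real k + u) * x) - exp (- real k * x)) + u * (x * exp (- real k * x)))
      (ln (\<phi> (real k) / \<phi> (real k + u)) + u * tilted_mean (real k))"
    using integrable_H_x[OF k0(1)] k0
    by (intro has_bochner_integral_add has_integral_exp_diff has_bochner_integral_mult_right)
       (auto simp: has_bochner_integral_iff tilted_mean_def)
  moreover have "(exp (- (real k + u) * x) - exp (- real k * x)) + u * (x * exp (- real k * x)) =
      (exp (- u * x) - 1 + u * x) * exp (- real k * x)" for x
    by (simp add: algebra_simps flip: exp_add)
  ultimately show ?thesis by (simp add: log_factor_def)
qed

lemma exp_minus_linear_nonneg:
  fixes u x :: real
  shows "0 \<le> exp (- u * x) - 1 + u * x" and "0 \<le> exp (- (u * x)) - 1 + u * x"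
  using exp_ge_add_one_self[of "- u * x"] by simp_all

lemma log_factor_nonneg: "1 \<le> k \<Longrightarrow> - 1 < u \<Longrightarrow> 0 \<le> log_factor k u"
  unfolding has_bochner_integral_integral_eq[OF has_integral_log_factor, symmetric]
  by (intro integral_nonneg_AE AE_I2 mult_nonneg_nonneg exp_minus_linear_nonneg) simp

lemma levy_integral_nonneg: "0 \<le> levy_integral u"
  unfolding levy_integral_def using AE_H_pos
  by (intro integral_nonneg_AE, eventually_elim) (auto intro!: mult_nonneg_nonneg levy_density_bounds exp_minus_linear_nonneg)

text \<open>The integrands are nonnegative, so the series may be summed under the integral.\<close>

lemma log_factor_sums:
  assumes u: "- 1 < u"
  shows "(\<lambda>k. log_factor (Suc k) u) sums levy_integral u"
proof -
  let ?f = "\<lambda>k x. (exp (- u * x) - 1 + u * x) * exp (- real (Suc k) * x)"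
  have "ennreal (levy_integral u) = (\<integral>\<^sup>+x. ennreal ((exp (- u * x) - 1 + u * x) * levy_density x) \<partial>H)"
    unfolding levy_integral_def using AE_H_pos
    by (intro nn_integral_eq_integral[symmetric] integrable_real_levy_kernel[OF u], eventually_elim)
       (auto intro!: mult_nonneg_nonneg levy_density_bounds exp_minus_linear_nonneg)
  also have "\<dots> = (\<integral>\<^sup>+x. (\<Sum>k. ennreal (?f k x)) \<partial>H)"
    using AE_H_pos
  proof (intro nn_integral_cong_AE, eventually_elim)
    case (elim x)
    show ?case
      by (intro suminf_ennreal_eq[symmetric] sums_mult levy_density_sums elim)
         (auto intro!: mult_nonneg_nonneg exp_minus_linear_nonneg)
  qed
  also have "\<dots> = (\<Sum>k. \<integral>\<^sup>+x. ennreal (?f k x) \<partial>H)"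
    by (rule nn_integral_suminf) simp
  also have "\<dots> = (\<Sum>k. ennreal (log_factor (Suc k) u))"
  proof (rule suminf_cong)
    fix k
    have "has_bochner_integral H (?f k) (log_factor (Suc k) u)"
      by (rule has_integral_log_factor) (use u in auto)
    then show "(\<integral>\<^sup>+x. ennreal (?f k x) \<partial>H) = ennreal (log_factor (Suc k) u)"
      by (subst nn_integral_eq_integral)
         (auto simp: has_bochner_integral_iff intro!: mult_nonneg_nonneg exp_minus_linear_nonneg)
  qed
  finally have eq: "ennreal (levy_integral u) = (\<Sum>k. ennreal (log_factor (Suc k) u))" .
  have nn: "0 \<le> log_factor (Suc k) u" for k using u by (intro log_factor_nonneg) auto
  have summ: "summable (\<lambda>k. log_factor (Suc k) u)"
    using eq by (intro summable_suminf_not_top nn) (metis ennreal_neq_top)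
  then have "ennreal (levy_integral u) = ennreal (\<Sum>k. log_factor (Suc k) u)"
    unfolding eq by (intro suminf_ennreal2 nn)
  then have "levy_integral u = (\<Sum>k. log_factor (Suc k) u)"
    using levy_integral_nonneg suminf_nonneg[OF summ nn] by simp
  then show ?thesis using summ by (simp add: sums_iff)
qed

lemma ln_phi_ratio_tendsto_0:
  assumes u: "- 1 < u"
  shows "(\<lambda>n. ln (\<phi> (real (Suc n)) / \<phi> (real (Suc n) + u))) \<longlonglongrightarrow> 0"
proof -
  have "(\<lambda>n. tilted_mean (real (Suc n))) \<longlonglongrightarrow> (\<integral>x. 0 \<partial>H)"
    unfolding tilted_mean_def
  proof (rule integral_dominated_convergence)
    show "integrable H (\<lambda>x. x * exp (- 1 * x))" by (rule integrable_H_x) simp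
    show "AE x in H. (\<lambda>n. x * exp (- real (Suc n) * x)) \<longlonglongrightarrow> 0"
      using AE_H_pos
    proof eventually_elim
      case (elim x)
      have "(\<lambda>n. x * exp (- real (Suc n) * x)) \<longlonglongrightarrow> x * 0"
        by (intro tendsto_mult tendsto_const summable_LIMSEQ_zero sums_summable[OF levy_density_sums[OF elim]])
      then show ?case by simp
    qed
    show "AE x in H. norm (x * exp (- real (Suc n) * x)) \<le> x * exp (- 1 * x)" for n
      using AE_H_pos
    proof eventually_elim
      case (elim x)
      have "- real (Suc n) * x \<le> - 1 * x" using elim by (intro mult_right_mono) auto
      then show ?case using elim by (simp only: norm_mult real_norm_def abs_of_pos abs_exp_cancel) simp
    qed
  qed auto
  then have t: "(\<lambda>n. tilted_mean (real (Suc n))) \<longlonglongrightarrow> 0" by simp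
  have "(\<lambda>n. log_factor (Suc n) u - u * tilted_mean (real (Suc n))) \<longlonglongrightarrow> 0 - u * 0"
    by (intro tendsto_diff tendsto_mult tendsto_const t summable_LIMSEQ_zero[OF sums_summable[OF log_factor_sums[OF u]]])
  then show ?thesis by (simp add: log_factor_def)
qed

lemma gamma_seq_eq: "gamma_seq \<phi> n = (\<Sum>k<n. tilted_mean (real (Suc k))) - ln (\<phi> (real n))"
proof -
  have "(\<Sum>j=1..n. deriv \<phi> (real j) / \<phi> (real j)) = (\<Sum>j=1..n. tilted_mean (real j))"
    by (rule sum.cong) (auto simp: deriv_phi)
  also have "\<dots> = (\<Sum>k<n. tilted_mean (real (Suc k)))"
    by (rule sum.reindex_bij_witness[of _ Suc "\<lambda>k. k - 1"]) auto
  finally show ?thesis by (simp add: gamma_seq_def)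
qed

text \<open>The partial sums of the logarithmic factors at \<open>u = 1\<close> telescope to \<open>gamma_seq \<phi> n + ln (\<phi> 1)\<close> up to
  the null sequence \<open>ln (\<phi> n / \<phi> (n + 1))\<close>.\<close>

lemma gamma_seq_tendsto: "gamma_seq \<phi> \<longlonglongrightarrow> levy_integral 1 - ln (\<phi> 1)"
proof -
  have part: "(\<Sum>k<n. log_factor (Suc k) 1) = (\<Sum>k<n. tilted_mean (real (Suc k))) + ln (\<phi> 1) - ln (\<phi> (real (Suc n)))" for n
    by (induction n) (auto simp: log_factor_def ln_phi_div add.commute)
  have "(\<lambda>n. (\<Sum>k<Suc n. log_factor (Suc k) 1) - ln (\<phi> 1) - ln (\<phi> (real (Suc n)) / \<phi> (real (Suc n) + 1)))
      \<longlonglongrightarrow> levy_integral 1 - ln (\<phi> 1) - 0"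
    using log_factor_sums[of 1] unfolding sums_def
    by (intro tendsto_diff tendsto_const ln_phi_ratio_tendsto_0 LIMSEQ_Suc) auto
  moreover have "(\<Sum>k<Suc n. log_factor (Suc k) 1) - ln (\<phi> 1) - ln (\<phi> (real (Suc n)) / \<phi> (real (Suc n) + 1)) =
      gamma_seq \<phi> (Suc n)" for n
    unfolding part gamma_seq_eq by (simp add: ln_phi_div add.commute)
  ultimately have "(\<lambda>n. gamma_seq \<phi> (Suc n)) \<longlonglongrightarrow> levy_integral 1 - ln (\<phi> 1)" by simp
  then show ?thesis by (rule LIMSEQ_imp_Suc)
qed

lemma convergent_gamma_seq: "convergent (gamma_seq \<phi>)"
  using gamma_seq_tendsto by (auto simp: convergent_def)

lemma gamma_const_eq: "gamma_const \<phi> = levy_integral 1 - ln (\<phi> 1)"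
  unfolding gamma_const_def by (rule limI[OF gamma_seq_tendsto])

text \<open>The logarithmic form of the functional equation \<open>\<Gamma>\<^sub>\<phi> (s + 1) = \<phi> s \<Gamma>\<^sub>\<phi> s\<close>, by telescoping the
  differences of the logarithmic factors at \<open>u + 1\<close> and \<open>u\<close>.\<close>

lemma levy_integral_shift:
  assumes u: "- 1 < u"
  shows "levy_integral (u + 1) = levy_integral u + gamma_const \<phi> + ln (\<phi> (u + 1))"
proof -
  have part: "(\<Sum>k<n. log_factor (Suc k) (u + 1) - log_factor (Suc k) u) =
      (\<Sum>k<n. tilted_mean (real (Suc k))) + ln (\<phi> (u + 1)) - ln (\<phi> (real (Suc n) + u))" for n
  proof (induction n)
    case (Suc n)
    have "0 < \<phi> (real (Suc n))" "0 < \<phi> (real (Suc n) + u)" "0 < \<phi> (real (Suc n) + (u + 1))"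
      using u by (auto intro!: phi_pos)
    then have "log_factor (Suc n) (u + 1) - log_factor (Suc n) u =
        ln (\<phi> (real (Suc n) + u)) - ln (\<phi> (real (Suc (Suc n)) + u)) + tilted_mean (real (Suc n))"
      by (simp add: log_factor_def ln_div algebra_simps)
    then show ?case using Suc by simp
  qed (simp add: add.commute)
  have "(\<lambda>n. (\<Sum>k<Suc n. log_factor (Suc k) (u + 1) - log_factor (Suc k) u)) \<longlonglongrightarrow> levy_integral (u + 1) - levy_integral u"
    using sums_diff[OF log_factor_sums[of "u + 1"] log_factor_sums[OF u]] u
    unfolding sums_def by (intro LIMSEQ_Suc) auto
  moreover have "(\<lambda>n. gamma_seq \<phi> (Suc n) + ln (\<phi> (real (Suc n)) / \<phi> (real (Suc n) + (u + 1))) + ln (\<phi> (u + 1)))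
      \<longlonglongrightarrow> gamma_const \<phi> + 0 + ln (\<phi> (u + 1))"
    using u convergent_gamma_seq unfolding gamma_const_def
    by (intro tendsto_add tendsto_const ln_phi_ratio_tendsto_0 LIMSEQ_Suc) (auto simp: convergent_LIMSEQ_iff)
  moreover have "(\<Sum>k<Suc n. log_factor (Suc k) (u + 1) - log_factor (Suc k) u) =
      gamma_seq \<phi> (Suc n) + ln (\<phi> (real (Suc n)) / \<phi> (real (Suc n) + (u + 1))) + ln (\<phi> (u + 1))" for n
  proof -
    have "0 < \<phi> (real (Suc n))" "0 < \<phi> (real (Suc n) + (u + 1))" using u by (auto intro!: phi_pos)
    moreover have "real (Suc (Suc n)) + u = real (Suc n) + (u + 1)" by simp
    ultimately show ?thesis unfolding part gamma_seq_eq by (simp add: ln_div add.assoc)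
  qed
  ultimately have "levy_integral (u + 1) - levy_integral u = gamma_const \<phi> + 0 + ln (\<phi> (u + 1))"
    by (simp only:) (rule LIMSEQ_unique)
  then show ?thesis by simp
qed

lemma gamma_factor_eq:
  assumes k: "1 \<le> k" and u: "- 1 < u"
  shows "gamma_factor \<phi> u k = exp (log_factor k u)"
proof -
  have "0 < real k" "0 < real k + u" using k u by (auto intro: less_le_trans)
  then show ?thesis
    using phi_pos deriv_phi[of "real k"] by (simp add: gamma_factor_def log_factor_def exp_add flip: times_divide_eq_right)
qed

lemma convergent_prod_gamma_factor:
  "- 1 < u \<Longrightarrow> convergent_prod (\<lambda>n. gamma_factor \<phi> u (Suc n))"
  using convergent_prod_exp[OF sums_summable[OF log_factor_sums]] by (simp add: gamma_factor_eq)

lemma gen_Gamma_eq: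
  assumes u: "- 1 < u"
  shows "gen_Gamma \<phi> (u + 1) = exp (- u * gamma_const \<phi> + levy_integral u)"
proof -
  have u1: "- 1 < u + 1" using u by simp
  have "(\<Prod>n. gamma_factor \<phi> (u + 1) (Suc n)) = exp (levy_integral (u + 1))"
    using prodinf_exp[OF sums_summable[OF log_factor_sums[OF u1]]] sums_unique[OF log_factor_sums[OF u1]]
    by (simp add: gamma_factor_eq[OF _ u1])
  moreover have "\<phi> (u + 1) = exp (ln (\<phi> (u + 1)))" using u by (simp add: phi_pos)
  ultimately have "gen_Gamma \<phi> (u + 1) =
      exp (- gamma_const \<phi> * (u + 1) - ln (\<phi> (u + 1)) + levy_integral (u + 1))"
    unfolding gen_Gamma_def by (simp add: exp_add exp_diff)
  also have "- gamma_const \<phi> * (u + 1) - ln (\<phi> (u + 1)) + levy_integral (u + 1) = - u * gamma_const \<phi> + levy_integral u"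
    unfolding levy_integral_shift[OF u] by (simp add: algebra_simps)
  finally show ?thesis .
qed

end

section \<open>The independent series and its limit\<close>

text \<open>Bounds variances by exponential moments at \<open>\<plusminus> 1 / 2\<close>, where those of the summands below are finite.\<close>

lemma square_le_exp_half:
  fixes y :: real
  shows "y\<^sup>2 \<le> 8 * (exp (y / 2) + exp (- (y / 2)) - 2)"
proof -
  have *: "t\<^sup>2 / 2 \<le> exp t + exp (- t) - 2" if "0 \<le> t" for t :: real
    using exp_lower_Taylor_quadratic[OF that] exp_ge_add_one_self[of "- t"] by linarith
  have "(y / 2)\<^sup>2 / 2 \<le> exp (y / 2) + exp (- (y / 2)) - 2"
    using *[of "y / 2"] *[of "- (y / 2)"] by (cases "0 \<le> y") (auto simp: add.commute)
  then show ?thesis by (simp add: power2_eq_square)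
qed

lemma exp_minus_one_le_mult_exp: "exp x - 1 \<le> x * exp (x::real)"
proof -
  have "(1 - x) * exp x \<le> exp (- x) * exp x"
    using exp_ge_add_one_self[of "- x"] by (intro mult_right_mono) auto
  then show ?thesis by (simp add: algebra_simps flip: exp_add)
qed

text \<open>For \<open>\<alpha> = 1\<close> the variables have the laws of the last positions; \<open>\<alpha> = 1 / n\<close> will provide the \<open>n\<close>-th
  convolution roots.\<close>

locale independent_tilts = Laplace_exponent \<phi> H + K: prob_space K
  for \<phi> :: "real \<Rightarrow> real" and H :: "real measure" and K :: "'c measure" +
  fixes G :: "nat \<Rightarrow> 'c \<Rightarrow> real" and \<alpha> :: real
  assumes alpha_pos: "0 < \<alpha>"
    and indep_G: "K.indep_vars (\<lambda>_. borel) G {1..}"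
    and nn_integral_G: "\<And>k u. 1 \<le> k \<Longrightarrow> - real k < u \<Longrightarrow>
      (\<integral>\<^sup>+\<omega>. ennreal (exp (- u * G k \<omega>)) \<partial>K) = ennreal ((\<phi> (real k) / \<phi> (real k + u)) powr \<alpha>)"
begin

lemma measurable_G: "1 \<le> k \<Longrightarrow> G k \<in> borel_measurable K"
  using indep_G by (auto simp: K.indep_vars_def)

lemma has_integral_exp_G:
  assumes k: "1 \<le> k" and u: "- real k < u"
  shows "has_bochner_integral K (\<lambda>\<omega>. exp (- u * G k \<omega>)) (exp (\<alpha> * ln (\<phi> (real k) / \<phi> (real k + u))))"
proof (rule has_bochner_integral_nn_integral)
  have [measurable]: "G k \<in> borel_measurable K" by (rule measurable_G[OF k])
  show "(\<lambda>\<omega>. exp (- u * G k \<omega>)) \<in> borel_measurable K" by measurable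
  have "0 < \<phi> (real k)" "0 < \<phi> (real k + u)" using k u by (auto intro: phi_pos)
  then show "(\<integral>\<^sup>+\<omega>. ennreal (exp (- u * G k \<omega>)) \<partial>K) = ennreal (exp (\<alpha> * ln (\<phi> (real k) / \<phi> (real k + u))))"
    unfolding nn_integral_G[OF k u] by (simp add: powr_def)
qed auto

text \<open>The mean is the derivative at \<open>0\<close> of \<open>u \<mapsto> E exp (u G) = (\<phi> k / \<phi> (k - u))\<^sup>\<alpha>\<close>.\<close>

lemma mean_G:
  assumes k: "1 \<le> k"
  shows "integrable K (G k)" and "K.expectation (G k) = \<alpha> * tilted_mean (real k)"
proof -
  have [measurable]: "G k \<in> borel_measurable K" by (rule measurable_G[OF k])
  let ?M = "distr K borel (G k)"
  have int: "integrable ?M (\<lambda>x. exp (u * x))" if "u \<in> {..<real k}" for u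
    using has_integral_exp_G[OF k, of "- u"] that by (simp add: integrable_distr_eq has_bochner_integral_iff)
  have k0: "0 \<in> {..<real k}" using k by simp
  note D = real_Laplace_transform_derivative[OF sets_distr open_lessThan int k0]
  have "integrable ?M (\<lambda>x. x * exp (0 * x))" by (rule D(1))
  then show "integrable K (G k)" by (simp add: integrable_distr_eq)
  have "((\<lambda>u. \<integral>x. exp (u * x) \<partial>?M) has_real_derivative (\<integral>x. x * exp (0 * x) \<partial>?M)) (at 0)" by (rule D(2))
  also have "(\<integral>x. x * exp (0 * x) \<partial>?M) = K.expectation (G k)" by (simp add: integral_distr)
  finally have D0: "((\<lambda>u. \<integral>x. exp (u * x) \<partial>?M) has_real_derivative K.expectation (G k)) (at 0)" .
  have "((\<lambda>s. ln (\<phi> s)) has_real_derivative tilted_mean (real k)) (at (real k - 0))"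
    using DERIV_ln_phi[of "real k"] k by simp
  then have "((\<lambda>u. ln (\<phi> (real k - u))) has_real_derivative tilted_mean (real k) * (0 - 1)) (at 0)"
    by (rule DERIV_chain2) (auto intro!: derivative_eq_intros)
  from DERIV_fun_exp[OF DERIV_cmult[OF DERIV_diff[OF DERIV_const[of "ln (\<phi> (real k))"] this], of \<alpha>]]
  have D1: "((\<lambda>u. exp (\<alpha> * (ln (\<phi> (real k)) - ln (\<phi> (real k - u))))) has_real_derivative
      \<alpha> * tilted_mean (real k)) (at 0)"
    by simp
  have "\<forall>\<^sub>F u in nhds 0. u < real k"
    using k by (intro eventually_nhds_in_open[of "{..<real k}", simplified]) auto
  then have "\<forall>\<^sub>F u in nhds 0. exp (\<alpha> * (ln (\<phi> (real k)) - ln (\<phi> (real k - u)))) = (\<integral>x. exp (u * x) \<partial>?M)"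
  proof eventually_elim
    case (elim u)
    have "(\<integral>x. exp (u * x) \<partial>?M) = exp (\<alpha> * ln (\<phi> (real k) / \<phi> (real k + - u)))"
      using has_integral_exp_G[OF k, of "- u"] elim by (simp add: integral_distr has_bochner_integral_iff)
    then show ?case using k elim by (simp add: ln_phi_div)
  qed
  from DERIV_unique[OF D0 DERIV_cong_ev[OF refl this refl, THEN iffD1, OF D1]]
  show "K.expectation (G k) = \<alpha> * tilted_mean (real k)" .
qed

text \<open>The centred summands; their exponential moments are the factors of the infinite product to the
  power \<open>\<alpha>\<close>.\<close>

definition Y :: "nat \<Rightarrow> 'c \<Rightarrow> real" where
  "Y k \<omega> = \<alpha> * tilted_mean (real k) - G k \<omega>"

lemma indep_Y: "K.indep_vars (\<lambda>_. borel) Y {1..}"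
  using K.indep_vars_compose2[OF indep_G, of "\<lambda>k x. \<alpha> * tilted_mean (real k) - x" "\<lambda>_. borel"]
  by (simp add: Y_def[abs_def])

lemma measurable_Y: "1 \<le> k \<Longrightarrow> Y k \<in> borel_measurable K"
  unfolding Y_def[abs_def] using measurable_G[of k] by simp

lemma has_integral_exp_Y:
  assumes k: "1 \<le> k" and u: "- 1 < u"
  shows "has_bochner_integral K (\<lambda>\<omega>. exp (u * Y k \<omega>)) (exp (\<alpha> * log_factor k u))"
proof -
  have "- real k < u" using k u by (auto intro: order.strict_trans1)
  from has_bochner_integral_mult_right[OF has_integral_exp_G[OF k this], of "exp (u * (\<alpha> * tilted_mean (real k)))"]
  show ?thesis
    by (simp add: Y_def log_factor_def algebra_simps flip: exp_add)
qed

lemma Y_moments: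
  assumes k: "1 \<le> k"
  shows "integrable K (Y k)" and "K.expectation (Y k) = 0" and "integrable K (\<lambda>\<omega>. (Y k \<omega>)\<^sup>2)"
    and "K.expectation (\<lambda>\<omega>. (Y k \<omega>)\<^sup>2) \<le>
      8 * (exp (\<alpha> * log_factor k (1 / 2)) - 1) + 8 * (exp (\<alpha> * log_factor k (- (1 / 2))) - 1)"
proof -
  have [measurable]: "Y k \<in> borel_measurable K" by (rule measurable_Y[OF k])
  show "integrable K (Y k)" unfolding Y_def[abs_def] using mean_G(1)[OF k] by simp
  show "K.expectation (Y k) = 0"
    unfolding Y_def[abs_def] using mean_G[OF k] by (simp add: K.prob_space)
  have i: "integrable K (\<lambda>\<omega>. exp (1 / 2 * Y k \<omega>))" "integrable K (\<lambda>\<omega>. exp (- (1 / 2) * Y k \<omega>))"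
    "K.expectation (\<lambda>\<omega>. exp (1 / 2 * Y k \<omega>)) = exp (\<alpha> * log_factor k (1 / 2))"
    "K.expectation (\<lambda>\<omega>. exp (- (1 / 2) * Y k \<omega>)) = exp (\<alpha> * log_factor k (- (1 / 2)))"
    using has_integral_exp_Y[OF k, of "1 / 2"] has_integral_exp_Y[OF k, of "- (1 / 2)"]
    by (simp_all add: has_bochner_integral_iff)
  have bound: "integrable K (\<lambda>\<omega>. 8 * (exp (1 / 2 * Y k \<omega>) + exp (- (1 / 2) * Y k \<omega>) - 2))"
      "K.expectation (\<lambda>\<omega>. 8 * (exp (1 / 2 * Y k \<omega>) + exp (- (1 / 2) * Y k \<omega>) - 2)) =
      8 * (exp (\<alpha> * log_factor k (1 / 2)) + exp (\<alpha> * log_factor k (- (1 / 2))) - 2)"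
    using i by (simp_all add: K.prob_space)
  have le: "(Y k \<omega>)\<^sup>2 \<le> 8 * (exp (1 / 2 * Y k \<omega>) + exp (- (1 / 2) * Y k \<omega>) - 2)" for \<omega>
    using square_le_exp_half[of "Y k \<omega>"] by simp
  show int: "integrable K (\<lambda>\<omega>. (Y k \<omega>)\<^sup>2)"
  proof (rule Bochner_Integration.integrable_bound[OF bound(1)])
    show "AE \<omega> in K. norm ((Y k \<omega>)\<^sup>2) \<le>
        norm (8 * (exp (1 / 2 * Y k \<omega>) + exp (- (1 / 2) * Y k \<omega>) - 2))"
      unfolding real_norm_def abs_power2 by (intro AE_I2 order.trans[OF le abs_ge_self])
  qed simp
  have "K.expectation (\<lambda>\<omega>. (Y k \<omega>)\<^sup>2) \<le> K.expectation (\<lambda>\<omega>. 8 * (exp (1 / 2 * Y k \<omega>) + exp (- (1 / 2) * Y k \<omega>) - 2))"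
    by (rule integral_mono[OF int bound(1) le])
  then show "K.expectation (\<lambda>\<omega>. (Y k \<omega>)\<^sup>2) \<le>
      8 * (exp (\<alpha> * log_factor k (1 / 2)) - 1) + 8 * (exp (\<alpha> * log_factor k (- (1 / 2))) - 1)"
    unfolding bound(2) by (simp add: algebra_simps)
qed

lemma summable_exp_log_factor:
  assumes u: "- 1 < u"
  shows "summable (\<lambda>k. exp (\<alpha> * log_factor (Suc k) u) - 1)"
proof (rule summable_comparison_test'[where N=0])
  note s = log_factor_sums[OF u]
  have nn: "0 \<le> log_factor (Suc k) u" for k using u by (intro log_factor_nonneg) auto
  show "summable (\<lambda>k. \<alpha> * log_factor (Suc k) u * exp (\<alpha> * levy_integral u))"
    using sums_summable[OF s] by (intro summable_mult2 summable_mult)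
  fix k
  have le: "log_factor (Suc k) u \<le> levy_integral u"
    using sum_le_suminf[OF sums_summable[OF s], of "{k}"] nn sums_unique[OF s] by simp
  have "exp (\<alpha> * log_factor (Suc k) u) - 1 \<le> \<alpha> * log_factor (Suc k) u * exp (\<alpha> * log_factor (Suc k) u)"
    by (rule exp_minus_one_le_mult_exp)
  also have "\<dots> \<le> \<alpha> * log_factor (Suc k) u * exp (\<alpha> * levy_integral u)"
    using alpha_pos nn[of k] le by (intro mult_left_mono) auto
  finally show "norm (exp (\<alpha> * log_factor (Suc k) u) - 1) \<le> \<alpha> * log_factor (Suc k) u * exp (\<alpha> * levy_integral u)"
    using alpha_pos nn[of k] by simp
qed

lemma AE_summable_Y: "AE \<omega> in K. summable (\<lambda>k. Y (Suc k) \<omega>)"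
proof -
  have "AE \<omega> in K. summable (\<lambda>k. Y (1 + k) \<omega>)"
  proof (rule K.AE_summable_of_indep_centred[OF indep_Y])
    show "summable (\<lambda>k. K.expectation (\<lambda>\<omega>. (Y (1 + k) \<omega>)\<^sup>2))"
    proof (rule summable_comparison_test'[where N=0])
      show "summable (\<lambda>k. 8 * (exp (\<alpha> * log_factor (Suc k) (1 / 2)) - 1) + 8 * (exp (\<alpha> * log_factor (Suc k) (- (1 / 2))) - 1))"
        by (intro summable_add summable_mult summable_exp_log_factor) auto
      show "norm (K.expectation (\<lambda>\<omega>. (Y (1 + k) \<omega>)\<^sup>2)) \<le>
          8 * (exp (\<alpha> * log_factor (Suc k) (1 / 2)) - 1) + 8 * (exp (\<alpha> * log_factor (Suc k) (- (1 / 2))) - 1)" for k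
        using Y_moments(4)[of "Suc k"] by (simp add: integral_nonneg)
    qed
  qed (auto intro: Y_moments)
  then show ?thesis by simp
qed

lemma measurable_sum_Y [measurable]: "(\<lambda>\<omega>. \<Sum>k. Y (Suc k) \<omega>) \<in> borel_measurable K"
  using measurable_Y by (intro borel_measurable_suminf) auto

lemma has_integral_exp_partial_sum:
  assumes u: "- 1 < u"
  shows "has_bochner_integral K (\<lambda>\<omega>. exp (u * (\<Sum>k<n. Y (Suc k) \<omega>))) (exp (\<alpha> * (\<Sum>k<n. log_factor (Suc k) u)))"
proof -
  have reidx: "(\<Prod>k\<in>{1..n}. f k) = (\<Prod>k<n. f (Suc k))" for f :: "nat \<Rightarrow> real"
    by (rule prod.reindex_bij_witness[of _ Suc "\<lambda>k. k - 1"]) auto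
  have ind: "K.indep_vars (\<lambda>_. borel) (\<lambda>k \<omega>. exp (u * Y k \<omega>)) {1..n}"
    by (rule K.indep_vars_compose2[OF K.indep_vars_subset[OF indep_Y]]) auto
  have int: "integrable K (\<lambda>\<omega>. exp (u * Y k \<omega>))" if "k \<in> {1..n}" for k
    using has_integral_exp_Y[of k u] that u by (auto simp: has_bochner_integral_iff)
  have eq: "exp (u * (\<Sum>k<n. Y (Suc k) \<omega>)) = (\<Prod>k\<in>{1..n}. exp (u * Y k \<omega>))" for \<omega>
    unfolding reidx by (simp add: sum_distrib_left exp_sum)
  have "(\<Prod>k\<in>{1..n}. K.expectation (\<lambda>\<omega>. exp (u * Y k \<omega>))) = (\<Prod>k\<in>{1..n}. exp (\<alpha> * log_factor k u))"
    using has_integral_exp_Y u by (intro prod.cong) (auto simp: has_bochner_integral_iff)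
  also have "\<dots> = exp (\<alpha> * (\<Sum>k<n. log_factor (Suc k) u))"
    unfolding reidx by (simp add: sum_distrib_left exp_sum)
  finally show ?thesis
    unfolding eq has_bochner_integral_iff
    using K.indep_vars_integrable[OF _ ind int] K.indep_vars_lebesgue_integral[OF _ ind int] by simp
qed

lemma sum_log_factor_le: "- 1 < u \<Longrightarrow> (\<Sum>k<n. log_factor (Suc k) u) \<le> levy_integral u"
  using sum_le_suminf[OF sums_summable[OF log_factor_sums], of u "{..<n}"] sums_unique[OF log_factor_sums, of u]
    log_factor_nonneg[of "Suc _" u] by simp

text \<open>The variable whose law turns out, for \<open>\<alpha> = 1\<close>, to be that of the logarithm of the remainder.\<close>

definition X :: "'c \<Rightarrow> real" where
  "X \<omega> = - \<alpha> * gamma_const \<phi> + (\<Sum>k. Y (Suc k) \<omega>)"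

lemma measurable_X [measurable]: "X \<in> borel_measurable K"
  unfolding X_def[abs_def] by measurable

lemma exp_X: "exp (u * X \<omega>) = exp (- \<alpha> * gamma_const \<phi> * u) * exp (u * (\<Sum>k. Y (Suc k) \<omega>))"
  by (simp add: X_def algebra_simps flip: exp_add)

lemma AE_exp_partial_sum_tendsto:
  "AE \<omega> in K. (\<lambda>n. exp (u * (\<Sum>k<n. Y (Suc k) \<omega>))) \<longlonglongrightarrow> exp (u * (\<Sum>k. Y (Suc k) \<omega>))"
  using AE_summable_Y
proof eventually_elim
  case (elim \<omega>)
  then show ?case by (intro tendsto_exp tendsto_mult tendsto_const summable_LIMSEQ)
qed

text \<open>Fatou's lemma: the exponential moments of the partial sums are bounded.\<close>

lemma integrable_exp_X:
  assumes u: "- 1 < u"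
  shows "integrable K (\<lambda>\<omega>. exp (u * X \<omega>))"
proof -
  have [measurable]: "Y (Suc k) \<in> borel_measurable K" for k by (rule measurable_Y) simp
  have "(\<integral>\<^sup>+\<omega>. ennreal (exp (u * (\<Sum>k. Y (Suc k) \<omega>))) \<partial>K) =
      (\<integral>\<^sup>+\<omega>. liminf (\<lambda>n. ennreal (exp (u * (\<Sum>k<n. Y (Suc k) \<omega>)))) \<partial>K)"
    using AE_exp_partial_sum_tendsto
    by (intro nn_integral_cong_AE, eventually_elim)
       (intro lim_imp_Liminf[symmetric] tendsto_ennrealI trivial_limit_sequentially)
  also have "\<dots> \<le> liminf (\<lambda>n. \<integral>\<^sup>+\<omega>. ennreal (exp (u * (\<Sum>k<n. Y (Suc k) \<omega>))) \<partial>K)"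
    by (rule nn_integral_liminf) simp
  also have "\<dots> \<le> ennreal (exp (\<alpha> * levy_integral u))"
  proof (rule Liminf_le)
    show "\<forall>\<^sub>F n in sequentially. (\<integral>\<^sup>+\<omega>. ennreal (exp (u * (\<Sum>k<n. Y (Suc k) \<omega>))) \<partial>K) \<le> ennreal (exp (\<alpha> * levy_integral u))"
    proof (intro always_eventually allI)
      fix n
      have "(\<integral>\<^sup>+\<omega>. ennreal (exp (u * (\<Sum>k<n. Y (Suc k) \<omega>))) \<partial>K) = ennreal (exp (\<alpha> * (\<Sum>k<n. log_factor (Suc k) u)))"
        using has_integral_exp_partial_sum[OF u, of n]
        by (subst nn_integral_eq_integral) (auto simp: has_bochner_integral_iff)
      also have "\<dots> \<le> ennreal (exp (\<alpha> * levy_integral u))"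
        using sum_log_factor_le[OF u, of n] alpha_pos by (intro ennreal_leI) simp
      finally show "(\<integral>\<^sup>+\<omega>. ennreal (exp (u * (\<Sum>k<n. Y (Suc k) \<omega>))) \<partial>K) \<le> ennreal (exp (\<alpha> * levy_integral u))" .
    qed
  qed simp
  finally have "integrable K (\<lambda>\<omega>. exp (u * (\<Sum>k. Y (Suc k) \<omega>)))"
    by (intro integrableI_nonneg) (auto intro: order_le_less_trans)
  then show ?thesis unfolding exp_X by simp
qed

text \<open>The exponentials \<open>exp (u S\<^sub>n)\<close> of the partial sums are bounded in \<open>L\<^sup>2\<close>, since \<open>2 u\<close> is again an
  admissible exponent; for \<open>u\<close> close to \<open>-1\<close> this would fail.\<close>

lemma expectation_exp_X_nonneg:
  assumes u: "0 \<le> u"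
  shows "K.expectation (\<lambda>\<omega>. exp (u * X \<omega>)) = exp (\<alpha> * (- u * gamma_const \<phi> + levy_integral u))"
proof -
  have [measurable]: "Y (Suc k) \<in> borel_measurable K" for k by (rule measurable_Y) simp
  have u1: "- 1 < u" "- 1 < 2 * u" using u by auto
  let ?E = "\<lambda>n. K.expectation (\<lambda>\<omega>. exp (u * (\<Sum>k<n. Y (Suc k) \<omega>)))"
  have sq: "(exp (u * (\<Sum>k<n. Y (Suc k) \<omega>)))\<^sup>2 = exp (2 * u * (\<Sum>k<n. Y (Suc k) \<omega>))" for n \<omega>
    by (simp add: power2_eq_square flip: exp_add)
  have "?E \<longlonglongrightarrow> K.expectation (\<lambda>\<omega>. exp (u * (\<Sum>k. Y (Suc k) \<omega>)))"
  proof (rule K.expectation_tendsto_of_L2_bounded(2))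
    show "integrable K (\<lambda>\<omega>. (exp (u * (\<Sum>k<n. Y (Suc k) \<omega>)))\<^sup>2)" for n
      unfolding sq using has_integral_exp_partial_sum[OF u1(2)] by (simp add: has_bochner_integral_iff)
    show "K.expectation (\<lambda>\<omega>. (exp (u * (\<Sum>k<n. Y (Suc k) \<omega>)))\<^sup>2) \<le> exp (\<alpha> * levy_integral (2 * u))" for n
      unfolding sq has_bochner_integral_integral_eq[OF has_integral_exp_partial_sum[OF u1(2)]]
      using sum_log_factor_le[OF u1(2), of n] alpha_pos by simp
  qed (auto intro: AE_exp_partial_sum_tendsto)
  moreover have "?E \<longlonglongrightarrow> exp (\<alpha> * levy_integral u)"
    unfolding has_bochner_integral_integral_eq[OF has_integral_exp_partial_sum[OF u1(1)]]
    using log_factor_sums[OF u1(1)] unfolding sums_def by (intro tendsto_exp tendsto_mult tendsto_const)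
  ultimately have "K.expectation (\<lambda>\<omega>. exp (u * (\<Sum>k. Y (Suc k) \<omega>))) = exp (\<alpha> * levy_integral u)"
    by (rule LIMSEQ_unique)
  moreover have "K.expectation (\<lambda>\<omega>. exp (u * X \<omega>)) =
      exp (- \<alpha> * gamma_const \<phi> * u) * K.expectation (\<lambda>\<omega>. exp (u * (\<Sum>k. Y (Suc k) \<omega>)))"
    unfolding exp_X by simp
  ultimately show ?thesis by (simp add: algebra_simps flip: exp_add)
qed

text \<open>Both sides are holomorphic on \<open>Re z > -1\<close> and agree on \<open>(0, 1)\<close>. This extends the formula to negative
  real exponents and to the imaginary axis.\<close>

theorem expectation_complex_exp_X:
  assumes z: "- 1 < Re z"
  shows "(\<integral>\<omega>. exp (z * complex_of_real (X \<omega>)) \<partial>K) =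
    exp (of_real \<alpha> * (- z * of_real (gamma_const \<phi>) + complex_levy_integral z))"
proof -
  let ?M = "distr K borel X"
  let ?F = "\<lambda>z. \<integral>x. exp (z * complex_of_real x) \<partial>?M"
  let ?G = "\<lambda>z. exp (of_real \<alpha> * (- z * of_real (gamma_const \<phi>) + complex_levy_integral z))"
  let ?S = "{z. - 1 < Re z}"
  have int: "integrable ?M (\<lambda>x. exp (u * x))" if "u \<in> {- 1<..}" for u
    using integrable_exp_X[of u] that by (simp add: integrable_distr_eq)
  have "?F z = ?G z"
  proof (rule holomorphic_eq_of_real_interval[of ?F ?S ?G 0 1])
    show "?F holomorphic_on ?S"
      using Laplace_transform_holomorphic[OF sets_distr open_greaterThan int] by simp
    show "?G holomorphic_on ?S"
      by (intro holomorphic_intros complex_levy_integral_holomorphic)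
    show "open ?S" by (rule open_halfspace_Re_gt)
    show "connected ?S" by (intro convex_connected convex_halfspace_Re_gt)
    fix u :: real assume "0 < u" "u < 1"
    have "?F (of_real u) = of_real (\<integral>x. exp (u * x) \<partial>?M)"
      by (rule integral_exp_of_real)
    also have "(\<integral>x. exp (u * x) \<partial>?M) = exp (\<alpha> * (- u * gamma_const \<phi> + levy_integral u))"
      using expectation_exp_X_nonneg[of u] \<open>0 < u\<close> by (simp add: integral_distr)
    finally show "?F (of_real u) = ?G (of_real u)"
      by (simp add: complex_levy_integral_of_real flip: exp_of_real)
  qed (use z in auto)
  then show ?thesis by (simp add: integral_distr)
qed

lemma expectation_exp_X:
  assumes u: "- 1 < u"
  shows "K.expectation (\<lambda>\<omega>. exp (u * X \<omega>)) = exp (\<alpha> * (- u * gamma_const \<phi> + levy_integral u))"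
proof -
  have "complex_of_real (K.expectation (\<lambda>\<omega>. exp (u * X \<omega>))) =
      of_real (exp (\<alpha> * (- u * gamma_const \<phi> + levy_integral u)))"
    using expectation_complex_exp_X[of "of_real u"] u
    by (simp add: integral_exp_of_real complex_levy_integral_of_real flip: exp_of_real)
  then show ?thesis by (simp only: of_real_eq_iff)
qed

text \<open>The two series differ termwise by the convergent series of logarithmic factors at \<open>u = 1\<close>, whose sum
  is \<open>\<gamma> + ln (\<phi> 1)\<close>.\<close>

lemma series_representations:
  shows "AE \<omega> in K. summable (\<lambda>k. \<alpha> * ln (\<phi> (real (Suc k) + 1) / \<phi> (real (Suc k))) - G (Suc k) \<omega>)"
    and "AE \<omega> in K. X \<omega> = \<alpha> * ln (\<phi> 1) + (\<Sum>k. \<alpha> * ln (\<phi> (real (Suc k) + 1) / \<phi> (real (Suc k))) - G (Suc k) \<omega>)"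
proof -
  have eq: "\<alpha> * ln (\<phi> (real (Suc k) + 1) / \<phi> (real (Suc k))) - G (Suc k) \<omega> = Y (Suc k) \<omega> - \<alpha> * log_factor (Suc k) 1" for k \<omega>
    by (simp add: Y_def log_factor_def ln_phi_div algebra_simps)
  have s: "(\<lambda>k. \<alpha> * log_factor (Suc k) 1) sums (\<alpha> * levy_integral 1)"
    by (intro sums_mult log_factor_sums) simp
  show "AE \<omega> in K. summable (\<lambda>k. \<alpha> * ln (\<phi> (real (Suc k) + 1) / \<phi> (real (Suc k))) - G (Suc k) \<omega>)"
    unfolding eq using AE_summable_Y by eventually_elim (intro summable_diff sums_summable[OF s])
  show "AE \<omega> in K. X \<omega> = \<alpha> * ln (\<phi> 1) + (\<Sum>k. \<alpha> * ln (\<phi> (real (Suc k) + 1) / \<phi> (real (Suc k))) - G (Suc k) \<omega>)"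
    unfolding eq using AE_summable_Y
  proof eventually_elim
    case (elim \<omega>)
    have "(\<Sum>k. Y (Suc k) \<omega> - \<alpha> * log_factor (Suc k) 1) = (\<Sum>k. Y (Suc k) \<omega>) - \<alpha> * levy_integral 1"
      using sums_unique[OF sums_diff[OF summable_sums[OF elim] s]] by simp
    then show ?case by (simp add: X_def gamma_const_eq algebra_simps)
  qed
qed

end

section \<open>Infinite divisibility, the Levy measure and the remainder\<close>

lemma real_distribution_convolution_power:
  assumes "real_distribution \<nu>"
  shows "real_distribution (((\<lambda>\<rho>. \<nu> \<star> \<rho>) ^^ n) (return borel 0)) \<and>
    (\<integral>\<^sup>+x. ennreal (exp (u * x)) \<partial>((\<lambda>\<rho>. \<nu> \<star> \<rho>) ^^ n) (return borel 0)) =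
    (\<integral>\<^sup>+x. ennreal (exp (u * x)) \<partial>\<nu>) ^ n"
proof (induction n)
  case 0
  have "real_distribution (return borel (0::real))"
    by (auto simp: real_distribution_def real_distribution_axioms_def intro: prob_space_return)
  then show ?case by (simp add: nn_integral_return)
next
  case (Suc n)
  let ?\<rho> = "((\<lambda>\<rho>. \<nu> \<star> \<rho>) ^^ n) (return borel 0)"
  interpret \<nu>: real_distribution \<nu> by fact
  interpret \<rho>: real_distribution ?\<rho> using Suc by simp
  interpret P: pair_prob_space \<nu> ?\<rho> ..
  have "prob_space (\<nu> \<star> ?\<rho>)"
    unfolding convolution_def[of \<nu> ?\<rho>] by (rule P.prob_space_distr) simp
  then have "real_distribution (\<nu> \<star> ?\<rho>)"
    by (simp add: real_distribution_def real_distribution_axioms_def)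
  moreover have "(\<integral>\<^sup>+x. ennreal (exp (u * x)) \<partial>(\<nu> \<star> ?\<rho>)) =
      (\<integral>\<^sup>+x. \<integral>\<^sup>+y. ennreal (exp (u * x)) * ennreal (exp (u * y)) \<partial>?\<rho> \<partial>\<nu>)"
    by (subst nn_integral_convolution)
       (auto intro!: nn_integral_cong \<nu>.finite_measure_axioms \<rho>.finite_measure_axioms
         simp: distrib_left exp_add ennreal_mult)
  then have "(\<integral>\<^sup>+x. ennreal (exp (u * x)) \<partial>(\<nu> \<star> ?\<rho>)) =
      (\<integral>\<^sup>+x. ennreal (exp (u * x)) \<partial>\<nu>) * (\<integral>\<^sup>+x. ennreal (exp (u * x)) \<partial>?\<rho>)"
    by (simp add: nn_integral_cmult nn_integral_multc)
  ultimately show ?case using Suc by simp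
qed

text \<open>Non-measurable sets have measure \<open>0\<close> by convention. If a preimage were not measurable, its complement
  would not be either, so a set and its complement would both have image measure \<open>0\<close>.
  This yields the measurability of last positions from the fact that they have the law of a random
  variable.\<close>

lemma measurable_of_prob_space_distr:
  assumes "prob_space (distr M N f)" and f: "\<And>x. x \<in> space M \<Longrightarrow> f x \<in> space N"
  shows "f \<in> measurable M N"
proof (rule measurableI)
  interpret D: prob_space "distr M N f" by fact
  fix A assume A: "A \<in> sets N"
  let ?\<mu> = "\<lambda>A. emeasure M (f -` A \<inter> space M)"
  have le: "emeasure (distr M N f) A = ?\<mu> A \<or> emeasure (distr M N f) A = 0" if "A \<in> sets N" for A
    using that sets.space_closed[of N]
    by (auto simp: distr_def emeasure_measure_of_conv sets.sigma_sets_eq)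
  show "f -` A \<inter> space M \<in> sets M"
  proof (rule ccontr)
    assume n: "f -` A \<inter> space M \<notin> sets M"
    have "f -` (space N - A) \<inter> space M = space M - (f -` A \<inter> space M)"
      using f by auto
    moreover have "space M - (f -` A \<inter> space M) \<notin> sets M"
    proof
      assume "space M - (f -` A \<inter> space M) \<in> sets M"
      then have "space M - (space M - (f -` A \<inter> space M)) \<in> sets M" by (rule sets.compl_sets)
      moreover have "space M - (space M - (f -` A \<inter> space M)) = f -` A \<inter> space M" by auto
      ultimately show False using n by simp
    qed
    ultimately have "emeasure (distr M N f) A = 0" "emeasure (distr M N f) (space N - A) = 0"
      using le[OF A] le[OF sets.compl_sets[OF A]] n by (auto simp: emeasure_notin_sets)
    then have "emeasure (distr M N f) (A \<union> (space N - A)) = 0"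
      using A by (intro emeasure_Un_null_set[THEN trans]) (auto simp: null_sets_def)
    moreover have "A \<union> (space N - A) = space (distr M N f)"
      using sets.sets_into_space[OF A] by auto
    ultimately show False using D.emeasure_space_1 by simp
  qed
qed (rule f)

context Laplace_exponent
begin

lemma levy_integral_0: "levy_integral 0 = 0"
  by (simp add: levy_integral_def)

lemma set_integral_H:
  fixes f :: "real \<Rightarrow> real"
  assumes f: "integrable H f"
  shows "set_integrable H {0<..} f" and "(LINT x:{0<..}|H. f x) = (\<integral>x. f x \<partial>H)"
proof -
  have [measurable]: "f \<in> borel_measurable H" using f by simp
  show "set_integrable H {0<..} f"
    unfolding set_integrable_def by (rule integrable_mult_indicator[OF _ f]) simp
  show "(LINT x:{0<..}|H. f x) = (\<integral>x. f x \<partial>H)"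
    unfolding set_lebesgue_integral_def using AE_H_pos
    by (intro integral_cong_AE) (auto elim!: eventually_mono)
qed

definition levy_measure :: "real measure" where
  "levy_measure = distr (density H (\<lambda>x. indicator {0<..} x * ennreal (1 / (exp x - 1)))) borel uminus"

lemma levy_density_eq: "levy_density x = 1 / (exp x - 1)"
proof (cases "x = 0")
  case False
  have "exp x \<noteq> 1" using False by simp
  then show ?thesis by (simp add: levy_density_def exp_minus field_simps)
qed (simp add: levy_density_def)

lemma measurable_levy_density [measurable]: "levy_density \<in> borel_measurable borel"
  unfolding levy_density_def[abs_def] by measurable

lemma levy_measure_eq:
  "levy_measure = distr (density H (\<lambda>x. ennreal (indicator {0<..} x * levy_density x))) borel uminus"
proof -
  have "(\<lambda>x. indicator {0<..} x * ennreal (1 / (exp x - 1))) = (\<lambda>x. ennreal (indicator {0<..} x * levy_density x))"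
    by (auto simp: fun_eq_iff indicator_def levy_density_eq)
  then show ?thesis by (simp add: levy_measure_def)
qed

lemma nn_integral_levy_measure:
  assumes [measurable]: "f \<in> borel_measurable borel"
  shows "(\<integral>\<^sup>+x. f x \<partial>levy_measure) = (\<integral>\<^sup>+x. ennreal (levy_density x) * f (- x) \<partial>H)"
proof -
  have "(\<integral>\<^sup>+x. f x \<partial>levy_measure) = (\<integral>\<^sup>+x. ennreal (indicator {0<..} x * levy_density x) * f (- x) \<partial>H)"
    unfolding levy_measure_eq by (subst nn_integral_distr, simp, simp, subst nn_integral_density) auto
  also have "\<dots> = (\<integral>\<^sup>+x. ennreal (levy_density x) * f (- x) \<partial>H)"
    using AE_H_pos by (intro nn_integral_cong_AE) (auto elim!: eventually_mono)
  finally show ?thesis .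
qed

lemma integral_levy_measure:
  fixes f :: "real \<Rightarrow> complex"
  assumes [measurable]: "f \<in> borel_measurable borel"
  shows "(\<integral>x. f x \<partial>levy_measure) = (\<integral>x. of_real (levy_density x) * f (- x) \<partial>H)"
proof -
  have "(\<integral>x. f x \<partial>levy_measure) = (\<integral>x. (indicator {0<..} x * levy_density x) *\<^sub>R f (- x) \<partial>H)"
    unfolding levy_measure_eq
    by (subst integral_distr, simp, simp, subst integral_density)
       (auto intro!: AE_I2 simp: indicator_def levy_density_bounds)
  also have "\<dots> = (\<integral>x. of_real (levy_density x) * f (- x) \<partial>H)"
    using AE_H_pos
    by (intro integral_cong_AE) (auto elim!: eventually_mono simp: scaleR_conv_of_real)
  finally show ?thesis .
qed

text \<open>The exponent compensates jumps of all sizes by \<open>u x\<close>, while the Levy--Khintchine formula truncates at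
  \<open>|x| \<le> 1\<close>. The difference is the first moment of the large jumps, which moves into the drift; there is
  no Gaussian part.\<close>

lemma has_levy_measure_of_exponent:
  assumes char: "\<And>t. char \<mu> t = exp (- (\<i> * of_real t) * of_real g + complex_levy_integral (\<i> * of_real t))"
  shows "has_levy_measure \<mu> levy_measure"
  unfolding has_levy_measure_def
proof (intro conjI)
  let ?x2 = "\<lambda>x::real. x * exp (- 1 * x) + x\<^sup>2 * exp (- 1 * x)"
  have int2: "integrable H ?x2"
    using integrable_H_x[of 1] integrable_H_x2[of 1] by simp
  show "sets levy_measure = sets borel" by (simp add: levy_measure_def)
  show "emeasure levy_measure {0} = 0"
  proof -
    have "emeasure levy_measure {0} = (\<integral>\<^sup>+x. indicator {0} x \<partial>levy_measure)"
      by (subst nn_integral_indicator) (auto simp: levy_measure_def)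
    also have "\<dots> = (\<integral>\<^sup>+x. ennreal (levy_density x) * indicator {0} (- x) \<partial>H)"
      by (rule nn_integral_levy_measure) simp
    also have "\<dots> = (\<integral>\<^sup>+x. 0 \<partial>H)"
      using AE_H_pos by (intro nn_integral_cong_AE) (auto elim!: eventually_mono)
    finally show ?thesis by simp
  qed
  show "(\<integral>\<^sup>+x. ennreal (min 1 (x\<^sup>2)) \<partial>levy_measure) < \<infinity>"
  proof -
    have "(\<integral>\<^sup>+x. ennreal (min 1 (x\<^sup>2)) \<partial>levy_measure) = (\<integral>\<^sup>+x. ennreal (levy_density x) * ennreal (min 1 ((- x)\<^sup>2)) \<partial>H)"
      by (rule nn_integral_levy_measure) simp
    also have "\<dots> \<le> (\<integral>\<^sup>+x. ennreal (norm (?x2 x)) \<partial>H)"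
      using AE_H_pos
    proof (intro nn_integral_mono_AE, eventually_elim)
      case (elim x)
      have "levy_density x * min 1 (x\<^sup>2) \<le> levy_density x * x\<^sup>2"
        using levy_density_bounds(1)[OF elim(2)] by (intro mult_left_mono) auto
      also have "\<dots> = x * (x * levy_density x)" by (simp add: power2_eq_square)
      also have "\<dots> \<le> x * ((1 + x) * exp (- x))"
        using elim(2) by (intro mult_left_mono levy_density_bounds) auto
      also have "\<dots> \<le> norm (?x2 x)" by (simp add: power2_eq_square algebra_simps)
      finally show ?case
        using levy_density_bounds(1)[OF elim(2)] by (simp add: ennreal_leI flip: ennreal_mult)
    qed
    also have "\<dots> < \<infinity>" using int2 by (simp only: integrable_iff_bounded)
    finally show ?thesis .
  qed
  let ?h = "\<lambda>x. indicator {1<..} x * (x * levy_density x)"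
  \<comment> \<open>The contribution of the compensator beyond the truncation.\<close>
  define c where "c = (\<integral>x. ?h x \<partial>H)"
  have inth: "integrable H ?h"
  proof (rule integrable_H_le[OF int2])
    fix x :: real assume x: "0 < x"
    have "x * levy_density x \<le> (1 + x) * exp (- x)" by (rule levy_density_bounds[OF x])
    moreover have "(1 + x) * exp (- x) \<le> ?x2 x" if "1 < x"
    proof -
      have "1 * exp (- x) \<le> x\<^sup>2 * exp (- x)" using that by (intro mult_right_mono) auto
      then show ?thesis by (simp add: algebra_simps)
    qed
    ultimately show "norm (?h x) \<le> ?x2 x"
      using x levy_density_bounds(1)[OF x] by (auto simp: indicator_def)
  qed simp
  show "\<exists>b v. 0 \<le> v \<and> (\<forall>u. char \<mu> u = exp (\<i> * of_real (b * u) - of_real (v * u\<^sup>2 / 2) +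
      (\<integral>x. (iexp (u * x) - 1 - \<i> * of_real (u * x * indicator {-1..1} x)) \<partial>levy_measure)))"
  proof (rule exI[of _ "c - g"], rule exI[of _ "0::real"], intro conjI allI)
    fix u :: real
    let ?k = "\<lambda>x. (exp (- (\<i> * of_real u) * complex_of_real x) - 1 + (\<i> * of_real u) * of_real x) * of_real (levy_density x)"
    have intk: "integrable H ?k" by (rule integrable_levy_kernel) simp
    have "(\<integral>x. (iexp (u * x) - 1 - \<i> * of_real (u * x * indicator {-1..1} x)) \<partial>levy_measure) =
        (\<integral>x. of_real (levy_density x) * (iexp (u * - x) - 1 - \<i> * of_real (u * - x * indicator {-1..1} (- x))) \<partial>H)"
      by (rule integral_levy_measure) simp
    also have "\<dots> = (\<integral>x. ?k x - \<i> * of_real u * of_real (?h x) \<partial>H)"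
    proof (rule integral_cong_AE)
      show "AE x in H. of_real (levy_density x) * (iexp (u * - x) - 1 - \<i> * of_real (u * - x * indicator {-1..1} (- x))) =
          ?k x - \<i> * of_real u * of_real (?h x)"
        using AE_H_pos
      proof eventually_elim
        case (elim x)
        have ind: "indicator {-1..1} (- x) = 1 - (indicator {1<..} x :: real)"
          using elim by (auto simp: indicator_def)
        show ?case unfolding ind by (simp add: algebra_simps)
      qed
    qed simp_all
    also have "\<dots> = (\<integral>x. ?k x \<partial>H) - \<i> * of_real u * of_real c"
      using intk inth unfolding c_def
      by (subst Bochner_Integration.integral_diff) (auto simp: integral_complex_of_real simp del: of_real_mult)
    finally have eq: "(\<integral>x. (iexp (u * x) - 1 - \<i> * of_real (u * x * indicator {-1..1} x)) \<partial>levy_measure) =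
        complex_levy_integral (\<i> * of_real u) - \<i> * of_real u * of_real c"
      by (simp only: complex_levy_integral_def)
    show "char \<mu> u = exp (\<i> * of_real ((c - g) * u) - of_real (0 * u\<^sup>2 / 2) +
      (\<integral>x. (iexp (u * x) - 1 - \<i> * of_real (u * x * indicator {-1..1} x)) \<partial>levy_measure))"
      unfolding eq char by (simp add: algebra_simps)
  qed simp
qed

end

context independent_tilts
begin

lemma has_levy_measure_X:
  assumes "\<alpha> = 1"
  shows "has_levy_measure (distr K borel X) levy_measure"
proof (rule has_levy_measure_of_exponent)
  fix t :: real
  have "char (distr K borel X) t = (\<integral>\<omega>. exp ((\<i> * of_real t) * complex_of_real (X \<omega>)) \<partial>K)"
    unfolding char_def by (subst integral_distr) (auto simp: mult.assoc)
  also have "\<dots> = exp (of_real \<alpha> * (- (\<i> * of_real t) * of_real (gamma_const \<phi>) + complex_levy_integral (\<i> * of_real t)))"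
    by (rule expectation_complex_exp_X) simp
  finally show "char (distr K borel X) t =
      exp (- (\<i> * of_real t) * of_real (gamma_const \<phi>) + complex_levy_integral (\<i> * of_real t))"
    using assms by simp
qed

text \<open>Iterating the functional equation of the gamma function.\<close>

lemma moments_exp_X:
  assumes "\<alpha> = 1"
  shows "has_bochner_integral K (\<lambda>\<omega>. exp (X \<omega>) ^ n) (\<Prod>i=1..n. \<phi> (real i))"
proof -
  have eq: "exp (X \<omega>) ^ n = exp (real n * X \<omega>)" for \<omega> by (simp add: exp_of_nat_mult)
  have "K.expectation (\<lambda>\<omega>. exp (real n * X \<omega>)) = exp (- real n * gamma_const \<phi> + levy_integral (real n))"
    using expectation_exp_X[of "real n"] assms by simp
  also have "\<dots> = (\<Prod>i=1..n. \<phi> (real i))"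
  proof (induction n)
    case (Suc n)
    have "- real (Suc n) * gamma_const \<phi> + levy_integral (real (Suc n)) =
        (- real n * gamma_const \<phi> + levy_integral (real n)) + ln (\<phi> (real (Suc n)))"
      using levy_integral_shift[of "real n"] by (simp add: algebra_simps)
    then have "exp (- real (Suc n) * gamma_const \<phi> + levy_integral (real (Suc n))) =
        exp (- real n * gamma_const \<phi> + levy_integral (real n)) * \<phi> (real (Suc n))"
      by (simp only: exp_add) (simp add: phi_pos)
    then show ?case using Suc by simp
  qed (simp add: levy_integral_0)
  finally show ?thesis
    unfolding eq has_bochner_integral_iff using integrable_exp_X[of "real n"] by simp
qed

text \<open>\<open>R\<close> and \<open>exp X\<close> have the same moments \<open>\<phi> 1 \<cdots> \<phi> n \<le> (\<phi> 1)\<^sup>n n!\<close>, which determine the law.\<close>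

theorem distr_log_remainder:
  assumes "\<alpha> = 1" and R: "remainder \<phi> N R"
    and linear: "\<And>n. 1 \<le> n \<Longrightarrow> \<phi> (real n) \<le> real n * \<phi> 1"
  shows "distr N borel (\<lambda>\<omega>. ln (R \<omega>)) = distr K borel X"
proof -
  interpret N: prob_space N using R by (simp add: remainder_def)
  have [measurable]: "R \<in> borel_measurable N" and R0: "AE \<omega> in N. 0 < R \<omega>"
    using R by (auto simp: remainder_def)
  have p1: "0 < \<phi> 1" by (rule phi_pos) simp
  let ?m = "\<lambda>n. \<Prod>i=1..n. \<phi> (real i)"
  have "distr N borel R = distr K borel (\<lambda>\<omega>. exp (X \<omega>))"
  proof (rule moments_determine_distribution[where m="?m" and C="\<phi> 1"])
    show "real_distribution (distr N borel R)"
      by (auto simp: real_distribution_def real_distribution_axioms_def intro: N.prob_space_distr)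
    show "real_distribution (distr K borel (\<lambda>\<omega>. exp (X \<omega>)))"
      by (auto simp: real_distribution_def real_distribution_axioms_def intro: K.prob_space_distr)
    show "AE x in distr N borel R. 0 \<le> x"
      using R0 by (subst AE_distr_iff) (auto elim!: eventually_mono)
    show "AE x in distr K borel (\<lambda>\<omega>. exp (X \<omega>)). 0 \<le> x"
      by (subst AE_distr_iff) auto
    show "has_bochner_integral (distr N borel R) (\<lambda>x. x ^ n) (?m n)" for n
    proof (cases "1 \<le> n")
      case True
      then have "has_bochner_integral N (\<lambda>\<omega>. R \<omega> ^ n) (?m n)" using R by (simp add: remainder_def)
      then show ?thesis by (simp add: has_bochner_integral_iff integrable_distr_eq integral_distr)
    next
      case False
      interpret D: prob_space "distr N borel R" by (rule N.prob_space_distr) simp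
      from False have "n = 0" by simp
      then show ?thesis using D.prob_space by (simp add: has_bochner_integral_iff)
    qed
    show "has_bochner_integral (distr K borel (\<lambda>\<omega>. exp (X \<omega>))) (\<lambda>x. x ^ n) (?m n)" for n
      using moments_exp_X[OF assms(1), of n]
      by (simp add: has_bochner_integral_iff integrable_distr_eq integral_distr)
    show "?m n \<le> \<phi> 1 ^ n * fact n" for n
    proof (induction n)
      case (Suc n)
      have "?m (Suc n) = ?m n * \<phi> (real (Suc n))" by simp
      also have "\<dots> \<le> (\<phi> 1 ^ n * fact n) * (real (Suc n) * \<phi> 1)"
        using Suc linear[of "Suc n"] p1 phi_pos by (intro mult_mono) (auto intro: prod_nonneg less_imp_le)
      finally show ?case by (simp add: ac_simps)
    qed simp
  qed (rule p1)
  then have "distr (distr N borel R) borel ln = distr (distr K borel (\<lambda>\<omega>. exp (X \<omega>))) borel ln" by simp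
  then show ?thesis by (simp add: distr_distr o_def)
qed

end

context nontrivial_subordinator
begin

lemma AE_harmonic_potential_pos: "AE x in harmonic_potential M \<xi>. 0 < x"
  unfolding harmonic_potential_eq by (subst AE_density) (auto split: split_indicator)

sublocale Laplace_exponent \<phi> "harmonic_potential M \<xi>"
proof
  show "sets (harmonic_potential M \<xi>) = sets borel" by simp
  show "AE x in harmonic_potential M \<xi>. 0 < x" by (rule AE_harmonic_potential_pos)
  show "0 < \<phi> s" if "0 < s" for s using that by (rule exponent_pos)
  show "\<phi> s \<le> \<phi> t" if "0 < s" "s \<le> t" for s t using that by (intro exponent_mono) auto
  show "(\<integral>\<^sup>+x. ennreal ((1 - exp (- l * x)) * exp (- s * x)) \<partial>harmonic_potential M \<xi>) =
    ennreal (ln (\<phi> (s + l) / \<phi> s))" if "0 < s" "0 \<le> l" for s l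
    using that by (rule nn_integral_harmonic_potential)
qed

text \<open>A space carrying independent variables with the tilted potentials as laws. The index \<open>0\<close> is a dummy,
  for which \<open>max 1 k\<close> supplies some probability measure.\<close>

definition tilted_product :: "real \<Rightarrow> (nat \<Rightarrow> real) measure" where
  "tilted_product \<alpha> = PiM UNIV (\<lambda>k. tilted_potential \<alpha> (real (max 1 k)))"

lemma independent_tilts_product:
  assumes \<alpha>: "0 < \<alpha>"
  shows "independent_tilts \<phi> (harmonic_potential M \<xi>)
    (tilted_product \<alpha>) (\<lambda>k \<omega>. \<omega> k) \<alpha>"
proof -
  define T where "T k = tilted_potential \<alpha> (real (max 1 k))" for k
  let ?T = "T"
  let ?K = "tilted_product \<alpha>"
  have K_def: "?K = PiM UNIV T" by (simp add: tilted_product_def T_def[abs_def])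
  have T: "real_distribution (?T k)" for k
    unfolding T_def by (rule real_distribution_tilted_potential[OF \<alpha>]) simp
  have Tp: "prob_space (?T k)" for k using T[of k] by (simp add: real_distribution_def)
  have T_sets [measurable_cong]: "sets (?T k) = sets borel" for k
    by (rule real_distribution.events_eq_borel[OF T])
  have [measurable_cong]: "sets ?K = sets (PiM UNIV (\<lambda>_. borel))"
    unfolding K_def by (rule sets_PiM_cong) (simp_all add: T_sets)
  interpret K: prob_space ?K unfolding K_def by (rule prob_space_PiM[OF Tp])
  have comp: "distr ?K borel (\<lambda>\<omega>. \<omega> k) = ?T k" for k
  proof -
    have "distr ?K borel (\<lambda>\<omega>. \<omega> k) = distr ?K (?T k) (\<lambda>\<omega>. \<omega> k)"
      by (rule distr_cong) (simp_all add: T_sets)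
    then show ?thesis using distr_PiM_component[of UNIV T k] Tp unfolding K_def by simp
  qed
  have rv: "(\<lambda>\<omega>. \<omega> k) \<in> borel_measurable ?K" for k :: nat
    by measurable
  show ?thesis
  proof (unfold_locales)
    show "0 < \<alpha>" by fact
    have "K.indep_vars (\<lambda>_. borel) (\<lambda>k \<omega>. \<omega> k) UNIV"
    proof (subst K.indep_vars_iff_distr_eq_PiM')
      have "distr ?K (PiM UNIV (\<lambda>_. borel)) (\<lambda>x. \<lambda>i\<in>UNIV. x i) = ?K"
        unfolding restrict_UNIV by (rule distr_id2) (simp add: \<open>sets ?K = _\<close>)
      then show "distr ?K (PiM UNIV (\<lambda>_. borel)) (\<lambda>x. \<lambda>i\<in>UNIV. x i) = PiM UNIV (\<lambda>i. distr ?K borel (\<lambda>\<omega>. \<omega> i))"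
        by (simp only: K_def comp[unfolded K_def])
    qed (use rv in auto)
    then show "K.indep_vars (\<lambda>_. borel) (\<lambda>k \<omega>. \<omega> k) {1..}"
      by (rule K.indep_vars_subset) simp
    fix k :: nat and u :: real assume k: "1 \<le> k" "- real k < u"
    have "(\<integral>\<^sup>+\<omega>. ennreal (exp (- u * \<omega> k)) \<partial>?K) = (\<integral>\<^sup>+x. ennreal (exp (- u * x)) \<partial>distr ?K borel (\<lambda>\<omega>. \<omega> k))"
      by (subst nn_integral_distr) (auto simp: rv)
    also have "\<dots> = (\<integral>\<^sup>+x. ennreal (exp (- u * x)) \<partial>tilted_potential \<alpha> (real k))"
      using k by (simp only: comp T_def max_absorb2)
    also have "\<dots> = ennreal ((\<phi> (real k) / \<phi> (real k + u)) powr \<alpha>)"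
      using k by (intro nn_integral_tilted_potential[OF \<alpha>]) auto
    finally show "(\<integral>\<^sup>+\<omega>. ennreal (exp (- u * \<omega> k)) \<partial>?K) = ennreal ((\<phi> (real k) / \<phi> (real k + u)) powr \<alpha>)" .
  qed
qed

text \<open>The \<open>n\<close>-th root is the law of the series built from the exponent \<open>\<phi>\<close> to the power \<open>1 / n\<close>: the \<open>n\<close>-th
  power of its Laplace transform is that of \<open>\<mu>\<close>.\<close>

lemma infinitely_divisible_of_exponent:
  assumes \<mu>: "real_distribution \<mu>"
    and int: "\<And>u. - 1 < u \<Longrightarrow> integrable \<mu> (\<lambda>x. exp (u * x))"
    and eq: "\<And>u. - 1 < u \<Longrightarrow> (\<integral>x. exp (u * x) \<partial>\<mu>) = exp (- u * gamma_const \<phi> + levy_integral u)"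
  shows "infinitely_divisible \<mu>"
  unfolding infinitely_divisible_def
proof (intro allI impI)
  fix n :: nat assume n: "1 \<le> n"
  let ?K = "tilted_product (1 / real n)"
  interpret T: independent_tilts \<phi> "harmonic_potential M \<xi>" ?K "\<lambda>k \<omega>. \<omega> k" "1 / real n"
    using n by (intro independent_tilts_product) simp
  let ?\<nu> = "distr ?K borel T.X"
  let ?\<rho> = "((\<lambda>\<rho>. ?\<nu> \<star> \<rho>) ^^ n) (return borel 0)"
  have \<nu>: "real_distribution ?\<nu>"
    by (auto simp: real_distribution_def real_distribution_axioms_def intro: T.K.prob_space_distr)
  have \<rho>: "real_distribution ?\<rho>"
    using real_distribution_convolution_power[OF \<nu>] by blast
  have E: "has_bochner_integral ?\<rho> (\<lambda>x. exp (u * x)) (exp (- u * gamma_const \<phi> + levy_integral u))" if u: "- 1 < u" for u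
  proof (rule has_bochner_integral_nn_integral)
    show "(\<lambda>x. exp (u * x)) \<in> borel_measurable ?\<rho>"
      using real_distribution.events_eq_borel[OF \<rho>] by (simp cong: measurable_cong_sets)
    have "(\<integral>\<^sup>+x. ennreal (exp (u * x)) \<partial>?\<nu>) = (\<integral>\<^sup>+\<omega>. ennreal (exp (u * T.X \<omega>)) \<partial>?K)"
      by (rule nn_integral_distr) simp_all
    also have "\<dots> = ennreal (exp (1 / real n * (- u * gamma_const \<phi> + levy_integral u)))"
      unfolding T.expectation_exp_X[OF u, symmetric]
      by (intro nn_integral_eq_integral T.integrable_exp_X[OF u]) simp
    finally have "(\<integral>\<^sup>+x. ennreal (exp (u * x)) \<partial>?\<rho>) =
        ennreal (exp (1 / real n * (- u * gamma_const \<phi> + levy_integral u))) ^ n"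
      using real_distribution_convolution_power[OF \<nu>, of n u] by (simp only: conjunct2)
    also have "\<dots> = ennreal (exp (real n * (1 / real n * (- u * gamma_const \<phi> + levy_integral u))))"
      by (simp only: ennreal_power exp_ge_zero exp_of_nat_mult)
    also have "real n * (1 / real n * (- u * gamma_const \<phi> + levy_integral u)) = - u * gamma_const \<phi> + levy_integral u"
      using n by simp
    finally show "(\<integral>\<^sup>+x. ennreal (exp (u * x)) \<partial>?\<rho>) = ennreal (exp (- u * gamma_const \<phi> + levy_integral u))" .
  qed auto
  have "?\<rho> = \<mu>"
    by (rule Laplace_transform_unique[OF \<rho> \<mu>, of "- 1" 1])
       (use E int eq in \<open>auto simp: has_bochner_integral_iff\<close>)
  with \<nu> show "\<exists>\<nu>. real_distribution \<nu> \<and> ((\<lambda>\<rho>. \<nu> \<star> \<rho>) ^^ n) (return borel 0) = \<mu>" by blast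
qed

lemma independent_tilts_last_position:
  assumes e: "\<And>k. 1 \<le> k \<Longrightarrow> independent_exponential M \<xi> (real k) (e k)"
    and K: "prob_space K" "prob_space.indep_vars K (\<lambda>_. borel) G {1..}"
    and G: "\<And>k. 1 \<le> k \<Longrightarrow> distr K borel (G k) = distr M borel (\<lambda>\<omega>. last_position \<xi> (e k \<omega>) \<omega>)"
  shows "independent_tilts \<phi> (harmonic_potential M \<xi>) K G 1"
proof -
  interpret K: prob_space K by fact
  show ?thesis
  proof (unfold_locales)
    show "K.indep_vars (\<lambda>_. borel) G {1..}" by fact
    fix k :: nat and u :: real assume k: "1 \<le> k" "- real k < u"
    have Gm [measurable]: "G k \<in> borel_measurable K"
      using K(2) k by (auto simp: K.indep_vars_def)
    have "prob_space (distr M borel (\<lambda>\<omega>. last_position \<xi> (e k \<omega>) \<omega>))"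
      unfolding G[OF k(1), symmetric] by (rule K.prob_space_distr) simp
    then have [measurable]: "(\<lambda>\<omega>. last_position \<xi> (e k \<omega>) \<omega>) \<in> borel_measurable M"
      by (rule measurable_of_prob_space_distr) simp
    have "(\<integral>\<^sup>+\<omega>. ennreal (exp (- u * G k \<omega>)) \<partial>K) = (\<integral>\<^sup>+x. ennreal (exp (- u * x)) \<partial>distr K borel (G k))"
      by (subst nn_integral_distr) auto
    also have "\<dots> = (\<integral>\<^sup>+\<omega>. ennreal (exp (- u * last_position \<xi> (e k \<omega>) \<omega>)) \<partial>M)"
      unfolding G[OF k(1)] by (subst nn_integral_distr) auto
    also have "\<dots> = ennreal (\<phi> (real k) / \<phi> (real k + u))"
      using k by (intro nn_integral_last_position e) auto
    finally show "(\<integral>\<^sup>+\<omega>. ennreal (exp (- u * G k \<omega>)) \<partial>K) = ennreal ((\<phi> (real k) / \<phi> (real k + u)) powr 1)"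
      using exponent_pos[of "real k"] exponent_pos[of "real k + u"] k by simp
  qed simp
qed

end

theorem theorem3:
  fixes M :: "'a measure" and \<xi> :: "real \<Rightarrow> 'a \<Rightarrow> ennreal"
    and N :: "'b measure" and R :: "'b \<Rightarrow> real"
    and \<phi> :: "real \<Rightarrow> real" and H :: "real measure"
  assumes "subordinator M \<xi>"
    and phi: "\<phi> = laplace_exponent M \<xi>"
    and "\<exists>u\<ge>0. \<phi> u \<noteq> 0"
    and H: "H = harmonic_potential M \<xi>"
    and "remainder \<phi> N R"
  shows
    "convergent (gamma_seq \<phi>) \<and>
     (\<forall>s>0. convergent_prod (\<lambda>n. gamma_factor \<phi> s (Suc n))) \<and>
     (\<forall>u>-1.
        integrable N (\<lambda>\<omega>. R \<omega> powr u) \<and>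
        ln (\<integral>\<omega>. R \<omega> powr u \<partial>N) = ln (gen_Gamma \<phi> (u + 1)) \<and>
        set_integrable H {0<..} (\<lambda>x. (exp (- u * x) - 1 + u * x) * (exp (- x) / (1 - exp (- x)))) \<and>
        ln (gen_Gamma \<phi> (u + 1)) =
          - u * gamma_const \<phi> +
          (LINT x:{0<..}|H. (exp (- u * x) - 1 + u * x) * (exp (- x) / (1 - exp (- x))))) \<and>
     infinitely_divisible (distr N borel (\<lambda>\<omega>. ln (R \<omega>))) \<and>
     has_levy_measure (distr N borel (\<lambda>\<omega>. ln (R \<omega>)))
       (distr (density H (\<lambda>x. indicator {0<..} x * ennreal (1 / (exp x - 1)))) borel uminus) \<and>
     (\<forall>k::nat\<ge>1.
        set_integrable H {0<..} (\<lambda>x. (1 - exp (- x)) * exp (- real k * x)) \<and>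
        (LINT x:{0<..}|H. (1 - exp (- x)) * exp (- real k * x)) =
          ln (\<phi> (real k + 1) / \<phi> (real k))) \<and>
     (\<forall>(e :: nat \<Rightarrow> 'a \<Rightarrow> real) (K :: 'c measure) (G :: nat \<Rightarrow> 'c \<Rightarrow> real).
        (\<forall>k\<ge>1. independent_exponential M \<xi> (real k) (e k)) \<and>
        prob_space K \<and>
        prob_space.indep_vars K (\<lambda>_. borel) G {1..} \<and>
        (\<forall>k\<ge>1. distr K borel (G k) = distr M borel (\<lambda>\<omega>. last_position \<xi> (e k \<omega>) \<omega>)) \<longrightarrow>
        (\<forall>k\<ge>1.
           integrable K (G k) \<and>
           (\<integral>\<omega>. G k \<omega> \<partial>K) = deriv \<phi> (real k) / \<phi> (real k) \<and>
           - ln (\<integral>\<omega>. exp (- G k \<omega>) \<partial>K) =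
             (LINT x:{0<..}|H. (1 - exp (- x)) * exp (- real k * x))) \<and>
        (let \<phi>1 = (\<lambda>k. - ln (\<integral>\<omega>. exp (- G k \<omega>) \<partial>K)) in
           (AE \<omega> in K. summable (\<lambda>k. \<phi>1 (Suc k) - G (Suc k) \<omega>)) \<and>
           (AE \<omega> in K. summable (\<lambda>k. (\<integral>\<omega>'. G (Suc k) \<omega>' \<partial>K) - G (Suc k) \<omega>)) \<and>
           distr N borel (\<lambda>\<omega>. ln (R \<omega>)) =
             distr K borel (\<lambda>\<omega>. ln (\<phi> 1) + (\<Sum>k. \<phi>1 (Suc k) - G (Suc k) \<omega>)) \<and>
           distr N borel (\<lambda>\<omega>. ln (R \<omega>)) =
             distr K borel (\<lambda>\<omega>. - gamma_const \<phi> +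
               (\<Sum>k. (\<integral>\<omega>'. G (Suc k) \<omega>' \<partial>K) - G (Suc k) \<omega>))))"
proof -
  let "_ \<and> ?products \<and> ?transform \<and> _ \<and> _ \<and> ?increments \<and> ?series" = ?thesis
  interpret S: nontrivial_subordinator M \<xi>
    using assms by unfold_locales auto
  have \<phi>: "S.\<phi> = \<phi>" by (simp add: S.\<phi>_def phi)
  interpret L: Laplace_exponent \<phi> H
    using S.Laplace_exponent_axioms by (simp only: \<phi> H)
  interpret N: prob_space N using assms(5) by (simp add: remainder_def)
  have [measurable]: "R \<in> borel_measurable N" and R0: "AE \<omega> in N. 0 < R \<omega>"
    using assms(5) by (auto simp: remainder_def)
  let ?\<mu> = "distr N borel (\<lambda>\<omega>. ln (R \<omega>))"
  have linear: "\<phi> (real n) \<le> real n * \<phi> 1" if "1 \<le> n" for n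
    using S.exponent_le_linear[OF that] by (simp only: \<phi>)
  define K0 where "K0 = S.tilted_product 1"
  interpret T: independent_tilts \<phi> H K0 "\<lambda>k \<omega>. \<omega> k" 1
    using S.independent_tilts_product[of 1] by (simp only: \<phi> H K0_def zero_less_one)
  have law: "?\<mu> = distr K0 borel T.X"
    by (rule T.distr_log_remainder[OF refl assms(5) linear])
  have \<mu>: "real_distribution ?\<mu>"
    by (auto simp: real_distribution_def real_distribution_axioms_def intro: N.prob_space_distr)
  have E: "integrable ?\<mu> (\<lambda>x. exp (u * x))"
    "(\<integral>x. exp (u * x) \<partial>?\<mu>) = exp (- u * gamma_const \<phi> + L.levy_integral u)" if u: "- 1 < u" for u
    using T.integrable_exp_X[OF u] T.expectation_exp_X[OF u]
    by (simp_all add: law integrable_distr_eq integral_distr)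
  have powr: "AE \<omega> in N. R \<omega> powr u = exp (u * ln (R \<omega>))" for u
    using R0 by eventually_elim (simp add: powr_def)
  have powr_int: "integrable N (\<lambda>\<omega>. R \<omega> powr u)"
    "(\<integral>\<omega>. R \<omega> powr u \<partial>N) = gen_Gamma \<phi> (u + 1)" if u: "- 1 < u" for u
  proof -
    have "integrable N (\<lambda>\<omega>. exp (u * ln (R \<omega>)))"
      using E(1)[OF u] by (simp add: integrable_distr_eq)
    then show "integrable N (\<lambda>\<omega>. R \<omega> powr u)"
      by (subst integrable_cong_AE[OF _ _ powr]) simp_all
    have "(\<integral>\<omega>. R \<omega> powr u \<partial>N) = (\<integral>\<omega>. exp (u * ln (R \<omega>)) \<partial>N)"
      by (rule integral_cong_AE[OF _ _ powr]) simp_all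
    then show "(\<integral>\<omega>. R \<omega> powr u \<partial>N) = gen_Gamma \<phi> (u + 1)"
      using E(2)[OF u] by (simp add: integral_distr L.gen_Gamma_eq[OF u])
  qed
  have kernel: "integrable H (\<lambda>x. (exp (- u * x) - 1 + u * x) * (exp (- x) / (1 - exp (- x))))"
    "L.levy_integral u = (\<integral>x. (exp (- u * x) - 1 + u * x) * (exp (- x) / (1 - exp (- x))) \<partial>H)" if u: "- 1 < u" for u
    using L.integrable_real_levy_kernel[OF u] by (simp_all only: L.levy_density_def L.levy_integral_def)
  have id: "infinitely_divisible ?\<mu>"
    by (rule S.infinitely_divisible_of_exponent[unfolded \<phi> H[symmetric], OF \<mu> E])
  have levy: "has_levy_measure ?\<mu> (distr (density H (\<lambda>x. indicator {0<..} x * ennreal (1 / (exp x - 1)))) borel uminus)"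
    using T.has_levy_measure_X unfolding law L.levy_measure_def by simp
  have phik: "integrable H (\<lambda>x. (1 - exp (- x)) * exp (- real k * x))"
    "(\<integral>x. (1 - exp (- x)) * exp (- real k * x) \<partial>H) = ln (\<phi> (real k + 1) / \<phi> (real k))" if "1 \<le> k" for k :: nat
    using L.has_integral_H[of "real k" 1] that by (simp_all add: has_bochner_integral_iff)
  have phik': "(LINT x:{0<..}|H. (1 - exp (- x)) * exp (- real k * x)) = ln (\<phi> (real k + 1) / \<phi> (real k))"
    if "1 \<le> k" for k :: nat
    using L.set_integral_H(2)[OF phik(1)[OF that]] phik(2)[OF that] by simp
  have products: ?products
    by (intro allI impI L.convergent_prod_gamma_factor) simp
  have transform: ?transform
  proof (intro allI impI conjI)
    fix u :: real assume u: "- 1 < u"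
    show "integrable N (\<lambda>\<omega>. R \<omega> powr u)" "ln (\<integral>\<omega>. R \<omega> powr u \<partial>N) = ln (gen_Gamma \<phi> (u + 1))"
      using powr_int[OF u] by simp_all
    show "set_integrable H {0<..} (\<lambda>x. (exp (- u * x) - 1 + u * x) * (exp (- x) / (1 - exp (- x))))"
      by (rule L.set_integral_H(1)[OF kernel(1)[OF u]])
    show "ln (gen_Gamma \<phi> (u + 1)) = - u * gamma_const \<phi> +
          (LINT x:{0<..}|H. (exp (- u * x) - 1 + u * x) * (exp (- x) / (1 - exp (- x))))"
      unfolding L.set_integral_H(2)[OF kernel(1)[OF u]] kernel(2)[OF u, symmetric] L.gen_Gamma_eq[OF u]
      by simp
  qed
  have increments: ?increments
    by (intro allI impI conjI L.set_integral_H(1) phik(1) phik')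
  have series: ?series
  proof (intro allI impI, goal_cases)
    case hyp: (1 e K G)
    interpret I: independent_tilts \<phi> H K G 1
      using S.independent_tilts_last_position[of e K G] hyp by (simp add: \<phi> H)
    have [measurable]: "G (Suc k) \<in> borel_measurable K" for k by (rule I.measurable_G) simp
    have mean: "integrable K (G k)" "(\<integral>\<omega>. G k \<omega> \<partial>K) = L.tilted_mean (real k)" if "1 \<le> k" for k
      using I.mean_G[OF that] by simp_all
    have phi1: "- ln (\<integral>\<omega>. exp (- G k \<omega>) \<partial>K) = ln (\<phi> (real k + 1) / \<phi> (real k))" if "1 \<le> k" for k
      using I.has_integral_exp_G[OF that, of 1] that
      by (simp add: has_bochner_integral_iff L.ln_phi_div)
    have law': "?\<mu> = distr K borel I.X"
      by (rule I.distr_log_remainder[OF refl assms(5) linear])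
    have Y: "(\<integral>\<omega>'. G (Suc k) \<omega>' \<partial>K) - G (Suc k) \<omega> = I.Y (Suc k) \<omega>" for k \<omega>
      by (simp add: I.Y_def mean)
    have X: "distr K borel I.X = distr K borel (\<lambda>\<omega>. ln (\<phi> 1) + (\<Sum>k. ln (\<phi> (real (Suc k) + 1) / \<phi> (real (Suc k))) - G (Suc k) \<omega>))"
      using I.series_representations(2) by (intro distr_cong_AE) simp_all
    have phi1': "- ln (\<integral>\<omega>. exp (- G (Suc k) \<omega>) \<partial>K) = ln (\<phi> (real (Suc k) + 1) / \<phi> (real (Suc k)))" for k
      by (rule phi1) simp
    have mean': "(\<integral>\<omega>. G k \<omega> \<partial>K) = deriv \<phi> (real k) / \<phi> (real k)" if "1 \<le> k" for k
      using mean(2)[OF that] L.deriv_phi[of "real k"] that by simp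
    show ?case
      unfolding Let_def Y phi1'
      using mean(1) mean' phi1 phik' I.AE_summable_Y I.series_representations(1) law' X
      by (simp add: I.X_def[abs_def])
  qed
  show ?thesis
    by (intro conjI L.convergent_gamma_seq products transform id levy increments series)
qed

end
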